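(* Let $\mathcal S=\{\phi_e\}_{e\in E}$ be a Lüroth system, let $f=f_{\mathcal S}:J_{\mathcal S}\to J_{\mathcal S}$ be the corresponding map, and let $\tilde f:J_{\mathcal S}\times\overline{J_{\mathcal S}}\to J_{\mathcal S}\times\overline{J_{\mathcal S}}$ be the natural extension of $f$. Let $\phi:J_{\mathcal S}\times\overline{J_{\mathcal S}}\to\mathbb R$ be a potential such that $\widehat\phi=\phi\circ p_J\circ\hat\pi:E^{\mathbb Z}\to\mathbb R$ is locally Hölder continuous and summable. Then, for $\mu_\phi\circ p_1^{-1}$-a.e. $x\in J_{\mathcal S}$, the conditional measure $\mu_\phi^x$ is exact dimensional on $\overline{J_{\mathcal S}}$, and moreover $$\lim_{r\to0}\frac{\log\mu_\phi^x(B(y,r))}{\log r}=\frac{h_{\mu_\phi}(\tilde f)}{\chi_{\mu_\phi}(\tilde f)}$$ for $\mu_\phi^x$-a.e. $y\in\overline{J_{\mathcal S}}$; hence, equivalently, for $\mu_\phi$-a.e. $(x,y)\in J_{\mathcal S}\times\overline{J_{\mathcal S}}$. In particular, if $\phi:J_{\mathcal S}\times\overline{J_{\mathcal S}}\to\mathbb R$ is a locally Hölder continuous potential with $\widehat\phi$ summable, or if $\phi(x,y)=\theta(x)$ where $\theta:J_{\mathcal S}\to\mathbb R$ is such that $\theta\circ\pi_{\mathcal S}:E^{\{0,1,2,\ldots\}}\to\mathbb R$ is locally Hölder continuous and summable, then for $\mu_\phi\circ p_1^{-1}$-a.e. $x\in J_{\mathcal S}$ the conditional measure $\mu_\phi^x$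 is exact dimensional on $\overline{J_{\mathcal S}}$, and $\lim_{r\to0}\frac{\log\mu_\phi^x(B(y,r))}{\log r}=\frac{h_{\mu_\phi}(\tilde f)}{\chi_{\mu_\phi}(\tilde f)}$ for $\mu_\phi^x$-a.e. $y\in\overline{J_{\mathcal S}}$; hence, equivalently, for $\mu_\phi$-a.e. $(x,y)\in J_{\mathcal S}\times\overline{J_{\mathcal S}}$.
   Context: **Lüroth system.** $I=[0,1]$, $E$ countable, $\phi_e:I\to I$, $\phi_e(x)=a_ex+b_e$ with $a_e\in(0,1)$, the sets $\mathrm{Int}(\phi_e(I))$ are pairwise disjoint, and $\mathrm{Leb}(\bigcup_{e\in E}\phi_e(I))=1$. The coding is $\{\pi_{\mathcal S}(\omega)\}=\bigcap_n\phi_{\omega_0}\circ\cdots\circ\phi_{\omega_{n-1}}(I)$ for $\omega\in E^{\{0,1,2,\ldots\}}$, and $J_{\mathcal S}$ is the image of $\pi_{\mathcal S}$. The associated map is $f(x)=a_e^{-1}x-a_e^{-1}b_e$ if $x\in\mathrm{Int}(\phi_e(I))$ and $f(x)=0$ if $x\notin\bigcup_e\mathrm{Int}(\phi_e(I))$. The natural extension is $\tilde f(x,y)=(f(x),a_ey+b_e)$ if $x\in\mathrm{Int}(\phi_e(I))$ and $\tilde f(x,y)=(0,0)$ if $x\notin\bigcup_e\mathrm{Int}(\phi_e(I))$ (the value on this last exceptional set plays no role). **Symbolic notions.** $\sigma$ is the left shift on $E^{\{0,1,\ldots\}}$ or $E^{\mathbb Z}$. A real function $g$ on $E^{\{0,1,\ldots\}}$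 (resp. $E^{\mathbb Z}$) is locally Hölder continuous if there are $C,\beta>0$ with $|g(\omega)-g(\tau)|\le Ce^{-\beta n}$ whenever $n\ge0$ and $\omega_k=\tau_k$ for $0\le k\le n$ (resp. $|k|\le n$); it is summable if $\sum_{e\in E}\exp(\sup g|_{[e]})<\infty$, $[e]=\{\omega:\omega_0=e\}$. Pressure: $P(g)=\lim_n\frac1n\log\sum_{|\omega|=n}\exp(\sup_{[\omega]}S_ng)$. For $g$ locally Hölder and summable, $\mu_g$ is the unique shift-invariant Gibbs state: $C^{-1}\le\mu_g([\omega_0\ldots\omega_{n-1}])/\exp(S_ng(\omega)-nP(g))\le C$ for some $C\ge1$. A potential on $J_{\mathcal S}\times\overline{J_{\mathcal S}}$ is called locally Hölder continuous if its composition $\widehat\phi$ with the coding is. **Measures.** $p_J\circ\hat\pi:E^{\mathbb Z}\to J_{\mathcal S}\times\overline{J_{\mathcal S}}$ is $\tau\mapsto(\pi_{\mathcal S}(\tau_0\tau_1\ldots),\pi_{\mathcal S}(\tau_{-1}\tau_{-2}\ldots))$; $p_1(x,y)=x$; $\mu_\phi:=\mu_{\widehat\phi}\circ(p_J\circ\hat\pi)^{-1}$ is the equilibrium measure of $\phi$ for $\tilde f$; $\mu_\phi^x$ are its Rokhlin conditional measures for the partition into fibers $\{x\}\times\overline{J_{\mathcal S}}$, viewed on $\overline{J_{\mathcal S}}$. $h_\mu(\tilde f)$ is measure-theoretic entropy; $\chi_\mu(\tilde f)=-\int\log a_{e(x)}\,d\mu(x,y)$ where $x\in\mathrm{Int}(\phi_{e(x)}(I))$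 ($\mu$-a.e. defined). A measure $\mu$ is exact dimensional if $\lim_{r\to0}\log\mu(B(x,r))/\log r$ exists and is constant $\mu$-a.e.
   Formalization: The formal theorem additionally assumes that the entropy h and the Lyapunov exponent χ of μ_φ are not both infinite, since for an infinite alphabet the quotient h/χ would otherwise be the undefined ∞/∞; the case h finite, χ infinite (dimension 0) is kept. *)

theory Defs
  imports "HOL-Probability.Probability"
begin

text \<open>
  The countable alphabet \<open>E\<close> is a type of class \<^class>\<open>countable\<close> (finite types included). A Lueroth
  system is given by the slopes \<open>a\<close> and the translations \<open>b\<close> of its affine branches.
\<close>

definition branch :: "('e \<Rightarrow> real) \<Rightarrow> ('e \<Rightarrow> real) \<Rightarrow> 'e \<Rightarrow> real \<Rightarrow> real" where
  "branch a b e x = a e * x + b e"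

definition luroth_system :: "('e::countable \<Rightarrow> real) \<Rightarrow> ('e \<Rightarrow> real) \<Rightarrow> bool" where
  "luroth_system a b \<longleftrightarrow>
     (\<forall>e. 0 < a e \<and> a e < 1) \<and>
     (\<forall>e. branch a b e ` {0..1} \<subseteq> {0..1}) \<and>
     disjoint_family (\<lambda>e. interior (branch a b e ` {0..1})) \<and>
     emeasure lborel (\<Union>e. branch a b e ` {0..1}) = 1"

primrec branch_word :: "('e \<Rightarrow> real) \<Rightarrow> ('e \<Rightarrow> real) \<Rightarrow> (nat \<Rightarrow> 'e) \<Rightarrow> nat \<Rightarrow> real \<Rightarrow> real" where
  "branch_word a b \<omega> 0 = id"
| "branch_word a b \<omega> (Suc n) = branch_word a b \<omega> n \<circ> branch a b (\<omega> n)"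

definition coding :: "('e \<Rightarrow> real) \<Rightarrow> ('e \<Rightarrow> real) \<Rightarrow> (nat \<Rightarrow> 'e) \<Rightarrow> real" where
  "coding a b \<omega> = (THE x. x \<in> (\<Inter>n. branch_word a b \<omega> n ` {0..1}))"

definition limit_set :: "('e \<Rightarrow> real) \<Rightarrow> ('e \<Rightarrow> real) \<Rightarrow> real set" where
  "limit_set a b = range (coding a b)"

text \<open>The coding \<open>p\<^sub>J \<circ> \<pi>\<close> of the two-sided shift: the second coordinate reads the past
  \<open>\<tau>\<^sub>-\<^sub>1 \<tau>\<^sub>-\<^sub>2 \<dots>\<close>.\<close>

definition coding2 :: "('e \<Rightarrow> real) \<Rightarrow> ('e \<Rightarrow> real) \<Rightarrow> (int \<Rightarrow> 'e) \<Rightarrow> real \<times> real" where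
  "coding2 a b \<tau> = (coding a b (\<lambda>n. \<tau> (int n)), coding a b (\<lambda>n. \<tau> (- int n - 1)))"

text \<open>The index \<open>e(x)\<close> is meaningful only on \<open>\<Union>\<^sub>e Int (\<phi>\<^sub>e I)\<close>, the regular set. The maps below
  are total on the line and the plane; a point of the limit set on the boundary of a branch may be
  sent to a point outside the limit set.\<close>

definition regular_set :: "('e \<Rightarrow> real) \<Rightarrow> ('e \<Rightarrow> real) \<Rightarrow> real set" where
  "regular_set a b = (\<Union>e. interior (branch a b e ` {0..1}))"

definition digit :: "('e \<Rightarrow> real) \<Rightarrow> ('e \<Rightarrow> real) \<Rightarrow> real \<Rightarrow> 'e" where
  "digit a b x = (THE e. x \<in> interior (branch a b e ` {0..1}))"

definition luroth_map :: "('e \<Rightarrow> real) \<Rightarrow> ('e \<Rightarrow> real) \<Rightarrow> real \<Rightarrow> real" where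
  "luroth_map a b x =
     (if x \<in> regular_set a b
      then inverse (a (digit a b x)) * x - inverse (a (digit a b x)) * b (digit a b x)
      else 0)"

definition natural_extension :: "('e \<Rightarrow> real) \<Rightarrow> ('e \<Rightarrow> real) \<Rightarrow> real \<times> real \<Rightarrow> real \<times> real" where
  "natural_extension a b = (\<lambda>(x, y).
     (if x \<in> regular_set a b
      then (luroth_map a b x, a (digit a b x) * y + b (digit a b x))
      else (0, 0)))"

definition locally_holder_one_sided :: "((nat \<Rightarrow> 'e) \<Rightarrow> real) \<Rightarrow> bool" where
  "locally_holder_one_sided g \<longleftrightarrow>
     (\<exists>C>0. \<exists>\<beta>>0. \<forall>(n::nat) \<omega> \<tau>. (\<forall>k\<le>n. \<omega> k = \<tau> k) \<longrightarrow>
        \<bar>g \<omega> - g \<tau>\<bar> \<le> C * exp (- \<beta> * real n))"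

definition locally_holder_two_sided :: "((int \<Rightarrow> 'e) \<Rightarrow> real) \<Rightarrow> bool" where
  "locally_holder_two_sided g \<longleftrightarrow>
     (\<exists>C>0. \<exists>\<beta>>0. \<forall>(n::nat) \<omega> \<tau>. (\<forall>k. \<bar>k\<bar> \<le> int n \<longrightarrow> \<omega> k = \<tau> k) \<longrightarrow>
        \<bar>g \<omega> - g \<tau>\<bar> \<le> C * exp (- \<beta> * real n))"

definition locally_holder_potential ::
    "('e \<Rightarrow> real) \<Rightarrow> ('e \<Rightarrow> real) \<Rightarrow> (real \<times> real \<Rightarrow> real) \<Rightarrow> bool" where
  "locally_holder_potential a b \<phi> \<longleftrightarrow> locally_holder_two_sided (\<phi> \<circ> coding2 a b)"

text \<open>Summability of a potential on a one-sided (\<open>'i = nat\<close>) or two-sided (\<open>'i = int\<close>) shift. The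
  supremum is a real one, so its finiteness is required explicitly.\<close>

definition summable_potential :: "(('i::zero \<Rightarrow> 'e) \<Rightarrow> real) \<Rightarrow> bool" where
  "summable_potential g \<longleftrightarrow>
     (\<forall>e. bdd_above (g ` {\<omega>. \<omega> 0 = e})) \<and>
     (\<lambda>e. exp (SUP \<omega>\<in>{\<omega>. \<omega> 0 = e}. g \<omega>)) summable_on UNIV"

definition shift :: "(int \<Rightarrow> 'e) \<Rightarrow> int \<Rightarrow> 'e" where
  "shift \<omega> = (\<lambda>k. \<omega> (k + 1))"

definition cylinder :: "'e list \<Rightarrow> (int \<Rightarrow> 'e) set" where
  "cylinder w = {\<omega>. \<forall>k<length w. \<omega> (int k) = w ! k}"

definition birkhoff_sum :: "((int \<Rightarrow> 'e) \<Rightarrow> real) \<Rightarrow> nat \<Rightarrow> (int \<Rightarrow> 'e) \<Rightarrow> real" where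
  "birkhoff_sum g n \<omega> = (\<Sum>k<n. g ((shift ^^ k) \<omega>))"

definition pressure :: "((int \<Rightarrow> 'e) \<Rightarrow> real) \<Rightarrow> real" where
  "pressure g =
     lim (\<lambda>n. ln (\<Sum>\<^sub>\<infinity>w\<in>{w. length w = n}. exp (SUP \<omega>\<in>cylinder w. birkhoff_sum g n \<omega>)) / real n)"

definition invariant_gibbs_state ::
    "((int \<Rightarrow> 'e::countable) \<Rightarrow> real) \<Rightarrow> (int \<Rightarrow> 'e) measure \<Rightarrow> bool" where
  "invariant_gibbs_state g M \<longleftrightarrow>
     prob_space M \<and>
     sets M = sets (PiM UNIV (\<lambda>_. count_space UNIV)) \<and>
     distr M M shift = M \<and>
     (\<exists>C\<ge>1. \<forall>\<omega> n.
        inverse C \<le> measure M (cylinder (map (\<lambda>k. \<omega> (int k)) [0..<n]))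
                     / exp (birkhoff_sum g n \<omega> - real n * pressure g) \<and>
        measure M (cylinder (map (\<lambda>k. \<omega> (int k)) [0..<n]))
                     / exp (birkhoff_sum g n \<omega> - real n * pressure g) \<le> C)"

definition base_space :: "('e \<Rightarrow> real) \<Rightarrow> ('e \<Rightarrow> real) \<Rightarrow> real measure" where
  "base_space a b = restrict_space borel (limit_set a b)"

definition fibre_space :: "('e \<Rightarrow> real) \<Rightarrow> ('e \<Rightarrow> real) \<Rightarrow> real measure" where
  "fibre_space a b = restrict_space borel (closure (limit_set a b))"

text \<open>The invariant Gibbs state of \<open>\<phi> \<circ> coding2 a b\<close> exists and is unique when this potential is
  locally Hoelder and summable; \<open>\<mu>\<^sub>\<phi>\<close> is specified by a predicate rather than by a
  choice of that Gibbs state.\<close>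

definition equilibrium_measure ::
    "('e::countable \<Rightarrow> real) \<Rightarrow> ('e \<Rightarrow> real) \<Rightarrow> (real \<times> real \<Rightarrow> real) \<Rightarrow> (real \<times> real) measure \<Rightarrow> bool"
  where
  "equilibrium_measure a b \<phi> \<mu> \<longleftrightarrow>
     (\<exists>M. invariant_gibbs_state (\<phi> \<circ> coding2 a b) M \<and>
          \<mu> = distr M (base_space a b \<Otimes>\<^sub>M fibre_space a b) (coding2 a b))"

text \<open>Rokhlin conditional measures of \<open>\<mu>\<close> for the partition into fibres \<open>{x} \<times> Y\<close>, viewed on
  \<open>Y\<close>: any version of the disintegration of \<open>\<mu>\<close> over its first marginal.\<close>

definition conditional_measures ::
    "'x measure \<Rightarrow> 'y measure \<Rightarrow> ('x \<times> 'y) measure \<Rightarrow> ('x \<Rightarrow> 'y measure) \<Rightarrow> bool" where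
  "conditional_measures X Y \<mu> \<kappa> \<longleftrightarrow>
     \<kappa> \<in> X \<rightarrow>\<^sub>M prob_algebra Y \<and>
     (\<forall>A\<in>sets (X \<Otimes>\<^sub>M Y).
        emeasure \<mu> A = (\<integral>\<^sup>+x. emeasure (\<kappa> x) (Pair x -` A) \<partial>distr \<mu> X fst))"

definition finite_partitions :: "'x measure \<Rightarrow> 'x set set set" where
  "finite_partitions M = {P. finite P \<and> P \<subseteq> sets M \<and> partition_on (space M) P}"

text \<open>The sum is the usual one, \<open>0 * ln 0\<close> being \<open>0\<close>.\<close>

definition partition_entropy :: "'x measure \<Rightarrow> 'x set set \<Rightarrow> real" where
  "partition_entropy M P = - (\<Sum>A\<in>P. measure M A * ln (measure M A))"

text \<open>The join of \<open>P, T\<^sup>-\<^sup>1 P, \<dots>, T\<^sup>-\<^sup>(\<^sup>n\<^sup>-\<^sup>1\<^sup>) P\<close>. The map \<open>T\<close> need preserve the space only up to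
  a null set; points whose orbit leaves the space lie in no atom.\<close>

definition refined_partition ::
    "'x measure \<Rightarrow> ('x \<Rightarrow> 'x) \<Rightarrow> 'x set set \<Rightarrow> nat \<Rightarrow> 'x set set" where
  "refined_partition M T P n =
     (\<lambda>A. {z \<in> space M. \<forall>k<n. (T ^^ k) z \<in> A k}) ` ({..<n} \<rightarrow>\<^sub>E P)"

definition ks_entropy :: "'x measure \<Rightarrow> ('x \<Rightarrow> 'x) \<Rightarrow> ereal" where
  "ks_entropy M T =
     (SUP P\<in>finite_partitions M.
        ereal (lim (\<lambda>n. partition_entropy M (refined_partition M T P n) / real n)))"

text \<open>The integrand \<open>- ln a\<^sub>e\<close> is positive, so the integral exists in \<open>[0, \<infinity>]\<close>. For an infinite
  alphabet both the entropy and the exponent can be infinite; their quotient is then undefined,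
  although \<open>\<infinity> / \<infinity> = 0\<close> holds in type \<^typ>\<open>ereal\<close>.\<close>

definition lyapunov_exponent ::
    "('e \<Rightarrow> real) \<Rightarrow> ('e \<Rightarrow> real) \<Rightarrow> (real \<times> real) measure \<Rightarrow> ereal" where
  "lyapunov_exponent a b \<mu> =
     enn2ereal (\<integral>\<^sup>+(x, y). ennreal (- ln (a (digit a b x))) \<partial>\<mu>)"

text \<open>Balls are those of the metric space \<^term>\<open>space M\<close>. The convention \<open>ln 0 = 0\<close> matters only at
  points outside the support of \<open>M\<close>, a null set.\<close>

definition has_local_dimension :: "'x::metric_space measure \<Rightarrow> 'x \<Rightarrow> ereal \<Rightarrow> bool" where
  "has_local_dimension M y d \<longleftrightarrow>
     ((\<lambda>r. ereal (ln (measure M (ball y r \<inter> space M)) / ln r)) \<longlongrightarrow> d) (at_right 0)"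

definition exact_dimensional :: "'x::metric_space measure \<Rightarrow> bool" where
  "exact_dimensional M \<longleftrightarrow> (\<exists>d::real. AE y in M. has_local_dimension M y (ereal d))"

end

theory Submission
  imports Defs
begin

text \<open>
  Write \<open>M\<close> for the invariant Gibbs state on the two-sided shift, \<open>g\<close> for its potential and
  \<open>P\<close> for the pressure. Birkhoff sums add along concatenations, so the Gibbs inequality makes
  \<open>M\<close> multiplicative up to a constant: the mass of the cylinder of \<open>uv\<close> lies within a factor
  \<open>C\<^sup>3\<close> of the product of the masses of the cylinders of \<open>u\<close> and \<open>v\<close>
  (\<open>cylinder_append_upper\<close>, \<open>cylinder_append_lower\<close>). The whole argument rests on this fact.

  The first consequence is that past and future are almost independent: approximating by
  finite words extends the comparison to all events of the past and of the future
  (\<open>past_future\<close>). Let \<open>\<nu>\<close> be the law of the point of the line that is coded by the past.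
  For almost every \<open>x\<close> the conditional measure \<open>\<kappa> x\<close> and \<open>\<nu>\<close> give every ball the same mass up to
  the factor \<open>C\<^sup>3\<close> (\<open>AE_comparable\<close>), and a constant factor does not change a local dimension.
  Hence everything reduces to the local dimension of the single measure \<open>\<nu>\<close>.

  The second consequence is ergodicity (\<open>ergodic\<close>). The ergodic theorem for the inverse shift,
  applied to \<open>P - g\<close> and to \<open>- ln a\<close> of the symbol at \<open>0\<close>, shows that the cylinder of generation
  \<open>n\<close> around a typical point has mass about \<open>exp (- n h)\<close> and length about \<open>exp (- n \<chi>)\<close>, where
  \<open>h\<close> is the integral of \<open>P - g\<close> and \<open>\<chi>\<close> that of \<open>- ln a\<close>. A ball contains the
  cylinders around its centre that are shorter than its radius, which bounds the dimension from
  above by \<open>h / \<chi>\<close>. In the other direction a ball can meet many cylinders of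
  generation \<open>n\<close>. However, a ball of radius \<open>r\<close> meets at most four of those that have length at
  least \<open>r\<close>, their interiors being disjoint; counting the balls of too large a mass and the
  Borel-Cantelli lemma exclude them almost surely (\<open>AE_ball_mass_upper\<close>).

  Thirdly, \<open>h\<close> is the entropy of the natural extension (\<open>ks_entropy_eq\<close>). The coding
  conjugates the shift to the natural extension outside the null set of orbits that meet an
  endpoint. The entropy of a finite partition is at most \<open>h\<close> by comparing the law of its
  itineraries with that of a noisy block code of the symbols (\<open>entropy_bound_via_code\<close>). The bound
  is attained in the limit by the partitions that read the first symbol truncated at \<open>N\<close>: their
  laws are multiplicative up to a constant too, so their entropy rate can be read
  off from words of a fixed length (\<open>truncated_rate_approximates\<close>).

  If \<open>\<chi>\<close> is finite, so is \<open>h\<close>, by comparison with Lebesgue measure (\<open>gibbs_entropy_finite\<close>). If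
  \<open>\<chi>\<close> is infinite, then \<open>h\<close> is finite because the quotient is defined, and the bound from above
  alone shows that the dimension is \<open>0\<close>.
\<close>

section \<open>Entropy, subadditive sequences and the ergodic theorem\<close>

text \<open>The tangent line bound \<open>ln t \<le> t - 1\<close> at \<open>t = r i / p i\<close>, summed with weights \<open>p i\<close>.\<close>

lemma gibbs_inequality:
  fixes p r :: "'a \<Rightarrow> real"
  assumes "finite S" and p: "\<And>i. i \<in> S \<Longrightarrow> 0 \<le> p i" and r: "\<And>i. i \<in> S \<Longrightarrow> 0 \<le> r i"
    and ac: "\<And>i. i \<in> S \<Longrightarrow> 0 < p i \<Longrightarrow> 0 < r i"
    and sums: "sum r S \<le> sum p S"
  shows "- (\<Sum>i\<in>S. p i * ln (p i)) \<le> - (\<Sum>i\<in>S. p i * ln (r i))"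
proof -
  have *: "p i * ln (r i) - p i * ln (p i) \<le> r i - p i" if i: "i \<in> S" for i
  proof (cases "p i = 0")
    case True
    then show ?thesis using r[OF i] by simp
  next
    case False
    then have pos: "0 < p i" "0 < r i" using p[OF i] ac[OF i] by auto
    have "ln (r i) - ln (p i) = ln (r i / p i)"
      using pos by (simp add: ln_div)
    also have "\<dots> \<le> r i / p i - 1"
      using pos by (intro ln_le_minus_one) simp
    finally have "p i * (ln (r i) - ln (p i)) \<le> p i * (r i / p i - 1)"
      using pos by (intro mult_left_mono) auto
    then show ?thesis using pos by (simp add: algebra_simps)
  qed
  have "(\<Sum>i\<in>S. p i * ln (r i) - p i * ln (p i)) \<le> (\<Sum>i\<in>S. r i - p i)"
    by (rule sum_mono) (rule *)
  with sums show ?thesis by (simp add: sum_subtractf)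
qed

text \<open>A block of length \<open>m\<close> that nearly attains the infimum of \<open>u m / m\<close> controls all longer blocks.\<close>

lemma fekete:
  fixes u :: "nat \<Rightarrow> real"
  assumes sub: "\<And>m n. u (m + n) \<le> u m + u n" and nonneg: "\<And>n. 0 \<le> u n"
  shows "convergent (\<lambda>n. u n / real n)"
proof -
  define L where "L = (INF n\<in>{1..}. u n / real n)"
  have bdd: "bdd_below ((\<lambda>n. u n / real n) ` {1..})"
    by (rule bdd_belowI[of _ 0]) (auto intro!: divide_nonneg_nonneg nonneg)
  have L_le: "L \<le> u n / real n" if "n \<ge> 1" for n
    unfolding L_def using that by (intro cINF_lower bdd) auto
  have mult: "u (q * m + s) \<le> real q * u m + u s" for q m s
  proof (induction q)
    case (Suc q)
    have "u (Suc q * m + s) \<le> u m + u (q * m + s)"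
      using sub[of m "q * m + s"] by (simp add: add.assoc)
    with Suc show ?case by (simp add: algebra_simps)
  qed simp
  have "(\<lambda>n. u n / real n) \<longlonglongrightarrow> L"
  proof (rule LIMSEQ_I)
    fix e :: real assume "e > 0"
    have "\<exists>m\<in>{1..}. u m / real m < L + e / 2"
      using \<open>e > 0\<close> bdd unfolding L_def by (subst cINF_less_iff[symmetric]) auto
    then obtain m where m: "m \<ge> 1" "u m / real m < L + e / 2" by auto
    define B where "B = (\<Sum>s<m. u s)"
    have B: "u s \<le> B" if "s < m" for s
      unfolding B_def using that by (intro member_le_sum nonneg) auto
    obtain N where N: "real N > 2 * B / e" using reals_Archimedean2 by blast
    show "\<exists>no. \<forall>n\<ge>no. norm (u n / real n - L) < e"
    proof (intro exI allI impI)
      fix n assume n: "n \<ge> max 1 N"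
      have "u n \<le> real (n div m) * u m + u (n mod m)"
        using mult[of "n div m" m "n mod m"] by simp
      also have "\<dots> \<le> (real n / real m) * u m + B"
        using m by (intro add_mono mult_right_mono nonneg B)
          (auto simp: real_of_nat_div real_of_int_div4 of_nat_div_le_of_nat)
      finally have "u n / real n \<le> u m / real m + B / real n"
        using n m by (simp add: field_simps)
      moreover have "B / real n < e / 2"
      proof -
        have "2 * B / e < real n" using N n by linarith
        then show ?thesis using n \<open>e > 0\<close> by (simp add: field_simps)
      qed
      ultimately have "u n / real n < L + e" using m by linarith
      moreover have "L \<le> u n / real n" using n by (intro L_le) auto
      ultimately show "norm (u n / real n - L) < e" by simp
    qed
  qed
  then show ?thesis by (rule convergentI)
qed

context prob_space
begin

text \<open>The maximal sums \<open>m n x\<close>, the maximum of the first \<open>n + 1\<close> nonempty Birkhoff sums at \<open>x\<close>, satisfy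
  \<open>m (n + 1) - m n \<circ> T = f + max 0 (- m n \<circ> T)\<close>. The left side has nonnegative integral, since
  \<open>T\<close> preserves the measure and \<open>m\<close> increases with \<open>n\<close>. On the invariant set
  where \<open>m n\<close> is unbounded the right side tends to \<open>f\<close>; if this set had full measure,
  the integral of \<open>f\<close> would be nonnegative.\<close>

lemma ergodic_sums_bounded_above:
  fixes f :: "'a \<Rightarrow> real"
  assumes T [measurable]: "T \<in> M \<rightarrow>\<^sub>M M" and inv: "distr M M T = M"
    and erg: "\<And>A. A \<in> sets M \<Longrightarrow> (\<And>x. x \<in> space M \<Longrightarrow> T x \<in> A \<longleftrightarrow> x \<in> A) \<Longrightarrow> prob A = 0 \<or> prob A = 1"
    and f: "integrable M f" and neg: "integral\<^sup>L M f < 0"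
  shows "AE x in M. \<exists>K. \<forall>n. (\<Sum>k<n. f ((T ^^ k) x)) \<le> K"
proof -
  have f_meas [measurable]: "f \<in> borel_measurable M" using f by simp
  define m where "m = rec_nat f (\<lambda>n g x. f x + max 0 (g (T x)))"
  have m0: "m 0 x = f x" for x by (simp add: m_def)
  have mS: "m (Suc n) x = f x + max 0 (m n (T x))" for n x by (simp add: m_def)
  have int_T: "integrable M (\<lambda>x. g (T x)) \<and> (\<integral>x. g (T x) \<partial>M) = integral\<^sup>L M g"
    if g: "integrable M g" for g :: "'a \<Rightarrow> real"
    using integrable_distr[OF T, of g] integral_distr[OF T, of g] g inv by auto
  have int_m: "integrable M (m n)" for n
  proof (induction n)
    case 0
    then show ?case using f by (simp add: m0[abs_def])
  next
    case (Suc n)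
    have "integrable M (\<lambda>x. f x + max 0 (m n (T x)))"
      using int_T[OF Suc] f by auto
    then show ?case by (simp add: mS[abs_def])
  qed
  have m_meas [measurable]: "m n \<in> borel_measurable M" for n using int_m[of n] by simp
  have m_mono: "m n x \<le> m (Suc n) x" for n x
  proof (induction n arbitrary: x)
    case (Suc n)
    show ?case using Suc[of "T x"] by (simp add: mS)
  qed (simp add: m0 mS)
  have m_inc: "m n x \<le> m k x" if "n \<le> k" for n k x
    by (rule lift_Suc_mono_le[of "\<lambda>n. m n x", OF m_mono that])
  define D where "D n x = f x + max 0 (- m n (T x))" for n x
  have D_eq: "D n x = m (Suc n) x - m n (T x)" for n x by (simp add: D_def mS)
  have D_int: "0 \<le> integral\<^sup>L M (D n)" for n
  proof -
    have "integral\<^sup>L M (D n) = integral\<^sup>L M (m (Suc n)) - integral\<^sup>L M (m n)"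
      unfolding D_eq[abs_def] using int_m[of "Suc n"] int_T[OF int_m[of n]] by simp
    also have "\<dots> \<ge> 0" using int_m m_mono by (simp add: integral_mono)
    finally show ?thesis by simp
  qed
  define B where "B = {x\<in>space M. \<forall>i::nat. \<exists>n. real i < m n x}"
  have B_meas [measurable]: "B \<in> sets M" unfolding B_def by measurable
  have B_inv: "T x \<in> B \<longleftrightarrow> x \<in> B" if x: "x \<in> space M" for x
  proof
    assume "T x \<in> B"
    show "x \<in> B" unfolding B_def
    proof (intro CollectI conjI x allI)
      fix i :: nat
      obtain j :: nat where j: "real j > real i - f x" using reals_Archimedean2 by blast
      from \<open>T x \<in> B\<close> obtain n where "real j < m n (T x)" unfolding B_def by auto
      then have "real i < m (Suc n) x" using j by (simp add: mS)
      then show "\<exists>n. real i < m n x" ..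
    qed
  next
    assume "x \<in> B"
    show "T x \<in> B" unfolding B_def
    proof (intro CollectI conjI allI)
      show "T x \<in> space M" using x T by (rule measurable_space[rotated])
      fix i :: nat
      obtain j :: nat where j: "real j > real i + \<bar>f x\<bar>" using reals_Archimedean2 by blast
      from \<open>x \<in> B\<close> obtain n where n: "real j < m n x" unfolding B_def by auto
      then obtain n' where "n = Suc n'" using j by (cases n) (auto simp: m0)
      then have "real i < m n' (T x)" using n j by (simp add: mS max_def split: if_splits)
      then show "\<exists>n. real i < m n (T x)" ..
    qed
  qed
  have "prob B \<noteq> 1"
  proof
    assume "prob B = 1"
    then have AE_B: "AE x in M. x \<in> B" by (simp add: AE_in_set_eq_1)
    have "(\<lambda>n. integral\<^sup>L M (D n)) \<longlonglongrightarrow> integral\<^sup>L M f"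
    proof (rule integral_dominated_convergence[where w = "\<lambda>x. \<bar>f x\<bar> + \<bar>f (T x)\<bar>"])
      show "integrable M (\<lambda>x. \<bar>f x\<bar> + \<bar>f (T x)\<bar>)" using f int_T[OF f] by auto
      show "AE x in M. (\<lambda>n. D n x) \<longlonglongrightarrow> f x"
        using AE_B
      proof (eventually_elim)
        case (elim x)
        then have "T x \<in> B" using B_inv by (auto simp: B_def)
        then have "\<exists>n. real 0 < m n (T x)" unfolding B_def by blast
        then obtain n where n: "0 < m n (T x)" by auto
        have "D k x = f x" if "k \<ge> n" for k
          using m_inc[OF that, of "T x"] n by (simp add: D_def)
        then show ?case by (intro tendsto_eventually) (auto simp: eventually_sequentially)
      qed
      show "AE x in M. norm (D n x) \<le> \<bar>f x\<bar> + \<bar>f (T x)\<bar>" for n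
      proof (intro AE_I2)
        fix x
        have "m 0 (T x) \<le> m n (T x)" by (rule m_inc) simp
        then show "norm (D n x) \<le> \<bar>f x\<bar> + \<bar>f (T x)\<bar>" by (auto simp: D_def m0 max_def)
      qed
    qed (auto simp: D_def[abs_def])
    then have "0 \<le> integral\<^sup>L M f" by (rule LIMSEQ_le_const) (auto intro: D_int)
    with neg show False by simp
  qed
  then have "prob B = 0" using erg[OF B_meas B_inv] by auto
  then have "AE x in M. x \<notin> B" by (simp add: prob_eq_0)
  then show ?thesis
  proof (rule AE_mp, intro AE_I2 impI)
    fix x assume "x \<in> space M" "x \<notin> B"
    then obtain i :: nat where i: "\<And>n. m n x \<le> real i" unfolding B_def by (auto simp: not_less)
    have S: "(\<Sum>k<Suc j. f ((T ^^ k) y)) \<le> m j y" for j :: nat and y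
    proof (induction j arbitrary: y)
      case (Suc j)
      have "(\<Sum>k<Suc (Suc j). f ((T ^^ k) y)) = f y + (\<Sum>k<Suc j. f ((T ^^ k) (T y)))"
        by (subst sum.lessThan_Suc_shift) (simp add: funpow_swap1)
      with Suc[of "T y"] show ?case by (simp add: mS)
    qed (simp add: m0)
    have "(\<Sum>k<n. f ((T ^^ k) x)) \<le> real i" for n :: nat
    proof (cases n)
      case (Suc n')
      have "(\<Sum>k<Suc n'. f ((T ^^ k) x)) \<le> m n' x" by (rule S)
      then show ?thesis using Suc i[of n'] by simp
    qed simp
    then show "\<exists>K. \<forall>n. (\<Sum>k<n. f ((T ^^ k) x)) \<le> K" by blast
  qed
qed

text \<open>The value \<open>\<infinity>\<close> is included: both bounds come from the boundedness of the sums of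
  \<open>f - e\<close> and of \<open>e - min f N\<close>, the second applies when the integral of \<open>f\<close> is infinite.\<close>

lemma ergodic_theorem_nonneg:
  fixes f :: "'a \<Rightarrow> real"
  assumes T [measurable]: "T \<in> M \<rightarrow>\<^sub>M M" and inv: "distr M M T = M"
    and erg: "\<And>A. A \<in> sets M \<Longrightarrow> (\<And>x. x \<in> space M \<Longrightarrow> T x \<in> A \<longleftrightarrow> x \<in> A) \<Longrightarrow> prob A = 0 \<or> prob A = 1"
    and f [measurable]: "f \<in> borel_measurable M" and nonneg: "\<And>x. 0 \<le> f x"
  shows "AE x in M. (\<lambda>n. ereal ((\<Sum>k<n. f ((T ^^ k) x)) / real n))
           \<longlonglongrightarrow> enn2ereal (\<integral>\<^sup>+x. ennreal (f x) \<partial>M)"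
proof -
  define L where "L = (\<integral>\<^sup>+x. ennreal (f x) \<partial>M)"
  define S where "S g n x = (\<Sum>k<n. g ((T ^^ k) x))" for g :: "'a \<Rightarrow> real" and n x
  have S_const: "S (\<lambda>x. g x - c) n x = S g n x - c * real n"
    "S (\<lambda>x. c - g x) n x = c * real n - S g n x" for g c n x
    by (simp_all add: S_def sum_subtractf)
  have S_nonneg: "0 \<le> S f n x" for n x unfolding S_def by (intro sum_nonneg nonneg)
  have upper: "AE x in M. eventually (\<lambda>n. S f n x / real n < d) sequentially"
    if c: "L \<le> ennreal c" "0 \<le> c" "c < d" for c d
  proof -
    \<comment> \<open>The sums of \<open>f - e\<close> stay bounded, and the gap between \<open>e\<close> and \<open>d\<close> absorbs the bound.\<close>
    define e where "e = (c + d) / 2"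
    have e: "c < e" "e < d" using c by (auto simp: e_def)
    have fin: "L < \<infinity>" using c by (auto simp: ennreal_less_top top.not_eq_extremum intro: le_less_trans)
    have int: "integrable M f" using fin nonneg unfolding L_def by (intro integrableI_nonneg) auto
    have "ennreal (integral\<^sup>L M f) = L"
      unfolding L_def using nonneg int by (intro nn_integral_eq_integral[symmetric]) auto
    then have "integral\<^sup>L M f \<le> c" using c ennreal_le_iff by metis
    then have "integral\<^sup>L M (\<lambda>x. f x - e) < 0" using e int by (simp add: prob_space)
    then have "AE x in M. \<exists>K. \<forall>n. S (\<lambda>x. f x - e) n x \<le> K"
      unfolding S_def by (intro ergodic_sums_bounded_above[OF T inv erg]) (use int in auto)
    then show ?thesis
    proof eventually_elim
      case (elim x)
      then obtain K where K: "\<And>n. S f n x - e * real n \<le> K" by (auto simp: S_const)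
      obtain N :: nat where N: "real N > \<bar>K\<bar> / (d - e)" using reals_Archimedean2 by blast
      have "S f n x / real n < d" if n: "n \<ge> max 1 N" for n
      proof -
        have "\<bar>K\<bar> / (d - e) < real n" using N n by linarith
        then have "\<bar>K\<bar> < (d - e) * real n" using e by (simp add: field_simps)
        then have "S f n x < d * real n" using K[of n] by (simp add: algebra_simps)
        then show ?thesis using n by (simp add: field_simps)
      qed
      then show ?case unfolding eventually_sequentially by blast
    qed
  qed
  have lower: "AE x in M. eventually (\<lambda>n. d < S f n x / real n) sequentially"
    if c: "ennreal c < L" "0 \<le> c" "d < c" for c d
  proof -
    define e where "e = (c + d) / 2"
    have e: "e < c" "d < e" using c by (auto simp: e_def)
    have "L = (\<integral>\<^sup>+x. (SUP N. ennreal (min (f x) (real N))) \<partial>M)" unfolding L_def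
    proof (intro nn_integral_cong)
      fix x
      obtain N :: nat where N: "f x \<le> real N" using real_arch_simple by blast
      show "ennreal (f x) = (SUP N. ennreal (min (f x) (real N)))"
        by (rule antisym) (use N in \<open>auto intro!: SUP_upper2[of N] SUP_least ennreal_leI simp: min_def\<close>)
    qed
    also have "\<dots> = (SUP N. \<integral>\<^sup>+x. ennreal (min (f x) (real N)) \<partial>M)"
      by (intro nn_integral_monotone_convergence_SUP) (auto simp: incseq_def le_fun_def intro!: ennreal_leI)
    finally have "ennreal c < (SUP N. \<integral>\<^sup>+x. ennreal (min (f x) (real N)) \<partial>M)"
      using c(1) by simp
    then obtain N where N: "ennreal c < (\<integral>\<^sup>+x. ennreal (min (f x) (real N)) \<partial>M)"
      unfolding less_SUP_iff by blast
    define g where "g x = min (f x) (real N)" for x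
    have [measurable]: "g \<in> borel_measurable M" unfolding g_def by measurable
    have int: "integrable M g"
      by (rule integrable_const_bound[where B = "real N"]) (auto simp: g_def nonneg)
    have "(\<integral>\<^sup>+x. ennreal (g x) \<partial>M) = ennreal (integral\<^sup>L M g)"
      by (rule nn_integral_eq_integral[OF int]) (simp add: g_def nonneg)
    then have "c < integral\<^sup>L M g" using N c(2) unfolding g_def[symmetric] by (simp add: ennreal_less_iff)
    moreover have "integral\<^sup>L M (\<lambda>x. e - g x) = e - integral\<^sup>L M g"
      using Bochner_Integration.integral_diff[of M "\<lambda>_. e" g] int by (simp add: prob_space)
    ultimately have "integral\<^sup>L M (\<lambda>x. e - g x) < 0" using e by simp
    then have "AE x in M. \<exists>K. \<forall>n. S (\<lambda>x. e - g x) n x \<le> K"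
      unfolding S_def by (intro ergodic_sums_bounded_above[OF T inv erg]) (use int in auto)
    then show ?thesis
    proof eventually_elim
      case (elim x)
      then obtain K where K: "\<And>n. e * real n - S g n x \<le> K" by (auto simp: S_const)
      have gf: "S g n x \<le> S f n x" for n unfolding S_def g_def by (intro sum_mono) auto
      obtain N :: nat where N: "real N > \<bar>K\<bar> / (e - d)" using reals_Archimedean2 by blast
      have "d < S f n x / real n" if n: "n \<ge> max 1 N" for n
      proof -
        have "\<bar>K\<bar> / (e - d) < real n" using N n by linarith
        then have "\<bar>K\<bar> < (e - d) * real n" using e by (simp add: field_simps)
        then have "d * real n < S f n x" using K[of n] gf[of n] by (simp add: algebra_simps)
        then show ?thesis using n by (simp add: field_simps)
      qed
      then show ?case unfolding eventually_sequentially by blast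
    qed
  qed
  have upper': "AE x in M. eventually (\<lambda>n. S f n x / real n < d) sequentially"
    if d: "enn2ereal L < ereal d" for d
  proof -
    obtain c where c: "enn2ereal L < ereal c" "ereal c < ereal d" using d ereal_dense2 by blast
    have "ereal 0 < ereal c" using enn2ereal_nonneg[of L] c(1) by (metis ereal_eq_0(2) order.strict_trans1)
    then have "L < ennreal c" using c by (simp add: less_ennreal.rep_eq enn2ereal_ennreal)
    then show ?thesis using c \<open>ereal 0 < ereal c\<close> by (intro upper[of c]) auto
  qed
  have lower': "AE x in M. eventually (\<lambda>n. d < S f n x / real n) sequentially"
    if d: "ereal d < enn2ereal L" for d
  proof (cases "d < 0")
    case True
    have "d < S f n x / real n" for n x
      using S_nonneg[of n x] True by (meson divide_nonneg_nonneg less_le_trans of_nat_0_le_iff)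
    then show ?thesis by simp
  next
    case False
    obtain c where c: "ereal d < ereal c" "ereal c < enn2ereal L" using d ereal_dense2 by blast
    then have "ennreal c < L" using False by (simp add: less_ennreal.rep_eq enn2ereal_ennreal)
    then show ?thesis using c False by (intro lower[of c]) auto
  qed
  have "AE x in M. \<forall>q::rat. enn2ereal L < ereal (of_rat q) \<longrightarrow>
      eventually (\<lambda>n. S f n x / real n < of_rat q) sequentially"
    unfolding AE_all_countable using upper' by auto
  moreover have "AE x in M. \<forall>q::rat. ereal (of_rat q) < enn2ereal L \<longrightarrow>
      eventually (\<lambda>n. of_rat q < S f n x / real n) sequentially"
    unfolding AE_all_countable using lower' by auto
  ultimately show ?thesis
  proof eventually_elim
    case (elim x)
    show ?case unfolding L_def[symmetric] S_def[symmetric]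
    proof (rule order_tendstoI)
      fix d assume "d < enn2ereal L"
      then obtain q where q: "d < ereal (of_rat q)" "ereal (of_rat q) < enn2ereal L"
        using ereal_dense3 by blast
      then have "eventually (\<lambda>n. of_rat q < S f n x / real n) sequentially" using elim by blast
      then show "eventually (\<lambda>n. d < ereal (S f n x / real n)) sequentially"
        by eventually_elim (rule less_trans[OF q(1)], simp)
    next
      fix d assume "enn2ereal L < d"
      then obtain q where q: "enn2ereal L < ereal (of_rat q)" "ereal (of_rat q) < d"
        using ereal_dense3 by blast
      then have "eventually (\<lambda>n. S f n x / real n < of_rat q) sequentially" using elim by blast
      then show "eventually (\<lambda>n. ereal (S f n x / real n) < d) sequentially"
        by eventually_elim (rule less_trans[OF _ q(2)], simp)
    qed
  qed
qed

end

section \<open>Approximation by finitely determined sets\<close>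

definition determined_by :: "'i set \<Rightarrow> ('i \<Rightarrow> 'e) set \<Rightarrow> bool" where
  "determined_by J B \<longleftrightarrow> (\<forall>\<tau> \<tau>'. (\<forall>j\<in>J. \<tau> j = \<tau>' j) \<longrightarrow> (\<tau> \<in> B \<longleftrightarrow> \<tau>' \<in> B))"

text \<open>The sets that can be approximated in this way form a \<open>\<sigma>\<close>-algebra: a countable union is
  replaced by a finite one at a small cost.\<close>

lemma finitely_determined_approximation:
  fixes N :: "('i \<Rightarrow> 'e) measure"
  assumes "prob_space N" and sets: "sets N = sets (PiM UNIV (\<lambda>_. count_space UNIV))"
    and S: "S \<in> sets N" and "\<delta> > 0"
  shows "\<exists>J B. finite J \<and> B \<in> sets N \<and> determined_by J B \<and> measure N (sym_diff S B) < \<delta>"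
proof -
  interpret prob_space N by fact
  have space: "space N = UNIV"
    using sets_eq_imp_space_eq[OF sets] by (simp add: space_PiM)
  have "S \<in> sigma_sets UNIV {{f. f i \<in> A} | i A. True}"
    using S unfolding sets sets_PiM_single by (simp add: PiE_def)
  then show ?thesis using \<open>\<delta> > 0\<close>
  proof (induction arbitrary: \<delta> rule: sigma_sets.induct)
    case (Basic a)
    then obtain i A where a: "a = {f. f i \<in> A}" by auto
    have "(\<lambda>f. f i) -` A \<inter> space (PiM UNIV (\<lambda>_. count_space UNIV)) \<in> sets (PiM UNIV (\<lambda>_. count_space UNIV))"
      by (rule measurable_sets[OF measurable_component_singleton]) auto
    then have "a \<in> sets N" unfolding a sets by (simp add: space_PiM vimage_def)
    moreover have "determined_by {i} a" by (auto simp: a determined_by_def)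
    ultimately show ?case using Basic.prems by (intro exI[of _ "{i}"] exI[of _ a]) auto
  next
    case Empty
    then show ?case by (intro exI[of _ "{}"]) (auto simp: determined_by_def)
  next
    case (Compl a)
    then obtain J B where B: "finite J" "B \<in> sets N" "determined_by J B" "measure N (sym_diff a B) < \<delta>"
      by blast
    have "sym_diff (UNIV - a) (- B) = sym_diff a B" by auto
    moreover have "- B \<in> sets N" using sets.compl_sets[OF B(2)] by (simp add: space Compl_eq_Diff_UNIV)
    ultimately show ?case using B by (intro exI[of _ J] exI[of _ "- B"]) (auto simp: determined_by_def)
  next
    case (Union a)
    have aN [measurable]: "a i \<in> sets N" for i
    proof -
      have "a i \<in> sigma_sets UNIV {{f. f i \<in> A} | i A. True}" by (rule Union.hyps)
      then show ?thesis unfolding sets sets_PiM_single by (simp add: PiE_def)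
    qed
    define U where "U n = (\<Union>i<n. a i)" for n
    have "(\<lambda>n. prob (U n)) \<longlonglongrightarrow> prob (\<Union>n. U n)"
      unfolding U_def by (intro finite_Lim_measure_incseq) (auto simp: incseq_def, meson lessThan_iff less_le_trans)
    moreover have "(\<Union>n. U n) = (\<Union>i. a i)" by (auto simp: U_def)
    ultimately have "(\<lambda>n. prob (U n)) \<longlonglongrightarrow> prob (\<Union>i. a i)" by simp
    then have "\<forall>\<^sub>F n in sequentially. prob (\<Union>i. a i) - \<delta> / 2 < prob (U n)"
      using \<open>\<delta> > 0\<close> by (intro order_tendstoD) auto
    then obtain n where n: "prob (\<Union>i. a i) - \<delta> / 2 < prob (U n)"
      by (auto simp: eventually_sequentially)
    have "\<forall>i. \<exists>J B. finite J \<and> B \<in> sets N \<and> determined_by J B \<and> prob (sym_diff (a i) B) < \<delta> / (2 * real (n + 1))"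
      using \<open>\<delta> > 0\<close> by (intro allI Union.IH) auto
    then obtain J B where JB: "\<And>i. finite (J i)" "\<And>i. B i \<in> sets N" "\<And>i. determined_by (J i) (B i)"
      "\<And>i. prob (sym_diff (a i) (B i)) < \<delta> / (2 * real (n + 1))" by metis
    note [measurable] = JB(2)
    have "prob (sym_diff (\<Union>i. a i) (\<Union>i<n. B i)) \<le>
      prob (((\<Union>i. a i) - U n) \<union> (\<Union>i<n. sym_diff (a i) (B i)))"
      by (intro finite_measure_mono) (auto simp: U_def)
    also have "\<dots> \<le> prob ((\<Union>i. a i) - U n) + prob (\<Union>i<n. sym_diff (a i) (B i))"
      by (intro measure_Un_le) (auto simp: U_def)
    also have "prob ((\<Union>i. a i) - U n) = prob (\<Union>i. a i) - prob (U n)"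
      by (intro finite_measure_Diff) (auto simp: U_def)
    also have "\<dots> < \<delta> / 2" using n by simp
    also have "prob (\<Union>i<n. sym_diff (a i) (B i)) \<le> (\<Sum>i<n. prob (sym_diff (a i) (B i)))"
      by (intro finite_measure_subadditive_finite) auto
    also have "\<dots> \<le> (\<Sum>i<n. \<delta> / (2 * real (n + 1)))" using JB(4) by (intro sum_mono less_imp_le)
    also have "\<dots> \<le> \<delta> / 2" using \<open>\<delta> > 0\<close> by (simp add: field_simps)
    finally have "prob (sym_diff (\<Union>i. a i) (\<Union>i<n. B i)) < \<delta>" by simp
    moreover have "determined_by (\<Union>i<n. J i) (\<Union>i<n. B i)"
      unfolding determined_by_def
    proof (intro allI impI)
      fix \<tau> \<tau>' :: "'i \<Rightarrow> 'e" assume *: "\<forall>j\<in>\<Union> (J ` {..<n}). \<tau> j = \<tau>' j"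
      have "\<tau> \<in> B i \<longleftrightarrow> \<tau>' \<in> B i" if "i < n" for i
        using JB(3)[of i] * that unfolding determined_by_def by blast
      then show "\<tau> \<in> \<Union> (B ` {..<n}) \<longleftrightarrow> \<tau>' \<in> \<Union> (B ` {..<n})" by auto
    qed
    ultimately show ?case using JB(1,2)
      by (intro exI[of _ "\<Union>i<n. J i"] exI[of _ "\<Union>i<n. B i"]) auto
  qed
qed

section \<open>Gibbs states on the two-sided shift\<close>

definition translate :: "int \<Rightarrow> (int \<Rightarrow> 'e) \<Rightarrow> int \<Rightarrow> 'e" where
  "translate i \<tau> = (\<lambda>k. \<tau> (k + i))"

definition block :: "int \<Rightarrow> nat \<Rightarrow> (int \<Rightarrow> 'e) \<Rightarrow> 'e list" where
  "block i n \<tau> = map (\<lambda>k. \<tau> (i + int k)) [0..<n]"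

definition future :: "(int \<Rightarrow> 'e) \<Rightarrow> nat \<Rightarrow> 'e" where
  "future \<tau> = (\<lambda>n. \<tau> (int n))"

text \<open>The indexing of the second coordinate of the coding: the past is read backwards from \<open>-1\<close>.\<close>

definition past :: "(int \<Rightarrow> 'e) \<Rightarrow> nat \<Rightarrow> 'e" where
  "past \<tau> = (\<lambda>n. \<tau> (- int n - 1))"

lemma translate_apply: "translate i \<tau> k = \<tau> (k + i)"
  by (simp add: translate_def)

lemma translate_0 [simp]: "translate 0 \<tau> = \<tau>"
  by (simp add: translate_def)

lemma translate_translate [simp]: "translate i (translate j \<tau>) = translate (i + j) \<tau>"
  by (simp add: translate_def add.assoc)

lemma shift_eq_translate: "shift = translate 1"
  by (simp add: fun_eq_iff shift_def translate_apply)

lemma translate_funpow: "(translate i ^^ n) \<tau> = translate (i * int n) \<tau>"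
  by (induction n) (simp_all add: algebra_simps)

lemma length_block [simp]: "length (block i n \<tau>) = n"
  by (simp add: block_def)

lemma nth_block [simp]: "k < n \<Longrightarrow> block i n \<tau> ! k = \<tau> (i + int k)"
  by (simp add: block_def)

lemma block_eq_iff: "block i n \<tau> = w \<longleftrightarrow> length w = n \<and> (\<forall>k<n. \<tau> (i + int k) = w ! k)"
  by (auto simp: list_eq_iff_nth_eq)

lemma block_translate: "block i n (translate j \<tau>) = block (i + j) n \<tau>"
  by (simp add: block_def translate_def algebra_simps)

lemma block_append: "block i (m + n) \<tau> = block i m \<tau> @ block (i + int m) n \<tau>"
  by (auto simp: list_eq_iff_nth_eq nth_append)

lemma cylinder_eq_block: "cylinder w = {\<tau>. block 0 (length w) \<tau> = w}"
  by (auto simp: cylinder_def block_eq_iff)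

lemma ex_block: "\<exists>\<tau>. block i (length w) \<tau> = w"
proof
  show "block i (length w) (\<lambda>k. w ! nat (k - i)) = w"
    by (auto simp: block_eq_iff)
qed

lemma measurable_translate [measurable]:
  "translate i \<in> PiM UNIV (\<lambda>_. count_space UNIV) \<rightarrow>\<^sub>M PiM UNIV (\<lambda>_. count_space UNIV)"
  unfolding translate_def by (intro measurable_PiM_single') auto

lemma measurable_future [measurable]:
  "future \<in> PiM UNIV (\<lambda>_. count_space UNIV) \<rightarrow>\<^sub>M PiM UNIV (\<lambda>_. count_space UNIV)"
  unfolding future_def by (intro measurable_PiM_single') auto

lemma measurable_past [measurable]:
  "past \<in> PiM UNIV (\<lambda>_. count_space UNIV) \<rightarrow>\<^sub>M PiM UNIV (\<lambda>_. count_space UNIV)"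
  unfolding past_def by (intro measurable_PiM_single') auto

lemma measurable_block [measurable]:
  "block i n \<in> PiM UNIV (\<lambda>_. count_space (UNIV :: 'e::countable set)) \<rightarrow>\<^sub>M count_space UNIV"
proof (subst measurable_count_space_eq2_countable, safe)
  fix w :: "'e list"
  let ?P = "PiM UNIV (\<lambda>_::int. count_space (UNIV :: 'e set))"
  show "block i n -` {w} \<inter> space ?P \<in> sets ?P"
  proof (cases "length w = n")
    case True
    then have "block i n -` {w} \<inter> space ?P = {\<tau>\<in>space ?P. \<forall>k<n. \<tau> (i + int k) \<in> {w ! k}}"
      by (auto simp: block_eq_iff)
    also have "\<dots> \<in> sets ?P"
      by measurable
    finally show ?thesis .
  next
    case False
    then have "block i n -` {w} = {}" by auto
    then show ?thesis by simp
  qed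
qed (auto simp: space_PiM)

lemma le_by_small_error:
  fixes x y K :: real
  assumes "\<And>\<delta>. 0 < \<delta> \<Longrightarrow> \<delta> < 1 \<Longrightarrow> x \<le> y + K * \<delta>"
  shows "x \<le> y"
proof (rule tendsto_lowerbound)
  show "((\<lambda>\<delta>. y + K * \<delta>) \<longlongrightarrow> y) (at_right 0)"
    by (auto intro!: tendsto_eq_intros)
  show "\<forall>\<^sub>F \<delta> in at_right 0. x \<le> y + K * \<delta>"
    unfolding eventually_at_right_field using assms by (intro exI[of _ 1]) auto
qed auto

text \<open>For measures, inequalities on a generating family closed under intersections do not
  extend; on a countable set those on points do, by summation.\<close>

lemma emeasure_le_of_singletons:
  fixes \<mu> \<nu> :: "'x::countable measure"
  assumes "sets \<mu> = UNIV" "sets \<nu> = UNIV"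
    and "\<And>x. emeasure \<mu> {x} \<le> c * emeasure \<nu> {x}"
  shows "emeasure \<mu> S \<le> c * emeasure \<nu> S"
proof -
  have "emeasure \<mu> S = (\<integral>\<^sup>+x. emeasure \<mu> {x} \<partial>count_space S)"
    by (rule emeasure_countable_singleton) (auto simp: assms)
  also have "\<dots> \<le> (\<integral>\<^sup>+x. c * emeasure \<nu> {x} \<partial>count_space S)"
    by (intro nn_integral_mono assms)
  also have "\<dots> = c * (\<integral>\<^sup>+x. emeasure \<nu> {x} \<partial>count_space S)"
    by (intro nn_integral_cmult) auto
  also have "(\<integral>\<^sup>+x. emeasure \<nu> {x} \<partial>count_space S) = emeasure \<nu> S"
    by (rule emeasure_countable_singleton[symmetric]) (auto simp: assms)
  finally show ?thesis .
qed

text \<open>For the Gibbs state of a potential \<open>g\<close> of pressure \<open>P\<close>, the function \<open>F\<close> is \<open>P - g\<close>; this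
  normalisation absorbs the pressure into the Birkhoff sum.\<close>

locale gibbs_shift = prob_space M for M :: "(int \<Rightarrow> 'e::countable) measure" +
  fixes F :: "(int \<Rightarrow> 'e) \<Rightarrow> real" and C :: real
  assumes sets_M: "sets M = sets (PiM UNIV (\<lambda>_. count_space UNIV))"
    and invariant: "distr M M shift = M"
    and C_ge_1: "C \<ge> 1"
    and measurable_F: "F \<in> borel_measurable M"
    and gibbs_lower: "exp (- (\<Sum>k<n. F (translate (int k) \<tau>))) \<le> C * prob (cylinder (block 0 n \<tau>))"
    and gibbs_upper: "prob (cylinder (block 0 n \<tau>)) \<le> C * exp (- (\<Sum>k<n. F (translate (int k) \<tau>)))"
begin

declare measurable_F [measurable]

lemma sets_M_cong [measurable_cong]: "sets M = sets (PiM UNIV (\<lambda>_. count_space UNIV))"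
  by (rule sets_M)

lemma space_M [simp]: "space M = UNIV"
  using sets_eq_imp_space_eq[OF sets_M] by (simp add: space_PiM)

lemma emeasure_UNIV [simp]: "emeasure M UNIV = 1"
  using emeasure_space_1 by simp

lemma prob_UNIV [simp]: "prob UNIV = 1"
  using prob_space by simp

lemma measurable_translate_M [measurable]: "translate i \<in> M \<rightarrow>\<^sub>M M"
  by measurable

lemma distr_translate: "distr M M (translate i) = M"
proof -
  have *: "distr (distr M M (translate j)) M (translate i) = distr M M (translate (i + j))" for i j
    by (subst distr_distr) (auto simp: comp_def)
  have pos: "distr M M (translate (int n)) = M" for n
  proof (induction n)
    case 0
    have "distr M M (translate 0) = distr M M (\<lambda>x. x)" by (intro distr_cong) auto
    then show ?case by simp
  next
    case (Suc n)
    have "distr (distr M M (translate 1)) M (translate (int n)) = M"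
      by (simp only: invariant[unfolded shift_eq_translate] Suc)
    then have "distr M M (translate (int n + 1)) = M" unfolding * .
    moreover have "int n + 1 = int (Suc n)" by simp
    ultimately show ?case by metis
  qed
  have "distr (distr M M (translate (int n))) M (translate (- int n)) = M" for n
    unfolding * using pos[of 0] by simp
  then have neg: "distr M M (translate (- int n)) = M" for n by (simp add: pos)
  show ?thesis by (cases i) (use pos neg[of "Suc _"] in \<open>auto simp del: of_nat_Suc\<close>)
qed

lemma prob_translate:
  assumes "A \<in> events" shows "prob (translate i -` A) = prob A"
proof -
  have "measure (distr M M (translate i)) A = prob (translate i -` A)"
    using assms by (subst measure_distr) auto
  then show ?thesis by (simp add: distr_translate)
qed

lemma nn_integral_translate:
  assumes [measurable]: "f \<in> borel_measurable M"
  shows "(\<integral>\<^sup>+\<tau>. f (translate i \<tau>) \<partial>M) = (\<integral>\<^sup>+\<tau>. f \<tau> \<partial>M)"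
proof -
  have "(\<integral>\<^sup>+\<tau>. f \<tau> \<partial>distr M M (translate i)) = (\<integral>\<^sup>+\<tau>. f (translate i \<tau>) \<partial>M)"
    by (intro nn_integral_distr) auto
  then show ?thesis by (simp add: distr_translate)
qed

lemma block_events [measurable]: "{\<tau>. block i n \<tau> \<in> U} \<in> events"
proof -
  have "block i n -` U \<inter> space M \<in> events" by (rule measurable_sets[of _ _ "count_space UNIV"]) auto
  then show ?thesis by (simp add: vimage_def)
qed

lemma prob_block_eq: "prob {\<tau>. block i (length w) \<tau> = w} = prob (cylinder w)"
proof -
  have "translate i -` cylinder w = {\<tau>. block i (length w) \<tau> = w}"
    by (auto simp: cylinder_eq_block block_translate)
  moreover have "cylinder w \<in> events"
    unfolding cylinder_eq_block using block_events[of 0 "length w" "{w}"] by simp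
  ultimately show ?thesis using prob_translate[of "cylinder w" i] by simp
qed

lemma prob_cylinder_pos: "0 < prob (cylinder w)"
proof -
  obtain \<tau> where "block 0 (length w) \<tau> = w" using ex_block by blast
  with gibbs_lower[where n = "length w" and \<tau> = \<tau>]
  have "exp (- (\<Sum>k<length w. F (translate (int k) \<tau>))) \<le> C * prob (cylinder w)" by simp
  then have "0 < C * prob (cylinder w)" by (rule less_le_trans[rotated]) simp
  then show ?thesis using C_ge_1 by (simp add: zero_less_mult_iff)
qed

lemma F_sum_append:
  "(\<Sum>k<m + n. F (translate (int k) \<tau>)) =
     (\<Sum>k<m. F (translate (int k) \<tau>)) + (\<Sum>k<n. F (translate (int k) (translate (int m) \<tau>)))"
  by (induction n) (auto simp: add_ac)

text \<open>The exponent in the Gibbs inequality is additive along concatenations; the constant is used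
  once for each of the three words.\<close>

lemma
  shows cylinder_append_upper: "prob (cylinder (u @ v)) \<le> C ^ 3 * (prob (cylinder u) * prob (cylinder v))"
    and cylinder_append_lower: "prob (cylinder u) * prob (cylinder v) \<le> C ^ 3 * prob (cylinder (u @ v))"
proof -
  obtain \<tau> where \<tau>: "block 0 (length (u @ v)) \<tau> = u @ v" using ex_block by blast
  then have "block 0 (length u) \<tau> @ block (int (length u)) (length v) \<tau> = u @ v"
    using block_append[of 0 "length u" "length v" \<tau>] by simp
  then have u: "block 0 (length u) \<tau> = u" and v: "block 0 (length v) (translate (int (length u)) \<tau>) = v"
    by (auto simp: block_translate)
  let ?S = "\<lambda>n \<tau>. exp (- (\<Sum>k<n. F (translate (int k) \<tau>)))"
  let ?v = "translate (int (length u)) \<tau>"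
  have split: "?S (length u + length v) \<tau> = ?S (length u) \<tau> * ?S (length v) ?v"
    unfolding F_sum_append by (simp add: exp_add[symmetric])
  have C0: "0 \<le> C" using C_ge_1 by simp
  have "prob (cylinder (u @ v)) \<le> C * ?S (length u + length v) \<tau>"
    using gibbs_upper[where n = "length u + length v" and \<tau> = \<tau>] \<tau> by simp
  also have "\<dots> \<le> C * ((C * prob (cylinder u)) * (C * prob (cylinder v)))"
    unfolding split using gibbs_lower[where n = "length u" and \<tau> = \<tau>] gibbs_lower[where n = "length v" and \<tau> = "?v"] u v C0
    by (intro mult_left_mono mult_mono) auto
  finally show "prob (cylinder (u @ v)) \<le> C ^ 3 * (prob (cylinder u) * prob (cylinder v))"
    by (simp add: power3_eq_cube mult_ac)
  have "prob (cylinder u) * prob (cylinder v) \<le> (C * ?S (length u) \<tau>) * (C * ?S (length v) ?v)"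
    using gibbs_upper[where n = "length u" and \<tau> = \<tau>] gibbs_upper[where n = "length v" and \<tau> = "?v"] u v C0
    by (intro mult_mono) auto
  also have "\<dots> = C\<^sup>2 * ?S (length u + length v) \<tau>"
    unfolding split by (simp add: power2_eq_square)
  also have "\<dots> \<le> C\<^sup>2 * (C * prob (cylinder (u @ v)))"
    using gibbs_lower[where n = "length u + length v" and \<tau> = \<tau>] \<tau> by (intro mult_left_mono) auto
  finally show "prob (cylinder u) * prob (cylinder v) \<le> C ^ 3 * prob (cylinder (u @ v))"
    by (simp add: power3_eq_cube power2_eq_square mult_ac)
qed

text \<open>The law of a pair of adjacent blocks is compared with the product of the laws of the blocks,
  word by word.\<close>

lemma adjacent_blocks:
  fixes U V :: "'e list set" and i :: int and m n :: nat
  defines "X \<equiv> {\<tau>. block i m \<tau> \<in> U}" and "Y \<equiv> {\<tau>. block (i + int m) n \<tau> \<in> V}"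
  shows "prob (X \<inter> Y) \<le> C ^ 3 * (prob X * prob Y)" and "prob X * prob Y \<le> C ^ 3 * prob (X \<inter> Y)"
proof -
  let ?c = "count_space UNIV :: 'e list measure"
  define A where "A = distr M ?c (block i m)"
  define B where "B = distr M ?c (block (i + int m) n)"
  define D where "D = distr M (count_space UNIV) (\<lambda>\<tau>. (block i m \<tau>, block (i + int m) n \<tau>))"
  have pair_eq: "?c \<Otimes>\<^sub>M ?c = count_space UNIV"
    by (subst pair_measure_countable) auto
  have meas_D: "(\<lambda>\<tau>. (block i m \<tau>, block (i + int m) n \<tau>)) \<in> M \<rightarrow>\<^sub>M count_space UNIV"
    unfolding pair_eq[symmetric] by measurable
  interpret A: prob_space A unfolding A_def by (rule prob_space_distr) measurable
  interpret B: prob_space B unfolding B_def by (rule prob_space_distr) measurable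
  have sets_AB: "sets (A \<Otimes>\<^sub>M B) = UNIV"
  proof -
    have "sets (A \<Otimes>\<^sub>M B) = sets (?c \<Otimes>\<^sub>M ?c)"
      by (rule sets_pair_measure_cong) (simp_all add: A_def B_def)
    then show ?thesis unfolding pair_eq by simp
  qed
  have sets_D: "sets D = UNIV" by (simp add: D_def)
  have A_eq: "emeasure A S = ennreal (prob {\<tau>. block i m \<tau> \<in> S})" for S
    unfolding A_def by (subst emeasure_distr) (auto simp: emeasure_eq_measure vimage_def)
  have B_eq: "emeasure B S = ennreal (prob {\<tau>. block (i + int m) n \<tau> \<in> S})" for S
    unfolding B_def by (subst emeasure_distr) (auto simp: emeasure_eq_measure vimage_def)
  have AB: "emeasure (A \<Otimes>\<^sub>M B) (S \<times> S') = ennreal (prob {\<tau>. block i m \<tau> \<in> S} * prob {\<tau>. block (i + int m) n \<tau> \<in> S'})" for S S'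
    by (subst B.emeasure_pair_measure_Times) (auto simp: A_def B_def A_eq[unfolded A_def] B_eq[unfolded B_def] ennreal_mult)
  have D: "emeasure D (S \<times> S') = ennreal (prob ({\<tau>. block i m \<tau> \<in> S} \<inter> {\<tau>. block (i + int m) n \<tau> \<in> S'}))" for S S'
    unfolding D_def by (subst emeasure_distr[OF meas_D]) (auto simp: emeasure_eq_measure vimage_def intro!: arg_cong[where f = prob])
  have single: "emeasure D {(u, v)} \<le> ennreal (C ^ 3) * emeasure (A \<Otimes>\<^sub>M B) {(u, v)} \<and>
    emeasure (A \<Otimes>\<^sub>M B) {(u, v)} \<le> ennreal (C ^ 3) * emeasure D {(u, v)}" for u v
  proof (cases "length u = m \<and> length v = n")
    case True
    have "{\<tau>. block i m \<tau> = u} \<inter> {\<tau>. block (i + int m) n \<tau> = v} = {\<tau>. block i (length (u @ v)) \<tau> = u @ v}"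
      using True by (auto simp: block_append)
    then have "prob ({\<tau>. block i m \<tau> = u} \<inter> {\<tau>. block (i + int m) n \<tau> = v}) = prob (cylinder (u @ v))"
      using prob_block_eq[of i "u @ v"] by simp
    then have 1: "emeasure D {(u, v)} = ennreal (prob (cylinder (u @ v)))"
      using D[of "{u}" "{v}"] by simp
    have 2: "emeasure (A \<Otimes>\<^sub>M B) {(u, v)} = ennreal (prob (cylinder u) * prob (cylinder v))"
      using AB[of "{u}" "{v}"] prob_block_eq[of i u] prob_block_eq[of "i + int m" v] True by simp
    show ?thesis unfolding 1 2 using cylinder_append_upper[of u v] cylinder_append_lower[of u v] C_ge_1
      by (auto simp: ennreal_mult[symmetric] intro!: ennreal_leI)
  next
    case False
    then have "{\<tau>. block i m \<tau> = u} = {} \<or> {\<tau>. block (i + int m) n \<tau> = v} = {}" by auto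
    then show ?thesis using D[of "{u}" "{v}"] AB[of "{u}" "{v}"] by auto
  qed
  have "emeasure D (U \<times> V) \<le> ennreal (C ^ 3) * emeasure (A \<Otimes>\<^sub>M B) (U \<times> V)"
    by (rule emeasure_le_of_singletons[OF sets_D sets_AB]) (use single in \<open>auto simp: split_paired_all\<close>)
  then show "prob (X \<inter> Y) \<le> C ^ 3 * (prob X * prob Y)"
    unfolding D AB X_def Y_def using C_ge_1 by (simp add: ennreal_mult[symmetric])
  have "emeasure (A \<Otimes>\<^sub>M B) (U \<times> V) \<le> ennreal (C ^ 3) * emeasure D (U \<times> V)"
    by (rule emeasure_le_of_singletons[OF sets_AB sets_D]) (use single in \<open>auto simp: split_paired_all\<close>)
  then show "prob X * prob Y \<le> C ^ 3 * prob (X \<inter> Y)"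
    unfolding D AB X_def Y_def using C_ge_1 by (simp add: ennreal_mult[symmetric])
qed

lemma prob_sym_diff:
  assumes "X \<in> events" "X' \<in> events" "prob (sym_diff X X') < \<delta>"
  shows "prob X \<le> prob X' + \<delta>" "prob X' \<le> prob X + \<delta>"
proof -
  have "prob X \<le> prob (X' \<union> sym_diff X X')" using assms by (intro finite_measure_mono) auto
  also have "\<dots> \<le> prob X' + prob (sym_diff X X')" using assms by (intro measure_Un_le) auto
  finally show "prob X \<le> prob X' + \<delta>" using assms by simp
  have "prob X' \<le> prob (X \<union> sym_diff X X')" using assms by (intro finite_measure_mono) auto
  also have "\<dots> \<le> prob X + prob (sym_diff X X')" using assms by (intro measure_Un_le) auto
  finally show "prob X' \<le> prob X + \<delta>" using assms by simp
qed

text \<open>Both inequalities are continuous in the two events, so they survive approximation by events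
  that are determined by adjacent blocks.\<close>

lemma adjacent_events:
  assumes [measurable]: "X \<in> events" "Y \<in> events"
    and approx: "\<And>\<delta>. \<delta> > 0 \<Longrightarrow> \<exists>i m n U V.
        prob (sym_diff X {\<tau>. block i m \<tau> \<in> U}) < \<delta> \<and>
        prob (sym_diff Y {\<tau>. block (i + int m) n \<tau> \<in> V}) < \<delta>"
  shows "prob (X \<inter> Y) \<le> C ^ 3 * (prob X * prob Y)" and "prob X * prob Y \<le> C ^ 3 * prob (X \<inter> Y)"
proof -
  have *: "prob (X \<inter> Y) \<le> C ^ 3 * (prob X * prob Y) + (3 * C ^ 3 + 2) * \<delta> \<and>
     prob X * prob Y \<le> C ^ 3 * prob (X \<inter> Y) + (2 * C ^ 3 + 3) * \<delta>" if \<delta>: "0 < \<delta>" "\<delta> < 1" for \<delta>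
  proof -
    obtain i m n U V where
      X': "prob (sym_diff X {\<tau>. block i m \<tau> \<in> U}) < \<delta>" and
      Y': "prob (sym_diff Y {\<tau>. block (i + int m) n \<tau> \<in> V}) < \<delta>"
      using approx[OF \<delta>(1)] by blast
    define X' where "X' = {\<tau>. block i m \<tau> \<in> U}"
    define Y' where "Y' = {\<tau>. block (i + int m) n \<tau> \<in> V}"
    have [measurable]: "X' \<in> events" "Y' \<in> events" by (auto simp: X'_def Y'_def)
    note X = prob_sym_diff[OF _ _ X'[folded X'_def], simplified]
    note Y = prob_sym_diff[OF _ _ Y'[folded Y'_def], simplified]
    have "prob (sym_diff (X \<inter> Y) (X' \<inter> Y')) \<le> prob (sym_diff X X' \<union> sym_diff Y Y')"
      by (intro finite_measure_mono) auto
    also have "\<dots> \<le> prob (sym_diff X X') + prob (sym_diff Y Y')"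
      by (intro measure_Un_le) auto
    also have "\<dots> < 2 * \<delta>" using X' Y' by (simp add: X'_def Y'_def)
    finally have XY: "prob (X \<inter> Y) \<le> prob (X' \<inter> Y') + 2 * \<delta>" "prob (X' \<inter> Y') \<le> prob (X \<inter> Y) + 2 * \<delta>"
      using prob_sym_diff[of "X \<inter> Y" "X' \<inter> Y'" "2 * \<delta>"] by auto
    have C3: "0 \<le> C ^ 3" using C_ge_1 by simp
    have prod: "(x + \<delta>) * (y + \<delta>) \<le> x * y + 3 * \<delta>" if "0 \<le> x" "x \<le> 1" "0 \<le> y" "y \<le> 1" for x y :: real
    proof -
      have "x * \<delta> \<le> 1 * \<delta>" "y * \<delta> \<le> 1 * \<delta>" "\<delta> * \<delta> \<le> 1 * \<delta>" using that \<delta> by (auto intro!: mult_right_mono)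
      then show ?thesis by (simp add: algebra_simps)
    qed
    have "prob (X' \<inter> Y') \<le> C ^ 3 * (prob X' * prob Y')"
      unfolding X'_def Y'_def by (rule adjacent_blocks)
    also have "\<dots> \<le> C ^ 3 * ((prob X + \<delta>) * (prob Y + \<delta>))"
      using X Y C3 \<delta> by (intro mult_left_mono mult_mono) auto
    also have "\<dots> \<le> C ^ 3 * (prob X * prob Y + 3 * \<delta>)"
      using C3 by (intro mult_left_mono prod) auto
    finally have 1: "prob (X \<inter> Y) \<le> C ^ 3 * (prob X * prob Y) + (3 * C ^ 3 + 2) * \<delta>"
      using XY by (simp add: algebra_simps)
    have "prob X * prob Y \<le> (prob X' + \<delta>) * (prob Y' + \<delta>)"
      using X Y \<delta> by (intro mult_mono) auto
    also have "\<dots> \<le> prob X' * prob Y' + 3 * \<delta>" by (intro prod) auto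
    also have "prob X' * prob Y' \<le> C ^ 3 * prob (X' \<inter> Y')"
      unfolding X'_def Y'_def by (rule adjacent_blocks)
    also have "C ^ 3 * prob (X' \<inter> Y') \<le> C ^ 3 * (prob (X \<inter> Y) + 2 * \<delta>)"
      using XY C3 by (intro mult_left_mono) auto
    finally have "prob X * prob Y \<le> C ^ 3 * prob (X \<inter> Y) + (2 * C ^ 3 + 3) * \<delta>"
      by (simp add: algebra_simps)
    with 1 show ?thesis by simp
  qed
  show "prob (X \<inter> Y) \<le> C ^ 3 * (prob X * prob Y)"
    by (rule le_by_small_error) (use * in blast)
  show "prob X * prob Y \<le> C ^ 3 * prob (X \<inter> Y)"
    by (rule le_by_small_error) (use * in blast)
qed

lemma approx_by_blocks:
  assumes A: "A \<in> events" and "\<delta> > 0"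
  shows "\<exists>m0. \<forall>m\<ge>m0. \<exists>U. prob (sym_diff A {\<tau>. block (- int m) (2 * m + 1) \<tau> \<in> U}) < \<delta>"
proof -
  obtain J B where JB: "finite J" "determined_by J B" "prob (sym_diff A B) < \<delta>"
    using finitely_determined_approximation[OF prob_space_axioms sets_M A \<open>\<delta> > 0\<close>] by blast
  have "\<exists>U. prob (sym_diff A {\<tau>. block (- int m) (2 * m + 1) \<tau> \<in> U}) < \<delta>"
    if m: "m \<ge> nat (\<Sum>j\<in>J. \<bar>j\<bar>)" for m
  proof -
    have J: "\<bar>j\<bar> \<le> int m" if "j \<in> J" for j
    proof -
      have "\<bar>j\<bar> \<le> (\<Sum>j\<in>J. \<bar>j\<bar>)" using that JB(1) by (intro member_le_sum) auto
      then show ?thesis using m by linarith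
    qed
    have "B = {\<tau>. block (- int m) (2 * m + 1) \<tau> \<in> block (- int m) (2 * m + 1) ` B}"
    proof (intro set_eqI iffI CollectI)
      fix \<tau> assume "\<tau> \<in> {\<tau>. block (- int m) (2 * m + 1) \<tau> \<in> block (- int m) (2 * m + 1) ` B}"
      then obtain \<tau>' where \<tau>': "\<tau>' \<in> B" "block (- int m) (2 * m + 1) \<tau> = block (- int m) (2 * m + 1) \<tau>'"
        by auto
      have "\<tau> j = \<tau>' j" if "j \<in> J" for j
      proof -
        have "\<forall>k<2 * m + 1. \<tau> (- int m + int k) = \<tau>' (- int m + int k)"
          using \<tau>'(2) by (simp add: block_eq_iff)
        moreover have "nat (j + int m) < 2 * m + 1" "- int m + int (nat (j + int m)) = j"
          using J[OF that] by auto
        ultimately show ?thesis by metis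
      qed
      then show "\<tau> \<in> B" using JB(2) \<tau>'(1) unfolding determined_by_def by blast
    qed auto
    then show ?thesis using JB(3) by metis
  qed
  then show ?thesis by blast
qed

text \<open>If \<open>A\<close> is determined by a block up to a small error, a long translate of its complement is
  determined by the adjacent block. Since \<open>A\<close> is invariant, the translate is the complement itself,
  and quasi-independence of \<open>A\<close> and its complement forces one of them to be null.\<close>

lemma ergodic:
  assumes A [measurable]: "A \<in> events" and inv: "\<And>i \<tau>. translate i \<tau> \<in> A \<longleftrightarrow> \<tau> \<in> A"
  shows "prob A = 0 \<or> prob A = 1"
proof -
  have "prob A * prob (- A) \<le> C ^ 3 * prob (A \<inter> - A)"
  proof (rule adjacent_events(2))
    show [measurable]: "- A \<in> events" using sets.compl_sets[OF A] by (simp add: Compl_eq_Diff_UNIV)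
    fix \<delta> :: real assume "\<delta> > 0"
    then obtain m U where *: "prob (sym_diff A {\<tau>. block (- int m) (2 * m + 1) \<tau> \<in> U}) < \<delta>"
      using approx_by_blocks[OF A] by blast
    let ?d = "sym_diff A {\<tau>. block (- int m) (2 * m + 1) \<tau> \<in> U}"
    have "translate (2 * int m + 1) -` ?d =
        sym_diff (- A) {\<tau>. block (- int m + int (2 * m + 1)) (2 * m + 1) \<tau> \<in> - U}"
      by (auto simp: inv block_translate algebra_simps)
    moreover have "prob (translate (2 * int m + 1) -` ?d) = prob ?d"
      by (rule prob_translate) measurable
    ultimately show "\<exists>i m n U V. prob (sym_diff A {\<tau>. block i m \<tau> \<in> U}) < \<delta> \<and>
        prob (sym_diff (- A) {\<tau>. block (i + int m) n \<tau> \<in> V}) < \<delta>"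
      using * by metis
  qed fact
  then have "prob A * (1 - prob A) \<le> 0"
    using prob_compl[OF A] by (simp add: Compl_eq_Diff_UNIV)
  moreover have "0 \<le> prob A" "prob A \<le> 1" by auto
  ultimately show ?thesis by (auto simp: mult_le_0_iff)
qed

text \<open>Quasi-independence of past and future. The block before \<open>0\<close> that determines an approximation of
  the past event is adjacent to the one from \<open>0\<close> on that does this for the future event.\<close>

lemma past_future:
  fixes S S' :: "(nat \<Rightarrow> 'e) set"
  assumes S: "S \<in> sets (PiM UNIV (\<lambda>_. count_space UNIV))" and S': "S' \<in> sets (PiM UNIV (\<lambda>_. count_space UNIV))"
  defines "X \<equiv> past -` S" and "Y \<equiv> future -` S'"
  shows "X \<in> events" "Y \<in> events"
    "prob (X \<inter> Y) \<le> C ^ 3 * (prob X * prob Y)" and "prob X * prob Y \<le> C ^ 3 * prob (X \<inter> Y)"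
proof -
  let ?N = "PiM UNIV (\<lambda>_::nat. count_space (UNIV :: 'e set))"
  have past_meas: "past \<in> M \<rightarrow>\<^sub>M ?N" and future_meas: "future \<in> M \<rightarrow>\<^sub>M ?N" by measurable
  show X: "X \<in> events" "Y \<in> events" unfolding X_def Y_def
    using measurable_sets[OF past_meas S] measurable_sets[OF future_meas S'] S S' by auto
  have approx: "\<exists>n B. (\<forall>\<tau> \<tau>'. (\<forall>k<n. \<tau> k = \<tau>' k) \<longrightarrow> (\<tau> \<in> B \<longleftrightarrow> \<tau>' \<in> B)) \<and>
      prob (sym_diff (Z -` S) (Z -` B)) < \<delta>"
    if S: "S \<in> sets ?N" and Z [measurable]: "Z \<in> M \<rightarrow>\<^sub>M ?N" and "\<delta> > 0" for Z S \<delta>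
  proof -
    obtain J B where JB: "finite J" "B \<in> sets (distr M ?N Z)" "determined_by J B"
      "measure (distr M ?N Z) (sym_diff S B) < \<delta>"
      using finitely_determined_approximation[of "distr M ?N Z" S \<delta>] S \<open>\<delta> > 0\<close>
      by (auto simp: prob_space_distr)
    obtain n where n: "\<And>j. j \<in> J \<Longrightarrow> j < n" using JB(1) finite_nat_bounded by blast
    have "measure (distr M ?N Z) (sym_diff S B) = prob (Z -` sym_diff S B \<inter> space M)"
      using JB(2) S by (intro measure_distr) auto
    also have "Z -` sym_diff S B \<inter> space M = sym_diff (Z -` S) (Z -` B)" by auto
    finally have "prob (sym_diff (Z -` S) (Z -` B)) < \<delta>" using JB(4) by simp
    moreover have "\<forall>\<tau> \<tau>'. (\<forall>k<n. \<tau> k = \<tau>' k) \<longrightarrow> (\<tau> \<in> B \<longleftrightarrow> \<tau>' \<in> B)"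
      using JB(3) n unfolding determined_by_def by blast
    ultimately show ?thesis by blast
  qed
  have *: "\<exists>i m n U V. prob (sym_diff X {\<tau>. block i m \<tau> \<in> U}) < \<delta> \<and>
        prob (sym_diff Y {\<tau>. block (i + int m) n \<tau> \<in> V}) < \<delta>" if \<delta>: "\<delta> > 0" for \<delta>
  proof -
    obtain m B where B: "\<And>\<tau> \<tau>'. (\<forall>k<m. \<tau> k = \<tau>' k) \<Longrightarrow> (\<tau> \<in> B \<longleftrightarrow> \<tau>' \<in> B)"
      "prob (sym_diff X (past -` B)) < \<delta>"
      using approx[OF S past_meas \<delta>] unfolding X_def by auto
    obtain n B' where B': "\<And>\<tau> \<tau>'. (\<forall>k<n. \<tau> k = \<tau>' k) \<Longrightarrow> (\<tau> \<in> B' \<longleftrightarrow> \<tau>' \<in> B')"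
      "prob (sym_diff Y (future -` B')) < \<delta>"
      using approx[OF S' future_meas \<delta>] unfolding Y_def by auto
    have 1: "past -` B = {\<tau>. block (- int m) m \<tau> \<in> block (- int m) m ` (past -` B)}"
    proof (intro set_eqI iffI CollectI)
      fix \<tau> assume "\<tau> \<in> {\<tau>. block (- int m) m \<tau> \<in> block (- int m) m ` (past -` B)}"
      then obtain \<tau>' where \<tau>': "past \<tau>' \<in> B" "block (- int m) m \<tau> = block (- int m) m \<tau>'" by auto
      have "past \<tau> k = past \<tau>' k" if "k < m" for k
      proof -
        have "\<forall>k<m. \<tau> (- int m + int k) = \<tau>' (- int m + int k)"
          using \<tau>'(2) by (simp add: block_eq_iff)
        moreover have "- int m + int (m - 1 - k) = - int k - 1" "m - 1 - k < m" using that by auto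
        ultimately show ?thesis unfolding past_def by metis
      qed
      then show "\<tau> \<in> past -` B" using B(1)[of "past \<tau>" "past \<tau>'"] \<tau>'(1) by auto
    qed auto
    have 2: "future -` B' = {\<tau>. block (- int m + int m) n \<tau> \<in> block 0 n ` (future -` B')}"
    proof (intro set_eqI iffI CollectI)
      fix \<tau> assume "\<tau> \<in> {\<tau>. block (- int m + int m) n \<tau> \<in> block 0 n ` (future -` B')}"
      then obtain \<tau>' where \<tau>': "future \<tau>' \<in> B'" "block 0 n \<tau> = block 0 n \<tau>'" by auto
      then have "future \<tau> k = future \<tau>' k" if "k < n" for k
        using that by (simp add: block_eq_iff future_def)
      then show "\<tau> \<in> future -` B'" using B'(1)[of "future \<tau>" "future \<tau>'"] \<tau>'(1) by auto
    qed auto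
    show ?thesis using B(2) B'(2) 1 2 by metis
  qed
  show "prob (X \<inter> Y) \<le> C ^ 3 * (prob X * prob Y)" "prob X * prob Y \<le> C ^ 3 * prob (X \<inter> Y)"
    using adjacent_events[OF X *] by auto
qed

end

section \<open>Coding by affine branches\<close>

text \<open>Lebesgue measure in the form in which it counts cylinders.\<close>

lemma sum_of_disjoint_lengths:
  fixes c d :: "'i \<Rightarrow> real"
  assumes "finite S" "l \<le> u" and le: "\<And>i. i \<in> S \<Longrightarrow> l \<le> c i \<and> c i \<le> d i \<and> d i \<le> u"
    and disj: "disjoint_family_on (\<lambda>i. {c i<..<d i}) S"
  shows "(\<Sum>i\<in>S. d i - c i) \<le> u - l"
proof -
  have "(\<Sum>i\<in>S. d i - c i) = (\<Sum>i\<in>S. measure lborel {c i<..<d i})"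
    using le by (intro sum.cong) auto
  also have "\<dots> = measure lborel (\<Union>i\<in>S. {c i<..<d i})"
    using assms by (intro measure_finite_Union[symmetric]) auto
  also have "\<dots> \<le> measure lborel {l..u}"
  proof (rule measure_mono_fmeasurable)
    show "(\<Union>i\<in>S. {c i<..<d i}) \<subseteq> {l..u}" using le by fastforce
    show "(\<Union>i\<in>S. {c i<..<d i}) \<in> sets lborel" by (simp add: borel_open open_UN)
    show "{l..u} \<in> fmeasurable lborel" by (auto intro!: fmeasurableI simp: emeasure_lborel_Icc_eq)
  qed
  also have "\<dots> = u - l" using \<open>l \<le> u\<close> by simp
  finally show ?thesis .
qed

locale luroth =
  fixes a b :: "'e::countable \<Rightarrow> real"
  assumes luroth_system: "luroth_system a b"
begin

lemma a_pos: "0 < a e" and a_less_1: "a e < 1"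
  using luroth_system by (auto simp: luroth_system_def)

lemma branch_unit: "x \<in> {0..1} \<Longrightarrow> branch a b e x \<in> {0..1}"
  using luroth_system unfolding luroth_system_def image_subset_iff by blast

lemma b_nonneg: "0 \<le> b e" and a_plus_b: "a e + b e \<le> 1"
  using branch_unit[of 0 e] branch_unit[of 1 e] by (auto simp: branch_def)

lemma branch_image: "branch a b e ` {0..1} = {b e..a e + b e}"
  using a_pos[of e] unfolding branch_def[abs_def] by (subst image_affinity_atLeastAtMost) auto

lemma branch_interior: "interior (branch a b e ` {0..1}) = {b e<..<a e + b e}"
  unfolding branch_image by (rule interior_atLeastAtMost_real)

lemma disjoint_interiors: "e \<noteq> e' \<Longrightarrow> {b e<..<a e + b e} \<inter> {b e'<..<a e' + b e'} = {}"
  using luroth_system unfolding luroth_system_def branch_interior disjoint_family_on_def by auto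

lemma sum_a_le_1:
  assumes "finite S" shows "sum a S \<le> 1"
proof -
  have "(\<Sum>e\<in>S. (a e + b e) - b e) \<le> 1 - 0"
    using assms a_pos b_nonneg a_plus_b disjoint_interiors
    by (intro sum_of_disjoint_lengths) (auto simp: disjoint_family_on_def less_imp_le)
  then show ?thesis by simp
qed

lemma two_symbols: "\<exists>e e' :: 'e. e \<noteq> e'"
proof (rule ccontr)
  assume "\<not> ?thesis"
  then have "e = undefined" for e :: 'e by blast
  then have "(\<Union>e. branch a b e ` {0..1}) = (\<Union>e::'e. branch a b undefined ` {0..1})"
    by (intro SUP_cong) metis+
  then have "(\<Union>e. branch a b e ` {0..1}) = branch a b undefined ` {0..1}" by simp
  then have "emeasure lborel (branch a b undefined ` {0..1}) = 1"
    using luroth_system by (simp add: luroth_system_def)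
  then show False using a_pos[of undefined] a_less_1[of undefined] by (simp add: branch_image)
qed

text \<open>Although the alphabet may be infinite, the slopes stay away from \<open>1\<close>: two different ones have
  sum at most \<open>1\<close>, and every symbol differs from one of two fixed symbols.\<close>

lemma uniform_contraction: "\<exists>\<rho><1. \<forall>e. a e \<le> \<rho>"
proof -
  obtain e0 e1 :: 'e where "e0 \<noteq> e1" using two_symbols by blast
  have pair: "a e + a e' \<le> 1" if "e \<noteq> e'" for e e'
    using sum_a_le_1[of "{e, e'}"] that by simp
  have "a e \<le> max (1 - a e0) (1 - a e1)" for e
  proof (cases "e = e0")
    case True
    then show ?thesis using pair[OF \<open>e0 \<noteq> e1\<close>] by simp
  next
    case False
    then show ?thesis using pair[OF False] by simp
  qed
  moreover have "max (1 - a e0) (1 - a e1) < 1" using a_pos by simp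
  ultimately show ?thesis by blast
qed

definition contraction :: real where
  "contraction = (SOME \<rho>. \<rho> < 1 \<and> (\<forall>e. a e \<le> \<rho>))"

lemma contraction_less_1: "contraction < 1" and a_le_contraction: "a e \<le> contraction"
proof -
  have "contraction < 1 \<and> (\<forall>e. a e \<le> contraction)"
    unfolding contraction_def using uniform_contraction by (rule someI_ex)
  then show "contraction < 1" "a e \<le> contraction" by auto
qed

lemma contraction_pos: "0 < contraction"
  using a_pos a_le_contraction by (rule less_le_trans)

definition word_map :: "'e list \<Rightarrow> real \<Rightarrow> real" where
  "word_map w = foldr (branch a b) w"

definition word_length :: "'e list \<Rightarrow> real" where
  "word_length w = prod_list (map a w)"

lemma word_map_Nil [simp]: "word_map [] x = x"
  and word_map_Cons [simp]: "word_map (e # w) x = branch a b e (word_map w x)"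
  and word_map_append: "word_map (u @ v) x = word_map u (word_map v x)"
  by (simp_all add: word_map_def)

lemma word_length_Nil [simp]: "word_length [] = 1"
  and word_length_Cons [simp]: "word_length (e # w) = a e * word_length w"
  by (simp_all add: word_length_def)

lemma word_map_affine: "word_map w x = word_length w * x + word_map w 0"
  by (induction w) (auto simp: branch_def algebra_simps)

lemma word_length_pos: "0 < word_length w"
  by (induction w) (auto simp: a_pos)

lemma word_length_le: "word_length w \<le> contraction ^ length w"
  using a_pos a_le_contraction word_length_pos contraction_pos
  by (induction w) (auto intro!: mult_mono simp: less_imp_le)

lemma word_map_inj: "word_map w x = word_map w y \<longleftrightarrow> x = y"
  unfolding word_map_affine[of w x] word_map_affine[of w y] using word_length_pos[of w] by simp

lemma branch_open_unit: "x \<in> {0<..<1} \<Longrightarrow> branch a b e x \<in> {b e<..<a e + b e}"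
  using a_pos[of e] by (auto simp: branch_def)

lemma branch_interior_subset: "{b e<..<a e + b e} \<subseteq> {0<..<1}"
  using b_nonneg[of e] a_plus_b[of e] by auto

lemma word_map_open_unit: "x \<in> {0<..<1} \<Longrightarrow> word_map w x \<in> {0<..<1}"
proof (induction w)
  case (Cons e w)
  then show ?case using branch_open_unit[of "word_map w x" e] branch_interior_subset[of e] by auto
qed simp

lemma word_map_disjoint:
  assumes "length u = length v" "x \<in> {0<..<1}" "y \<in> {0<..<1}" "word_map u x = word_map v y"
  shows "u = v"
  using assms(1,4)
proof (induction u v rule: list_induct2)
  case (Cons e u e' v)
  have "branch a b e (word_map u x) \<in> {b e<..<a e + b e}" "branch a b e' (word_map v y) \<in> {b e'<..<a e' + b e'}"
    using assms word_map_open_unit branch_open_unit by blast+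
  then have "e = e'" using disjoint_interiors[of e e'] Cons.prems
    by (metis IntI empty_iff word_map_Cons)
  then have "word_map u x = word_map v y" using Cons.prems word_map_inj[of "[e]"] by simp
  then show ?case using Cons.IH \<open>e = e'\<close> by simp
qed simp

lemma open_cylinders_disjoint:
  assumes "length u = length v" "u \<noteq> v"
  shows "{word_map u 0<..<word_map u 0 + word_length u} \<inter> {word_map v 0<..<word_map v 0 + word_length v} = {}"
proof -
  have *: "\<exists>x\<in>{0<..<1}. z = word_map w x" if "z \<in> {word_map w 0<..<word_map w 0 + word_length w}" for z w
    using that word_length_pos[of w]
    by (intro bexI[of _ "(z - word_map w 0) / word_length w"])
      (auto simp: word_map_affine[of w "_ / _"] field_simps)
  show ?thesis using *[of _ u] *[of _ v] word_map_disjoint[OF assms(1)] assms(2) by blast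
qed

lemma word_map_image: "word_map w ` {0..1} = {word_map w 0..word_map w 0 + word_length w}"
proof -
  have "word_map w ` {0..1} = (\<lambda>x. word_length w * x + word_map w 0) ` {0..1}"
    by (rule image_cong[OF refl]) (rule word_map_affine)
  then show ?thesis using word_length_pos[of w] by (simp add: image_affinity_atLeastAtMost add.commute)
qed

lemma branch_word_eq: "branch_word a b \<omega> n = word_map (map \<omega> [0..<n])"
  by (induction n) (auto simp: fun_eq_iff word_map_append)

lemma coding_unique: "\<exists>!x. x \<in> (\<Inter>n. branch_word a b \<omega> n ` {0..1})"
proof -
  let ?S = "\<lambda>n. branch_word a b \<omega> n ` {0..1}"
  have dist: "\<exists>n. \<forall>x\<in>?S n. \<forall>y\<in>?S n. dist x y < \<epsilon>" if "\<epsilon> > 0" for \<epsilon>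
  proof -
    obtain n where n: "contraction ^ n < \<epsilon>"
      using real_arch_pow_inv[OF \<open>\<epsilon> > 0\<close> contraction_less_1] by blast
    have "dist x y \<le> word_length (map \<omega> [0..<n])" if "x \<in> ?S n" "y \<in> ?S n" for x y
      using that by (auto simp: branch_word_eq word_map_image dist_real_def)
    then show ?thesis using n word_length_le[of "map \<omega> [0..<n]"] by (intro exI[of _ n]) force
  qed
  have mono: "?S n \<subseteq> ?S m" if "m \<le> n" for m n
    using that
  proof (induction n rule: dec_induct)
    case (step n)
    have "?S (Suc n) \<subseteq> ?S n" using branch_unit by auto
    with step show ?case by blast
  qed simp
  have "\<exists>x. \<Inter>(range ?S) = {x}"
    by (rule decreasing_closed_nest_sing) (use mono dist in \<open>auto simp: branch_word_eq word_map_image less_imp_le[OF word_length_pos]\<close>)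
  then show ?thesis by (metis singleton_iff)
qed

lemma coding_mem: "coding a b \<omega> \<in> word_map (map \<omega> [0..<n]) ` {0..1}"
  using theI'[OF coding_unique, of \<omega>] unfolding coding_def branch_word_eq by blast

lemma coding_eqI: "(\<And>n. x \<in> word_map (map \<omega> [0..<n]) ` {0..1}) \<Longrightarrow> coding a b \<omega> = x"
  unfolding coding_def by (rule the1_equality[OF coding_unique]) (auto simp: branch_word_eq)

lemma coding_unit: "coding a b \<omega> \<in> {0..1}"
  using coding_mem[of \<omega> 0] by simp

lemma coding_shift: "coding a b \<omega> = branch a b (\<omega> 0) (coding a b (\<lambda>n. \<omega> (Suc n)))"
proof (rule coding_eqI)
  fix n
  show "branch a b (\<omega> 0) (coding a b (\<lambda>n. \<omega> (Suc n))) \<in> word_map (map \<omega> [0..<n]) ` {0..1}"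
  proof (cases n)
    case 0
    then show ?thesis using branch_unit coding_unit by simp
  next
    case (Suc n')
    have "map \<omega> [0..<n] = \<omega> 0 # map (\<lambda>n. \<omega> (Suc n)) [0..<n']"
      unfolding Suc by (simp add: upt_conv_Cons map_Suc_upt[symmetric] del: upt_Suc)
    then show ?thesis using coding_mem[of "\<lambda>n. \<omega> (Suc n)" n'] by auto
  qed
qed

lemma coding_approx: "\<bar>coding a b \<omega> - branch_word a b \<omega> n 0\<bar> \<le> contraction ^ n"
  using coding_mem[of \<omega> n] word_length_le[of "map \<omega> [0..<n]"]
  unfolding word_map_image branch_word_eq by auto

lemma measurable_coding [measurable]:
  "coding a b \<in> borel_measurable (PiM UNIV (\<lambda>_. count_space UNIV))"
proof (rule borel_measurable_LIMSEQ_real)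
  let ?P = "PiM UNIV (\<lambda>_::nat. count_space (UNIV :: 'e set))"
  show "(\<lambda>n. branch_word a b \<omega> n 0) \<longlonglongrightarrow> coding a b \<omega>" for \<omega>
  proof (rule LIM_zero_cancel, rule Lim_null_comparison)
    show "(\<lambda>n. contraction ^ n) \<longlonglongrightarrow> 0"
      using contraction_pos contraction_less_1 by (intro LIMSEQ_realpow_zero) auto
    show "\<forall>\<^sub>F n in sequentially. norm (branch_word a b \<omega> n 0 - coding a b \<omega>) \<le> contraction ^ n"
      using coding_approx[of \<omega>] by (simp add: abs_minus_commute)
  qed
  have eq: "branch_word a b \<omega> n x = word_map (map \<omega> [0..<n]) x" for \<omega> n x
    by (simp add: branch_word_eq)
  have rec: "branch_word a b \<omega> (Suc n) x = a (\<omega> 0) * branch_word a b (\<lambda>n. \<omega> (Suc n)) n x + b (\<omega> 0)" for \<omega> n x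
  proof -
    have "map \<omega> [0..<Suc n] = \<omega> 0 # map (\<lambda>n. \<omega> (Suc n)) [0..<n]"
      by (simp add: upt_conv_Cons map_Suc_upt[symmetric] del: upt_Suc)
    then show ?thesis unfolding eq by (simp add: branch_def)
  qed
  have tl [measurable]: "(\<lambda>\<omega> n. \<omega> (Suc n)) \<in> ?P \<rightarrow>\<^sub>M ?P"
    by (intro measurable_PiM_single') auto
  have count [measurable]: "h \<in> count_space UNIV \<rightarrow>\<^sub>M borel" for h :: "'e \<Rightarrow> real" by simp
  show "(\<lambda>\<omega>. branch_word a b \<omega> n 0) \<in> borel_measurable ?P" for n
  proof (induction n)
    case (Suc n)
    note measurable_compose[OF tl Suc, measurable]
    show ?case unfolding rec by measurable
  qed simp
qed

lemma digit_eq: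
  assumes "x \<in> {b e<..<a e + b e}" shows "digit a b x = e"
  unfolding digit_def branch_interior
proof (rule the_equality)
  show "\<And>e'. x \<in> {b e'<..<a e' + b e'} \<Longrightarrow> e' = e" using disjoint_interiors assms by blast
qed fact

lemma regular_set_eq: "regular_set a b = (\<Union>e. {b e<..<a e + b e})"
  by (simp add: regular_set_def branch_interior)

lemma measurable_digit [measurable]: "digit a b \<in> borel \<rightarrow>\<^sub>M count_space UNIV"
proof (subst measurable_count_space_eq2_countable, safe)
  fix e
  have "digit a b x = digit a b y" if "x \<notin> regular_set a b" "y \<notin> regular_set a b" for x y
    using that unfolding digit_def regular_set_def by simp
  then have "\<exists>B. digit a b -` {e} = {b e<..<a e + b e} \<union> B \<and> (B = {} \<or> B = - regular_set a b)"
  proof (intro exI conjI)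
    show "digit a b -` {e} = {b e<..<a e + b e} \<union> (digit a b -` {e} - regular_set a b)"
      using digit_eq unfolding regular_set_eq by auto
  qed auto
  then obtain B where B: "digit a b -` {e} = {b e<..<a e + b e} \<union> B" "B = {} \<or> B = - regular_set a b" by blast
  have "open (regular_set a b)" unfolding regular_set_eq by auto
  then have "- regular_set a b \<in> sets borel" by (intro borel_closed) auto
  then show "digit a b -` {e} \<inter> space borel \<in> sets borel" using B by auto
qed auto

text \<open>If a point coded by \<open>\<omega>\<close> is an endpoint of the unit interval, then every branch in the sequence
  \<open>\<omega>\<close> touches this endpoint, and only one branch does.\<close>

lemma coding_endpoint:
  assumes "coding a b \<omega> \<in> {0, 1}" shows "\<omega> n = \<omega> 0"
proof -
  define t where "t n = coding a b (\<lambda>k. \<omega> (k + n))" for n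
  have t: "t n = a (\<omega> n) * t (Suc n) + b (\<omega> n)" for n
    unfolding t_def by (subst coding_shift) (simp add: branch_def)
  have t01: "0 \<le> t n" "t n \<le> 1" for n using coding_unit[of "\<lambda>k. \<omega> (k + n)"] by (auto simp: t_def)
  have overlap: "e = e'" if "b e = b e' \<or> a e + b e = a e' + b e'" for e e'
  proof (rule ccontr)
    assume "e \<noteq> e'"
    \<comment> \<open>A point in the interior of both branches, close to the common endpoint.\<close>
    define z where "z = (if b e = b e' then b e + min (a e) (a e') / 2 else a e + b e - min (a e) (a e') / 2)"
    have "z \<in> {b e<..<a e + b e} \<inter> {b e'<..<a e' + b e'}"
      using that a_pos[of e] a_pos[of e'] by (auto simp: z_def min_def)
    then show False using disjoint_interiors[OF \<open>e \<noteq> e'\<close>] by blast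
  qed
  have step0: "b (\<omega> n) = 0 \<and> t (Suc n) = 0" if "t n = 0" for n
  proof -
    have "0 \<le> a (\<omega> n) * t (Suc n)" using a_pos t01 by (simp add: less_imp_le)
    then have "a (\<omega> n) * t (Suc n) = 0" "b (\<omega> n) = 0" using t[of n] that b_nonneg[of "\<omega> n"] by linarith+
    then show ?thesis using a_pos[of "\<omega> n"] by auto
  qed
  have step1: "a (\<omega> n) + b (\<omega> n) = 1 \<and> t (Suc n) = 1" if "t n = 1" for n
  proof -
    have "0 \<le> a (\<omega> n) * (1 - t (Suc n))" using a_pos t01 by (simp add: less_imp_le)
    moreover have "a (\<omega> n) * (1 - t (Suc n)) = a (\<omega> n) + b (\<omega> n) - 1"
      using t[of n] that by (simp add: algebra_simps)
    ultimately have "a (\<omega> n) * (1 - t (Suc n)) = 0" "a (\<omega> n) + b (\<omega> n) = 1"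
      using a_plus_b[of "\<omega> n"] by linarith+
    then show ?thesis using a_pos[of "\<omega> n"] by auto
  qed
  have "t 0 \<in> {0, 1}" using assms by (simp add: t_def)
  then consider "t 0 = 0" | "t 0 = 1" by auto
  then show ?thesis
  proof cases
    case 1
    then have "t k = 0" for k by (induction k) (use step0 in auto)
    then show ?thesis using step0 overlap by metis
  next
    case 2
    then have "t k = 1" for k by (induction k) (use step1 in auto)
    then show ?thesis using step1 overlap by metis
  qed
qed

lemma coding2_eq: "coding2 a b \<tau> = (coding a b (future \<tau>), coding a b (past \<tau>))"
  by (simp add: coding2_def future_def past_def)

lemma coding_future: "coding a b (future \<tau>) = branch a b (\<tau> 0) (coding a b (future (translate 1 \<tau>)))"
  by (subst coding_shift) (simp add: future_def translate_apply add.commute)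

lemma coding_past: "coding a b (past (translate 1 \<tau>)) = branch a b (\<tau> 0) (coding a b (past \<tau>))"
proof -
  have "(\<lambda>n. past (translate 1 \<tau>) (Suc n)) = past \<tau>"
    unfolding past_def translate_apply by (intro ext) (auto intro!: arg_cong[where f = \<tau>])
  moreover have "past (translate 1 \<tau>) 0 = \<tau> 0" by (simp add: past_def translate_apply)
  ultimately show ?thesis by (subst coding_shift) simp
qed

text \<open>The conjugacy with the shift, for sequences whose point is in the interior of its branch.\<close>

lemma natural_extension_coding2:
  assumes "coding a b (future (translate 1 \<tau>)) \<notin> {0, 1}"
  shows "natural_extension a b (coding2 a b \<tau>) = coding2 a b (translate 1 \<tau>)"
    and "digit a b (fst (coding2 a b \<tau>)) = \<tau> 0"
proof -
  have "coding a b (future (translate 1 \<tau>)) \<in> {0<..<1}"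
    using assms coding_unit[of "future (translate 1 \<tau>)"] by auto
  then have x: "coding a b (future \<tau>) \<in> {b (\<tau> 0)<..<a (\<tau> 0) + b (\<tau> 0)}"
    unfolding coding_future[of \<tau>] by (rule branch_open_unit)
  then have d: "digit a b (coding a b (future \<tau>)) = \<tau> 0" by (rule digit_eq)
  then show "digit a b (fst (coding2 a b \<tau>)) = \<tau> 0" by (simp add: coding2_eq)
  have reg: "coding a b (future \<tau>) \<in> regular_set a b" using x by (auto simp: regular_set_eq)
  have "luroth_map a b (coding a b (future \<tau>)) = coding a b (future (translate 1 \<tau>))"
    unfolding luroth_map_def d using reg coding_future[of \<tau>] a_pos[of "\<tau> 0"]
    by (simp add: branch_def field_simps)
  then show "natural_extension a b (coding2 a b \<tau>) = coding2 a b (translate 1 \<tau>)"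
    using reg d by (simp add: natural_extension_def coding2_eq coding_past branch_def)
qed

end

section \<open>Local dimension of the law of the past\<close>

lemma eventually_at_right_0_ln:
  fixes K :: real shows "\<forall>\<^sub>F r in at_right 0. K < - ln r \<and> 0 < r \<and> r < 1"
proof -
  have "\<forall>\<^sub>F r::real in at_right 0. r < min 1 (exp (- K))"
    by (intro eventually_at_right_less[THEN eventually_mono] eventually_at_rightI[of 0 "min 1 (exp (- K))"]) auto
  moreover have "\<forall>\<^sub>F r::real in at_right 0. 0 < r" by (rule eventually_at_right_less)
  ultimately show ?thesis
  proof eventually_elim
    case (elim r)
    then have "ln r < ln (exp (- K))" by (subst ln_less_cancel_iff) auto
    with elim show ?case by auto
  qed
qed

text \<open>A bound along a geometric sequence of radii suffices, because \<open>- ln r\<close> changes by the bounded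
  amount \<open>c\<close> between two of them.\<close>

lemma log_ratio_upper:
  fixes q :: "real \<Rightarrow> real"
  assumes pos: "\<And>r. 0 < r \<Longrightarrow> 0 < q r" and "0 < c" "0 \<le> s" "0 < \<delta>"
    and bound: "\<forall>\<^sub>F n in sequentially. \<forall>r. exp (- (real n * c)) < r \<longrightarrow> exp (- (real n * s)) \<le> q r"
  shows "\<forall>\<^sub>F r in at_right 0. ln (q r) / ln r \<le> s / c + \<delta>"
proof -
  obtain N where N: "\<And>n r. n \<ge> N \<Longrightarrow> exp (- (real n * c)) < r \<Longrightarrow> exp (- (real n * s)) \<le> q r"
    using bound by (auto simp: eventually_sequentially)
  show ?thesis
    using eventually_at_right_0_ln[of "max (s / \<delta>) (real N * c)"]
  proof eventually_elim
    case (elim r)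
    define L where "L = - ln r"
    have L: "s / \<delta> < L" "real N * c < L" "0 < L" "0 < r" using elim by (auto simp: L_def)
    \<comment> \<open>The least \<open>n\<close> with \<open>exp (- n c) < r\<close>.\<close>
    define n where "n = nat \<lfloor>L / c\<rfloor> + 1"
    have "0 \<le> \<lfloor>L / c\<rfloor>" using L \<open>0 < c\<close> by simp
    then have rn: "real n = of_int \<lfloor>L / c\<rfloor> + 1" by (simp add: n_def)
    have n1: "L / c < real n" "real n \<le> L / c + 1" unfolding rn by linarith+
    have "real N < L / c" using L \<open>0 < c\<close> by (simp add: field_simps)
    then have "n \<ge> N" using n1 by linarith
    have "- (real n * c) < ln r" using n1(1) \<open>0 < c\<close> by (simp add: L_def field_simps)
    then have "exp (- (real n * c)) < r" using L by (metis exp_less_cancel_iff exp_ln)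
    then have "exp (- (real n * s)) \<le> q r" using N \<open>n \<ge> N\<close> by blast
    then have "- (real n * s) \<le> ln (q r)" using pos[OF \<open>0 < r\<close>] by (simp add: ln_ge_iff)
    moreover have "real n * s \<le> (L / c + 1) * s" using n1(2) \<open>0 \<le> s\<close> by (rule mult_right_mono)
    ultimately have "- ln (q r) \<le> (L / c + 1) * s" by simp
    moreover have "s < \<delta> * L" using L \<open>0 < \<delta>\<close> by (simp add: field_simps)
    ultimately have "- ln (q r) \<le> (s / c + \<delta>) * L" by (simp add: algebra_simps)
    then have "- ln (q r) / L \<le> s / c + \<delta>" using L(3) by (simp only: pos_divide_le_eq)
    then show ?case by (simp add: L_def)
  qed
qed

lemma log_ratio_lower:
  fixes q :: "real \<Rightarrow> real"
  assumes pos: "\<And>r. 0 < r \<Longrightarrow> 0 < q r" and mono: "\<And>r r'. r \<le> r' \<Longrightarrow> q r \<le> q r'"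
    and "0 < c" "0 \<le> d" "0 < \<delta>"
    and bound: "\<forall>\<^sub>F n in sequentially. q (exp (- (real n * c))) \<le> exp (- (real n * d))"
  shows "\<forall>\<^sub>F r in at_right 0. d / c - \<delta> \<le> ln (q r) / ln r"
proof -
  obtain N where N: "\<And>n. n \<ge> N \<Longrightarrow> q (exp (- (real n * c))) \<le> exp (- (real n * d))"
    using bound by (auto simp: eventually_sequentially)
  show ?thesis
    using eventually_at_right_0_ln[of "max (d / \<delta>) ((real N + 1) * c)"]
  proof eventually_elim
    case (elim r)
    define L where "L = - ln r"
    have L: "d / \<delta> < L" "(real N + 1) * c < L" "0 < L" "0 < r" using elim by (auto simp: L_def)
    \<comment> \<open>The largest \<open>n\<close> with \<open>r \<le> exp (- n c)\<close>.\<close>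
    define n where "n = nat \<lfloor>L / c\<rfloor>"
    have "0 \<le> \<lfloor>L / c\<rfloor>" using L \<open>0 < c\<close> by simp
    then have rn: "real n = of_int \<lfloor>L / c\<rfloor>" by (simp add: n_def)
    have n1: "real n \<le> L / c" "L / c - 1 \<le> real n" unfolding rn by linarith+
    have "real N + 1 < L / c" using L \<open>0 < c\<close> by (simp add: field_simps)
    then have "n \<ge> N" using n1 by linarith
    have "ln r \<le> - (real n * c)" using n1(1) \<open>0 < c\<close> by (simp add: L_def field_simps)
    then have "r \<le> exp (- (real n * c))" using L by (metis exp_le_cancel_iff exp_ln)
    then have "q r \<le> exp (- (real n * d))" using N[OF \<open>n \<ge> N\<close>] mono by (meson order_trans)
    then have "ln (q r) \<le> - (real n * d)" using pos[OF \<open>0 < r\<close>] by (metis exp_gt_zero ln_exp ln_le_cancel_iff)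
    moreover have "(L / c - 1) * d \<le> real n * d" using n1(2) \<open>0 \<le> d\<close> by (rule mult_right_mono)
    ultimately have "(L / c - 1) * d \<le> - ln (q r)" by simp
    moreover have "d < \<delta> * L" using L \<open>0 < \<delta>\<close> by (simp add: field_simps)
    ultimately have "(d / c - \<delta>) * L \<le> - ln (q r)" by (simp add: algebra_simps)
    then have "d / c - \<delta> \<le> - ln (q r) / L" using L(3) by (simp only: pos_le_divide_eq)
    then show ?case by (simp add: L_def)
  qed
qed

lemma le_exp_iff:
  fixes p x :: real
  assumes "0 < p" shows "p \<le> exp x \<longleftrightarrow> ln p \<le> x"
  using assms by (metis exp_le_cancel_iff exp_ln)

context luroth
begin

text \<open>Each of these cylinders contains an interval of length \<open>r\<close> inside the interval of radius \<open>2 * r\<close>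
  around \<open>z\<close>; these intervals are disjoint.\<close>

lemma long_cylinders_near_point:
  assumes "finite W" and len: "\<And>w. w \<in> W \<Longrightarrow> length w = n \<and> r \<le> word_length w \<and> y w \<in> word_map w ` {0..1} \<and> dist (y w) z < r"
    and "0 < r"
  shows "card W \<le> 4"
proof -
  \<comment> \<open>The left end of an interval of length \<open>r\<close> inside the cylinder that has \<open>y w\<close> in its closure.\<close>
  define c where "c w = max (word_map w 0) (y w - r)" for w
  have c: "word_map w 0 \<le> c w \<and> c w + r \<le> word_map w 0 + word_length w \<and> z - 2 * r \<le> c w \<and> c w + r \<le> z + 2 * r"
    if "w \<in> W" for w
    using len[OF that] unfolding word_map_image c_def dist_real_def by auto
  have "(\<Sum>w\<in>W. (c w + r) - c w) \<le> (z + 2 * r) - (z - 2 * r)"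
  proof (rule sum_of_disjoint_lengths)
    show "disjoint_family_on (\<lambda>w. {c w<..<c w + r}) W"
      unfolding disjoint_family_on_def
    proof (intro ballI impI)
      fix u v assume uv: "u \<in> W" "v \<in> W" "u \<noteq> v"
      have "{c w<..<c w + r} \<subseteq> {word_map w 0<..<word_map w 0 + word_length w}" if "w \<in> W" for w
        using c[OF that] by auto
      then show "{c u<..<c u + r} \<inter> {c v<..<c v + r} = {}"
        using open_cylinders_disjoint[of u v] uv len by blast
    qed
  qed (use assms c in auto)
  then have "real (card W) * r \<le> 4 * r" by simp
  then show ?thesis using \<open>0 < r\<close> by simp
qed

end

locale luroth_gibbs = luroth a b + gibbs_shift M F C
  for a b :: "'e::countable \<Rightarrow> real" and M :: "(int \<Rightarrow> 'e) measure" and F C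
begin

definition pt :: "(int \<Rightarrow> 'e) \<Rightarrow> real" where
  "pt \<tau> = coding a b (past \<tau>)"

definition past_word :: "nat \<Rightarrow> (int \<Rightarrow> 'e) \<Rightarrow> 'e list" where
  "past_word n \<tau> = map (past \<tau>) [0..<n]"

definition information :: "nat \<Rightarrow> (int \<Rightarrow> 'e) \<Rightarrow> real" where
  "information n \<tau> = - ln (prob {\<tau>'. past_word n \<tau>' = past_word n \<tau>})"

definition ball_mass :: "real \<Rightarrow> real \<Rightarrow> real" where
  "ball_mass y r = prob {\<tau>. dist y (pt \<tau>) < r}"

text \<open>The integral of \<open>F\<close>, which may be infinite. By the Gibbs inequality \<open>F \<ge> - ln C\<close>, so the
  integrand below is nonnegative and its integral exists in \<open>[0, \<infinity>]\<close>.\<close>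

definition gibbs_entropy :: ereal where
  "gibbs_entropy = enn2ereal (\<integral>\<^sup>+\<tau>. ennreal (F \<tau> + ln C) \<partial>M) - ereal (ln C)"

definition mean_contraction :: ereal where
  "mean_contraction = enn2ereal (\<integral>\<^sup>+\<tau>. ennreal (- ln (a (\<tau> 0))) \<partial>M)"

lemma past_word_eq_rev: "past_word n \<tau> = rev (block (- int n) n \<tau>)"
  unfolding past_word_def past_def
  by (auto simp: list_eq_iff_nth_eq rev_nth intro!: arg_cong[where f = \<tau>])

lemma past_word_events [measurable]: "{\<tau>. past_word n \<tau> \<in> U} \<in> events"
  using block_events[of "- int n" n "rev -` U"] by (simp add: past_word_eq_rev)

lemma length_past_word [simp]: "length (past_word n \<tau>) = n"
  by (simp add: past_word_def)

lemma measurable_pt [measurable]: "pt \<in> borel_measurable M"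
  unfolding pt_def by measurable

lemma ball_events [measurable]: "{\<tau>. dist y (pt \<tau>) < r} \<in> events"
proof -
  have "{\<tau>\<in>space M. dist y (pt \<tau>) < r} \<in> events" by measurable
  then show ?thesis by simp
qed

lemma prob_past_word:
  "prob {\<tau>'. past_word n \<tau>' = past_word n \<tau>} = prob (cylinder (block 0 n (translate (- int n) \<tau>)))"
  using prob_block_eq[of "- int n" "block (- int n) n \<tau>"]
  by (simp add: past_word_eq_rev block_translate)

lemma prob_past_word_pos: "0 < prob {\<tau>'. past_word n \<tau>' = past_word n \<tau>}"
  unfolding prob_past_word by (rule prob_cylinder_pos)

lemma backward_sum:
  "(\<Sum>k<n. F (translate (int k) (translate (- int n) \<tau>))) = (\<Sum>j<n. F (translate (-1) ((translate (-1) ^^ j) \<tau>)))"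
proof -
  have "(\<Sum>j<n. F (translate (- int (Suc j)) \<tau>)) = (\<Sum>k<n. F (translate (- int (Suc (n - Suc k))) \<tau>))"
    by (rule sum.nat_diff_reindex[symmetric])
  also have "\<dots> = (\<Sum>k<n. F (translate (int k) (translate (- int n) \<tau>)))"
    by (intro sum.cong) (auto simp: Suc_diff_Suc of_nat_diff)
  finally show ?thesis by (simp add: translate_funpow)
qed

lemma information_approx:
  "\<bar>information n \<tau> - (\<Sum>j<n. F (translate (-1) ((translate (-1) ^^ j) \<tau>)))\<bar> \<le> ln C"
proof -
  let ?S = "\<Sum>j<n. F (translate (-1) ((translate (-1) ^^ j) \<tau>))"
  let ?p = "prob {\<tau>'. past_word n \<tau>' = past_word n \<tau>}"
  have "exp (- ?S) \<le> C * ?p" "?p \<le> C * exp (- ?S)"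
    using gibbs_lower[where n = n and \<tau> = "translate (- int n) \<tau>"]
      gibbs_upper[where n = n and \<tau> = "translate (- int n) \<tau>"]
    unfolding backward_sum prob_past_word by auto
  moreover have "0 < ?p" by (rule prob_past_word_pos)
  ultimately have "ln (exp (- ?S)) \<le> ln (C * ?p)" "ln ?p \<le> ln (C * exp (- ?S))"
    by (meson exp_gt_zero less_le_trans ln_le_cancel_iff)+
  moreover have "ln (C * ?p) = ln C + ln ?p" "ln (C * exp (- ?S)) = ln C - ?S"
    using C_ge_1 \<open>0 < ?p\<close> by (auto simp: ln_mult)
  ultimately show ?thesis unfolding information_def by simp
qed

lemma information_nonneg: "0 \<le> information n \<tau>"
  using prob_past_word_pos[of n \<tau>] by (simp add: information_def)

lemma F_lower_bound: "0 \<le> F \<tau> + ln C"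
proof -
  have "exp (- F \<tau>) \<le> C * prob (cylinder (block 0 1 \<tau>))"
    using gibbs_lower[where n = 1 and \<tau> = \<tau>] by simp
  also have "\<dots> \<le> C * 1" using C_ge_1 by (intro mult_left_mono) auto
  finally have "ln (exp (- F \<tau>)) \<le> ln C" using C_ge_1 by (subst ln_le_cancel_iff) auto
  then show ?thesis by simp
qed

lemma backward_ergodic_theorem:
  fixes f :: "(int \<Rightarrow> 'e) \<Rightarrow> real"
  assumes [measurable]: "f \<in> borel_measurable M" and "\<And>\<tau>. 0 \<le> f \<tau>"
  shows "AE \<tau> in M. (\<lambda>n. ereal ((\<Sum>k<n. f (translate (-1) ((translate (-1) ^^ k) \<tau>))) / real n))
    \<longlonglongrightarrow> enn2ereal (\<integral>\<^sup>+\<tau>. ennreal (f \<tau>) \<partial>M)"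
proof -
  have "AE \<tau> in M. (\<lambda>n. ereal ((\<Sum>k<n. (\<lambda>\<tau>. f (translate (-1) \<tau>)) ((translate (-1) ^^ k) \<tau>)) / real n))
    \<longlonglongrightarrow> enn2ereal (\<integral>\<^sup>+\<tau>. ennreal ((\<lambda>\<tau>. f (translate (-1) \<tau>)) \<tau>) \<partial>M)"
  proof (rule ergodic_theorem_nonneg)
    fix A assume A: "A \<in> events" and inv: "\<And>\<tau>. \<tau> \<in> space M \<Longrightarrow> (translate (-1) \<tau> \<in> A) = (\<tau> \<in> A)"
    have neg: "translate (- int n) \<tau> \<in> A \<longleftrightarrow> \<tau> \<in> A" for n \<tau>
    proof (induction n)
      case (Suc n)
      have "translate (- int (Suc n)) \<tau> = translate (-1) (translate (- int n) \<tau>)" by simp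
      then show ?case using inv[of "translate (- int n) \<tau>"] Suc by (simp only: space_M UNIV_I)
    qed simp
    have pos: "translate (int n) \<tau> \<in> A \<longleftrightarrow> \<tau> \<in> A" for n \<tau>
      using neg[of n "translate (int n) \<tau>"] by simp
    have "translate i \<tau> \<in> A \<longleftrightarrow> \<tau> \<in> A" for i \<tau>
      using pos[of "nat i" \<tau>] neg[of "nat (- i)" \<tau>] by (cases "0 \<le> i") auto
    then show "prob A = 0 \<or> prob A = 1" by (intro ergodic A)
  qed (use assms in \<open>auto simp: distr_translate\<close>)
  then show ?thesis using nn_integral_translate[of "\<lambda>\<tau>. ennreal (f \<tau>)" "-1"] by simp
qed

text \<open>The Shannon-McMillan-Breiman theorem, which here is the ergodic theorem for \<open>F\<close>.\<close>

lemma AE_information: "AE \<tau> in M. (\<lambda>n. ereal (information n \<tau> / real n)) \<longlonglongrightarrow> gibbs_entropy"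
proof -
  have "AE \<tau> in M. (\<lambda>n. ereal ((\<Sum>k<n. (F (translate (-1) ((translate (-1) ^^ k) \<tau>)) + ln C)) / real n))
    \<longlonglongrightarrow> enn2ereal (\<integral>\<^sup>+\<tau>. ennreal (F \<tau> + ln C) \<partial>M)"
    by (rule backward_ergodic_theorem) (use F_lower_bound in auto)
  then show ?thesis
  proof eventually_elim
    case (elim \<tau>)
    let ?S = "\<lambda>n. \<Sum>k<n. F (translate (-1) ((translate (-1) ^^ k) \<tau>))"
    have err: "(\<lambda>n. (information n \<tau> - ?S n) / real n) \<longlonglongrightarrow> 0"
    proof (rule Lim_null_comparison)
      show "(\<lambda>n. ln C / real n) \<longlonglongrightarrow> 0" by (rule lim_const_over_n)
      show "\<forall>\<^sub>F n in sequentially. norm ((information n \<tau> - ?S n) / real n) \<le> ln C / real n"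
        using information_approx[of _ \<tau>] by (intro always_eventually allI) (simp add: divide_right_mono)
    qed
    have "(\<lambda>n. ereal ((\<Sum>k<n. (F (translate (-1) ((translate (-1) ^^ k) \<tau>)) + ln C)) / real n)
        + ereal ((information n \<tau> - ?S n) / real n - ln C)) \<longlonglongrightarrow> enn2ereal (\<integral>\<^sup>+\<tau>. ennreal (F \<tau> + ln C) \<partial>M) + ereal (0 - ln C)"
      using err by (intro tendsto_add_ereal_general elim tendsto_intros) auto
    moreover have "\<forall>\<^sub>F n in sequentially. ereal ((\<Sum>k<n. (F (translate (-1) ((translate (-1) ^^ k) \<tau>)) + ln C)) / real n)
        + ereal ((information n \<tau> - ?S n) / real n - ln C) = ereal (information n \<tau> / real n)"
      using eventually_gt_at_top[of "0::nat"]
      by eventually_elim (simp add: sum.distrib field_simps)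
    ultimately have "(\<lambda>n. ereal (information n \<tau> / real n)) \<longlonglongrightarrow> enn2ereal (\<integral>\<^sup>+\<tau>. ennreal (F \<tau> + ln C) \<partial>M) + ereal (0 - ln C)"
      by (rule Lim_transform_eventually)
    then show ?case by (simp add: gibbs_entropy_def minus_ereal_def)
  qed
qed

lemma ln_word_length: "- ln (word_length (past_word n \<tau>)) = (\<Sum>k<n. - ln (a (past \<tau> k)))"
proof (induction n)
  case (Suc n)
  have "word_length (past_word (Suc n) \<tau>) = word_length (past_word n \<tau>) * a (past \<tau> n)"
    by (simp add: past_word_def word_length_def)
  then show ?case using Suc a_pos[of "past \<tau> n"] word_length_pos[of "past_word n \<tau>"] by (simp add: ln_mult)
qed (simp add: past_word_def)

lemma AE_word_length: "AE \<tau> in M. (\<lambda>n. ereal (- ln (word_length (past_word n \<tau>)) / real n)) \<longlonglongrightarrow> mean_contraction"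
proof -
  have [measurable]: "(\<lambda>\<tau>. \<tau> 0) \<in> M \<rightarrow>\<^sub>M count_space UNIV" by measurable
  have A: "AE \<tau> in M. (\<lambda>n. ereal ((\<Sum>k<n. (\<lambda>\<tau>. - ln (a (\<tau> 0))) (translate (-1) ((translate (-1) ^^ k) \<tau>))) / real n))
    \<longlonglongrightarrow> enn2ereal (\<integral>\<^sup>+\<tau>. ennreal (- ln (a (\<tau> 0))) \<partial>M)"
    by (rule backward_ergodic_theorem) (use a_pos a_less_1 in \<open>auto simp: less_imp_le\<close>)
  have eq: "past \<tau> k = translate (-1) ((translate (-1) ^^ k) \<tau>) 0" for k \<tau>
    unfolding translate_funpow past_def translate_apply by (rule arg_cong[where f = \<tau>]) simp
  show ?thesis unfolding ln_word_length mean_contraction_def eq by (rule A)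
qed

lemma pt_mem: "pt \<tau> \<in> word_map (past_word n \<tau>) ` {0..1}"
  unfolding pt_def past_word_def by (rule coding_mem)

lemma ball_mass_mono: "r \<le> r' \<Longrightarrow> ball_mass y r \<le> ball_mass y r'"
  unfolding ball_mass_def by (intro finite_measure_mono) auto

lemma ball_mass_le_1: "ball_mass y r \<le> 1"
  by (simp add: ball_mass_def)

lemma ball_mass_ge:
  assumes "word_length (past_word n \<tau>) < r"
  shows "exp (- information n \<tau>) \<le> ball_mass (pt \<tau>) r"
proof -
  have "exp (- information n \<tau>) = prob {\<tau>'. past_word n \<tau>' = past_word n \<tau>}"
    using prob_past_word_pos by (simp add: information_def)
  also have "\<dots> \<le> ball_mass (pt \<tau>) r"
    unfolding ball_mass_def
  proof (intro finite_measure_mono subsetI CollectI)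
    fix \<tau>' assume "\<tau>' \<in> {\<tau>'. past_word n \<tau>' = past_word n \<tau>}"
    then have "pt \<tau>' \<in> word_map (past_word n \<tau>) ` {0..1}" using pt_mem[of \<tau>' n] by simp
    then show "dist (pt \<tau>) (pt \<tau>') < r"
      using pt_mem[of \<tau> n] assms unfolding word_map_image dist_real_def by auto
  qed (rule ball_events)
  finally show ?thesis .
qed

lemma ball_mass_pos:
  assumes "0 < r" shows "0 < ball_mass (pt \<tau>) r"
proof -
  obtain n where "contraction ^ n < r"
    using real_arch_pow_inv[OF assms contraction_less_1] by blast
  then have "word_length (past_word n \<tau>) < r" using word_length_le[of "past_word n \<tau>"] by simp
  then show ?thesis using ball_mass_ge by (meson exp_gt_zero less_le_trans)
qed

text \<open>Words whose cylinder is long and meets the centre of a ball of large mass: the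
  exceptional words of the bound from below on the dimension.\<close>

definition heavy_words :: "nat \<Rightarrow> real \<Rightarrow> real \<Rightarrow> 'e list set" where
  "heavy_words n r q = {w. length w = n \<and> r \<le> word_length w \<and> (\<exists>y\<in>word_map w ` {0..1}. q \<le> ball_mass y r)}"

text \<open>Choose such a centre in each cylinder. Integrating the number of the chosen balls that contain a
  point, which is at most four, gives at least \<open>q\<close> times the number of words.\<close>

lemma card_heavy_words:
  assumes "0 < r" "0 < q"
  shows "finite (heavy_words n r q) \<and> real (card (heavy_words n r q)) * q \<le> 4"
proof -
  have *: "real (card W) * q \<le> 4" if W: "W \<subseteq> heavy_words n r q" "finite W" for W
  proof -
    have "\<forall>w\<in>W. \<exists>y. length w = n \<and> r \<le> word_length w \<and> y \<in> word_map w ` {0..1} \<and> q \<le> ball_mass y r"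
      using W unfolding heavy_words_def by blast
    then obtain y where y: "\<And>w. w \<in> W \<Longrightarrow> length w = n \<and> r \<le> word_length w \<and> y w \<in> word_map w ` {0..1} \<and> q \<le> ball_mass (y w) r"
      by metis
    have "real (card W) * q \<le> (\<Sum>w\<in>W. ball_mass (y w) r)"
      using sum_mono[of W "\<lambda>_. q" "\<lambda>w. ball_mass (y w) r"] y by simp
    also have "\<dots> = (\<Sum>w\<in>W. integral\<^sup>L M (indicator {\<tau>. dist (y w) (pt \<tau>) < r}))"
      unfolding ball_mass_def by (intro sum.cong) auto
    also have "\<dots> = (\<integral>\<tau>. (\<Sum>w\<in>W. indicator {\<tau>. dist (y w) (pt \<tau>) < r} \<tau>) \<partial>M)"
      by (rule Bochner_Integration.integral_sum[symmetric]) (simp add: ball_events emeasure_eq_measure)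
    also have "\<dots> \<le> (\<integral>\<tau>. 4 \<partial>M)"
    proof (rule integral_mono)
      show "(\<Sum>w\<in>W. indicator {\<tau>. dist (y w) (pt \<tau>) < r} \<tau>) \<le> (4::real)" for \<tau>
      proof -
        have "(\<Sum>w\<in>W. indicator {\<tau>. dist (y w) (pt \<tau>) < r} \<tau>) = (\<Sum>w\<in>W. if dist (y w) (pt \<tau>) < r then 1 else 0 :: real)"
          by (intro sum.cong) (auto simp: indicator_def)
        also have "\<dots> = real (card {w\<in>W. dist (y w) (pt \<tau>) < r})"
          using W(2) by (simp add: sum.If_cases Int_def)
        also have "\<dots> \<le> real 4"
        proof (rule of_nat_mono, rule long_cylinders_near_point)
          show "finite {w\<in>W. dist (y w) (pt \<tau>) < r}" using W(2) by simp
          show "length w = n \<and> r \<le> word_length w \<and> y w \<in> word_map w ` {0..1} \<and> dist (y w) (pt \<tau>) < r"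
            if "w \<in> {w\<in>W. dist (y w) (pt \<tau>) < r}" for w using y[of w] that by blast
        qed fact
        finally show ?thesis by simp
      qed
    qed (auto simp: ball_events emeasure_eq_measure)
    finally show ?thesis by (simp add: prob_space)
  qed
  have "finite (heavy_words n r q) \<and> card (heavy_words n r q) \<le> nat \<lfloor>4 / q\<rfloor>"
  proof (rule finite_if_finite_subsets_card_bdd)
    fix W assume "W \<subseteq> heavy_words n r q" "finite W"
    then have "real (card W) * q \<le> 4" by (rule *)
    then have "real (card W) \<le> 4 / q" using \<open>0 < q\<close> by (simp add: pos_le_divide_eq)
    then show "card W \<le> nat \<lfloor>4 / q\<rfloor>" by (rule le_nat_floor)
  qed
  then show ?thesis using * by blast
qed

text \<open>At scale \<open>exp (- n s)\<close> there are at most \<open>4 exp (n (h - 2 \<epsilon>))\<close> heavy words. Those of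
  mass at most \<open>exp (- n (h - \<epsilon>))\<close> have total mass at most \<open>4 exp (- n \<epsilon>)\<close>, which is summable;
  almost every sequence eventually has long cylinders of such a mass, hence words that are not heavy.\<close>

lemma AE_ball_mass_upper:
  assumes "0 < \<epsilon>" and h: "ereal (h - \<epsilon>) < gibbs_entropy" and s: "mean_contraction < ereal s"
  shows "AE \<tau> in M. \<forall>\<^sub>F n in sequentially. ball_mass (pt \<tau>) (exp (- (real n * s))) \<le> exp (- (real n * (h - 2 * \<epsilon>)))"
proof -
  define R where "R n = exp (- (real n * s))" for n :: nat
  define Q where "Q n = exp (- (real n * (h - 2 * \<epsilon>)))" for n :: nat
  define P where "P n = exp (- (real n * (h - \<epsilon>)))" for n :: nat
  define W where "W n = {w \<in> heavy_words n (R n) (Q n). prob {\<tau>. past_word n \<tau> = w} \<le> P n}" for n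
  have fin: "finite (W n)" for n
    using card_heavy_words[of "R n" "Q n" n] by (auto simp: R_def Q_def W_def)
  have prob_W: "prob {\<tau>. past_word n \<tau> \<in> W n} \<le> 4 * exp (- \<epsilon>) ^ n" for n
  proof -
    have "{\<tau>. past_word n \<tau> \<in> W n} = (\<Union>w\<in>W n. {\<tau>. past_word n \<tau> = w})" by auto
    then have "prob {\<tau>. past_word n \<tau> \<in> W n} \<le> (\<Sum>w\<in>W n. prob {\<tau>. past_word n \<tau> = w})"
      using fin past_word_events[of n "{_}"] by (simp add: finite_measure_subadditive_finite image_subset_iff)
    also have "\<dots> \<le> real (card (W n)) * P n"
      using sum_bounded_above[of "W n" "\<lambda>w. prob {\<tau>. past_word n \<tau> = w}" "P n"] by (simp add: W_def)
    also have "\<dots> \<le> (4 / Q n) * P n"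
    proof (intro mult_right_mono)
      have "card (W n) \<le> card (heavy_words n (R n) (Q n))"
        using card_heavy_words[of "R n" "Q n" n] by (intro card_mono) (auto simp: W_def R_def Q_def)
      then have "real (card (W n)) * Q n \<le> real (card (heavy_words n (R n) (Q n))) * Q n"
        by (intro mult_right_mono) (auto simp: Q_def)
      also have "\<dots> \<le> 4" using card_heavy_words[of "R n" "Q n" n] by (simp add: R_def Q_def)
      finally show "real (card (W n)) \<le> 4 / Q n" by (simp add: Q_def field_simps)
    qed (simp add: P_def)
    also have "\<dots> = 4 * exp (- (real n * \<epsilon>))"
    proof -
      have "P n = Q n * exp (- (real n * \<epsilon>))"
        by (simp add: P_def Q_def exp_add[symmetric] algebra_simps)
      moreover have "0 < Q n" by (simp add: Q_def)
      ultimately show ?thesis by simp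
    qed
    also have "\<dots> = 4 * exp (- \<epsilon>) ^ n" by (simp add: exp_of_nat_mult[symmetric])
    finally show ?thesis .
  qed
  have "AE \<tau> in M. \<forall>\<^sub>F n in sequentially. \<tau> \<in> space M - {\<tau>. past_word n \<tau> \<in> W n}"
  proof (rule borel_cantelli_AE1)
    show "summable (\<lambda>n. measure M {\<tau>. past_word n \<tau> \<in> W n})"
    proof (rule summable_comparison_test[where g = "\<lambda>n. 4 * exp (- \<epsilon>) ^ n"])
      show "summable (\<lambda>n. 4 * exp (- \<epsilon>) ^ n)"
        using \<open>0 < \<epsilon>\<close> by (intro summable_mult summable_geometric) simp
    qed (use prob_W in auto)
  qed (auto simp: emeasure_eq_measure)
  with AE_information AE_word_length show ?thesis
  proof eventually_elim
    case (elim \<tau>)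
    have "\<forall>\<^sub>F n in sequentially. ereal (h - \<epsilon>) < ereal (information n \<tau> / real n)"
      using elim(1) h by (rule order_tendstoD)
    moreover have "\<forall>\<^sub>F n in sequentially. ereal (- ln (word_length (past_word n \<tau>)) / real n) < ereal s"
      using elim(2) s by (rule order_tendstoD)
    ultimately show ?case
      using elim(3) eventually_gt_at_top[of "0::nat"]
    proof eventually_elim
      case (elim n)
      have "real n * (h - \<epsilon>) < information n \<tau>" using elim by (simp add: field_simps)
      then have "prob {\<tau>'. past_word n \<tau>' = past_word n \<tau>} \<le> P n"
        unfolding information_def P_def le_exp_iff[OF prob_past_word_pos] by simp
      moreover have "- (real n * s) < ln (word_length (past_word n \<tau>))" using elim by (simp add: field_simps)
      then have "R n \<le> word_length (past_word n \<tau>)"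
        unfolding R_def ln_ge_iff[OF word_length_pos, symmetric] by simp
      ultimately have "\<not> Q n \<le> ball_mass (pt \<tau>) (R n)"
        using elim(3) pt_mem[of \<tau> n] by (auto simp: W_def heavy_words_def)
      then show ?case by (simp add: Q_def R_def)
    qed
  qed
qed

lemma AE_local_dimension_upper:
  assumes "0 < c" "ereal c < mean_contraction" "gibbs_entropy < ereal s" "0 \<le> s" "0 < \<delta>"
  shows "AE \<tau> in M. \<forall>\<^sub>F r in at_right 0. ln (ball_mass (pt \<tau>) r) / ln r \<le> s / c + \<delta>"
  using AE_information AE_word_length
proof eventually_elim
  case (elim \<tau>)
  show ?case
  proof (rule log_ratio_upper)
    have "\<forall>\<^sub>F n in sequentially. ereal (information n \<tau> / real n) < ereal s"
      using elim(1) assms(3) by (rule order_tendstoD)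
    moreover have "\<forall>\<^sub>F n in sequentially. ereal c < ereal (- ln (word_length (past_word n \<tau>)) / real n)"
      using elim(2) assms(2) by (rule order_tendstoD)
    ultimately show "\<forall>\<^sub>F n in sequentially. \<forall>r. exp (- (real n * c)) < r \<longrightarrow> exp (- (real n * s)) \<le> ball_mass (pt \<tau>) r"
      using eventually_gt_at_top[of "0::nat"]
    proof eventually_elim
      case (elim n)
      have "ln (word_length (past_word n \<tau>)) < - (real n * c)" using elim by (simp add: field_simps)
      then have "word_length (past_word n \<tau>) < exp (- (real n * c))"
        using word_length_pos by (metis exp_ln exp_less_cancel_iff)
      then have "exp (- information n \<tau>) \<le> ball_mass (pt \<tau>) r" if "exp (- (real n * c)) < r" for r
        using that by (intro ball_mass_ge) simp
      moreover have "exp (- (real n * s)) \<le> exp (- information n \<tau>)" using elim by (simp add: field_simps)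
      ultimately show ?case by (meson order_trans)
    qed
  qed (use assms ball_mass_pos in auto)
qed

lemma AE_local_dimension_lower:
  assumes "0 < \<epsilon>" and "ereal (h - \<epsilon>) < gibbs_entropy" and "mean_contraction < ereal s" "0 < s" "0 < \<delta>"
  shows "AE \<tau> in M. \<forall>\<^sub>F r in at_right 0. max 0 (h - 2 * \<epsilon>) / s - \<delta> \<le> ln (ball_mass (pt \<tau>) r) / ln r"
  using AE_ball_mass_upper[OF assms(1-3)]
proof eventually_elim
  case (elim \<tau>)
  show ?case
  proof (rule log_ratio_lower)
    show "\<forall>\<^sub>F n in sequentially. ball_mass (pt \<tau>) (exp (- (real n * s))) \<le> exp (- (real n * max 0 (h - 2 * \<epsilon>)))"
      using elim by eventually_elim (auto simp: max_def ball_mass_le_1)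
  qed (use assms ball_mass_pos ball_mass_mono in auto)
qed

lemma gibbs_entropy_nonneg: "0 \<le> gibbs_entropy"
proof -
  have "AE \<tau> in M. 0 \<le> gibbs_entropy"
    using AE_information
  proof eventually_elim
    case (elim \<tau>)
    show ?case by (rule LIMSEQ_le_const[OF elim]) (auto simp: information_nonneg)
  qed
  then show ?thesis by simp
qed

lemma mean_contraction_pos: "0 < mean_contraction"
proof -
  have "0 < - ln contraction" using contraction_pos contraction_less_1 by simp
  moreover have "ennreal (- ln contraction) \<le> (\<integral>\<^sup>+\<tau>. ennreal (- ln (a (\<tau> 0))) \<partial>M)"
  proof -
    have "(\<integral>\<^sup>+\<tau>. ennreal (- ln contraction) \<partial>M) \<le> (\<integral>\<^sup>+\<tau>. ennreal (- ln (a (\<tau> 0))) \<partial>M)"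
      using a_pos a_le_contraction contraction_pos by (intro nn_integral_mono ennreal_leI) auto
    then show ?thesis by (simp add: emeasure_space_1)
  qed
  ultimately have "0 < (\<integral>\<^sup>+\<tau>. ennreal (- ln (a (\<tau> 0))) \<partial>M)"
    by (meson ennreal_less_zero_iff less_le_trans)
  then show ?thesis unfolding mean_contraction_def by (simp add: less_ennreal.rep_eq zero_ennreal.rep_eq)
qed

lemma AE_local_dimension_finite:
  assumes h: "gibbs_entropy = ereal h" and l: "mean_contraction = ereal l"
  shows "AE \<tau> in M. ((\<lambda>r. ln (ball_mass (pt \<tau>) r) / ln r) \<longlongrightarrow> h / l) (at_right 0)"
proof -
  have "0 \<le> h" "0 < l" using gibbs_entropy_nonneg mean_contraction_pos by (simp_all add: h l)
  \<comment> \<open>A null sequence below \<open>l\<close>, so that \<open>l - \<epsilon> k\<close> remains positive.\<close>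
  define \<epsilon> where "\<epsilon> k = l / real (k + 2)" for k
  have \<epsilon>: "0 < \<epsilon> k" "\<epsilon> k < l" for k using \<open>0 < l\<close> by (auto simp: \<epsilon>_def field_simps intro!: add_pos_nonneg)
  have \<epsilon>_lim: "\<epsilon> \<longlonglongrightarrow> 0"
    unfolding \<epsilon>_def by (rule LIMSEQ_ignore_initial_segment[OF lim_const_over_n])
  have "AE \<tau> in M. \<forall>k. \<forall>\<^sub>F r in at_right 0. ln (ball_mass (pt \<tau>) r) / ln r \<le> (h + \<epsilon> k) / (l - \<epsilon> k) + \<epsilon> k"
    unfolding AE_all_countable using \<epsilon> \<open>0 \<le> h\<close>
    by (intro allI AE_local_dimension_upper) (auto simp: h l less_imp_le add_nonneg_nonneg)
  moreover have "AE \<tau> in M. \<forall>k. \<forall>\<^sub>F r in at_right 0. max 0 (h - 2 * \<epsilon> k) / (l + \<epsilon> k) - \<epsilon> k \<le> ln (ball_mass (pt \<tau>) r) / ln r"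
    unfolding AE_all_countable using \<epsilon> \<open>0 < l\<close>
    by (intro allI AE_local_dimension_lower) (auto simp: h l add_pos_pos)
  ultimately show ?thesis
  proof eventually_elim
    case (elim \<tau>)
    have up: "(\<lambda>k. (h + \<epsilon> k) / (l - \<epsilon> k) + \<epsilon> k) \<longlonglongrightarrow> (h + 0) / (l - 0) + 0"
      using \<open>0 < l\<close> by (intro tendsto_intros \<epsilon>_lim) auto
    have low: "(\<lambda>k. max 0 (h - 2 * \<epsilon> k) / (l + \<epsilon> k) - \<epsilon> k) \<longlonglongrightarrow> max 0 (h - 2 * 0) / (l + 0) - 0"
      using \<open>0 < l\<close> by (intro tendsto_intros \<epsilon>_lim) auto
    show ?case
    proof (rule order_tendstoI)
      fix x assume "x < h / l"
      then have "\<forall>\<^sub>F k in sequentially. x < max 0 (h - 2 * \<epsilon> k) / (l + \<epsilon> k) - \<epsilon> k"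
        using \<open>0 \<le> h\<close> by (intro order_tendstoD(1)[OF low]) simp
      then obtain k where k: "x < max 0 (h - 2 * \<epsilon> k) / (l + \<epsilon> k) - \<epsilon> k"
        by (auto simp: eventually_sequentially)
      show "\<forall>\<^sub>F r in at_right 0. x < ln (ball_mass (pt \<tau>) r) / ln r"
        using elim(2)[rule_format, of k] by eventually_elim (use k in simp)
    next
      fix x assume "h / l < x"
      then have "\<forall>\<^sub>F k in sequentially. (h + \<epsilon> k) / (l - \<epsilon> k) + \<epsilon> k < x"
        by (intro order_tendstoD(2)[OF up]) simp
      then obtain k where k: "(h + \<epsilon> k) / (l - \<epsilon> k) + \<epsilon> k < x"
        by (auto simp: eventually_sequentially)
      show "\<forall>\<^sub>F r in at_right 0. ln (ball_mass (pt \<tau>) r) / ln r < x"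
        using elim(1)[rule_format, of k] by eventually_elim (use k in simp)
    qed
  qed
qed

text \<open>The bound from above gives the limit, as a local dimension is nonnegative.\<close>

lemma AE_local_dimension_infinite_exponent:
  assumes h: "gibbs_entropy \<noteq> \<infinity>" and l: "mean_contraction = \<infinity>"
  shows "AE \<tau> in M. ((\<lambda>r. ln (ball_mass (pt \<tau>) r) / ln r) \<longlongrightarrow> 0) (at_right 0)"
proof -
  obtain s where s: "gibbs_entropy < ereal s" "0 \<le> s"
    using h gibbs_entropy_nonneg by (cases gibbs_entropy) (auto intro: that[of "real_of_ereal gibbs_entropy + 1"])
  have "AE \<tau> in M. \<forall>k. \<forall>\<^sub>F r in at_right 0. ln (ball_mass (pt \<tau>) r) / ln r \<le> s / real (Suc k) + 1 / real (Suc k)"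
    unfolding AE_all_countable using s by (intro allI AE_local_dimension_upper) (auto simp: l)
  then show ?thesis
  proof eventually_elim
    case (elim \<tau>)
    have lim: "(\<lambda>k. (s + 1) / real (Suc k)) \<longlonglongrightarrow> 0" by (rule LIMSEQ_Suc[OF lim_const_over_n])
    show ?case
    proof (rule order_tendstoI)
      fix x :: real assume "x < 0"
      show "\<forall>\<^sub>F r in at_right 0. x < ln (ball_mass (pt \<tau>) r) / ln r"
        using eventually_at_right_0_ln[of 0]
      proof eventually_elim
        case (elim r)
        have "ln (ball_mass (pt \<tau>) r) \<le> 0" using ball_mass_pos[of r \<tau>] ball_mass_le_1 elim by simp
        then have "0 \<le> ln (ball_mass (pt \<tau>) r) / ln r" using elim by (intro divide_nonpos_nonpos) auto
        then show ?case using \<open>x < 0\<close> by linarith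
      qed
    next
      fix x :: real assume "0 < x"
      then have "\<forall>\<^sub>F k in sequentially. (s + 1) / real (Suc k) < x"
        by (intro order_tendstoD(2)[OF lim])
      then obtain k where k: "(s + 1) / real (Suc k) < x"
        by (auto simp: eventually_sequentially)
      show "\<forall>\<^sub>F r in at_right 0. ln (ball_mass (pt \<tau>) r) / ln r < x"
        using elim[rule_format, of k] by eventually_elim (use k in \<open>simp add: add_divide_distrib\<close>)
    qed
  qed
qed

lemma sum_a_ennreal: "(\<integral>\<^sup>+e. ennreal (a e) \<partial>count_space UNIV) \<le> 1"
proof -
  have "(\<integral>\<^sup>+e. ennreal (a e) \<partial>count_space UNIV) = (\<integral>\<^sup>+e. emeasure lborel {b e<..<a e + b e} \<partial>count_space UNIV)"
    using a_pos by (intro nn_integral_cong) (simp add: less_imp_le)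
  also have "\<dots> = emeasure lborel (\<Union>e. {b e<..<a e + b e})"
    using disjoint_interiors by (intro emeasure_UN_countable[symmetric]) (auto simp: disjoint_family_on_def)
  also have "\<dots> \<le> emeasure lborel {0..1::real}"
    using branch_interior_subset by (intro emeasure_mono) fastforce+
  finally show ?thesis by simp
qed

text \<open>With \<open>p e\<close> the mass of the cylinder of the symbol \<open>e\<close>, the Gibbs inequality bounds \<open>F\<close> by
  \<open>- ln (p e)\<close> up to a constant, and \<open>- ln (p e) \<le> - ln (a e) + a e / p e\<close>. The integral of the
  last term is the sum of all slopes, which are lengths of disjoint intervals.\<close>

lemma gibbs_entropy_finite:
  assumes "mean_contraction \<noteq> \<infinity>" shows "gibbs_entropy \<noteq> \<infinity>"
proof -
  have [measurable]: "(\<lambda>\<tau>. \<tau> 0) \<in> M \<rightarrow>\<^sub>M count_space UNIV" by measurable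
  define p where "p e = prob {\<tau>. block 0 1 \<tau> = [e]}" for e
  have p_eq: "p e = prob (cylinder [e])" for e
    using prob_block_eq[of 0 "[e]"] by (simp add: p_def)
  have p_pos: "0 < p e" for e unfolding p_eq by (rule prob_cylinder_pos)
  have block_1: "block 0 1 \<tau> = [\<tau> 0]" for \<tau> :: "int \<Rightarrow> 'e" by (simp add: block_def)
  have F_le: "F \<tau> + ln C \<le> - ln (a (\<tau> 0)) + (a (\<tau> 0) / p (\<tau> 0) + 2 * ln C)" for \<tau>
  proof -
    have "p (\<tau> 0) \<le> C * exp (- F \<tau>)"
      using gibbs_upper[where n = 1 and \<tau> = \<tau>] unfolding p_eq block_1 by simp
    then have "ln (p (\<tau> 0)) \<le> ln (C * exp (- F \<tau>))"
      using p_pos C_ge_1 by (subst ln_le_cancel_iff) auto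
    also have "\<dots> = ln C - F \<tau>" using C_ge_1 by (simp add: ln_mult)
    finally have "F \<tau> \<le> ln C - ln (p (\<tau> 0))" by simp
    moreover have "ln (a (\<tau> 0) / p (\<tau> 0)) \<le> a (\<tau> 0) / p (\<tau> 0) - 1"
      using a_pos p_pos by (intro ln_le_minus_one) simp
    then have "- ln (p (\<tau> 0)) \<le> - ln (a (\<tau> 0)) + a (\<tau> 0) / p (\<tau> 0)"
      using a_pos[of "\<tau> 0"] p_pos[of "\<tau> 0"] by (simp add: ln_div)
    ultimately show ?thesis by simp
  qed
  define D where "D = distr M (count_space UNIV) (\<lambda>\<tau>. \<tau> 0)"
  have D: "emeasure D {e} = ennreal (p e)" for e
  proof -
    have "(\<lambda>\<tau>. \<tau> 0) -` {e} \<inter> space M = {\<tau>. block 0 1 \<tau> = [e]}" unfolding block_1 by auto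
    then show ?thesis unfolding D_def p_def by (subst emeasure_distr) (auto simp: emeasure_eq_measure)
  qed
  have "D = density (count_space UNIV) (\<lambda>e. ennreal (p e))"
  proof (rule measure_eqI_countable[of _ UNIV])
    show "emeasure D {e} = emeasure (density (count_space UNIV) (\<lambda>e. ennreal (p e))) {e}" for e
      unfolding D by (subst emeasure_density) (auto simp: nn_integral_indicator_singleton)
  qed (auto simp: D_def)
  then have "(\<integral>\<^sup>+e. ennreal (a e / p e) \<partial>D) = (\<integral>\<^sup>+e. ennreal (p e) * ennreal (a e / p e) \<partial>count_space UNIV)"
    by (simp add: nn_integral_density)
  also have "\<dots> = (\<integral>\<^sup>+e. ennreal (a e) \<partial>count_space UNIV)"
    using p_pos a_pos by (intro nn_integral_cong) (simp add: ennreal_mult[symmetric] less_imp_le less_imp_neq[symmetric])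
  also have "(\<integral>\<^sup>+e. ennreal (a e / p e) \<partial>D) = (\<integral>\<^sup>+\<tau>. ennreal (a (\<tau> 0) / p (\<tau> 0)) \<partial>M)"
    unfolding D_def by (intro nn_integral_distr) auto
  finally have "(\<integral>\<^sup>+\<tau>. ennreal (a (\<tau> 0) / p (\<tau> 0)) \<partial>M) \<le> 1" using sum_a_ennreal by simp
  then have fin: "(\<integral>\<^sup>+\<tau>. ennreal (a (\<tau> 0) / p (\<tau> 0)) \<partial>M) < \<infinity>"
    using ennreal_one_less_top by (metis infinity_ennreal_def le_less_trans)
  have fin2: "(\<integral>\<^sup>+\<tau>. ennreal (- ln (a (\<tau> 0))) \<partial>M) < \<infinity>"
    using assms unfolding mean_contraction_def by (auto simp: less_top[symmetric])
  have nn: "0 \<le> - ln (a e)" "0 \<le> a e / p e" "0 \<le> 2 * ln C" for e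
    using a_pos[of e] a_less_1[of e] p_pos[of e] C_ge_1 by auto
  have "(\<integral>\<^sup>+\<tau>. ennreal (F \<tau> + ln C) \<partial>M) \<le>
      (\<integral>\<^sup>+\<tau>. ennreal (- ln (a (\<tau> 0))) + (ennreal (a (\<tau> 0) / p (\<tau> 0)) + ennreal (2 * ln C)) \<partial>M)"
    using F_le nn by (intro nn_integral_mono) (simp add: ennreal_plus[symmetric] ennreal_leI del: ennreal_plus)
  also have "\<dots> = (\<integral>\<^sup>+\<tau>. ennreal (- ln (a (\<tau> 0))) \<partial>M) + ((\<integral>\<^sup>+\<tau>. ennreal (a (\<tau> 0) / p (\<tau> 0)) \<partial>M) + ennreal (2 * ln C))"
    by (simp add: nn_integral_add emeasure_space_1)
  also have "\<dots> < \<infinity>" using fin fin2 by simp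
  finally show ?thesis unfolding gibbs_entropy_def by (cases "\<integral>\<^sup>+\<tau>. ennreal (F \<tau> + ln C) \<partial>M") auto
qed

end

section \<open>Entropy of finite-valued processes\<close>

context gibbs_shift
begin

text \<open>Entropies are expressed by these classes rather than by values of \<open>X\<close>, so that they depend only on
  the partition that \<open>X\<close> induces.\<close>

definition itinerary_class :: "((int \<Rightarrow> 'e) \<Rightarrow> 'x) \<Rightarrow> nat \<Rightarrow> (int \<Rightarrow> 'e) \<Rightarrow> (int \<Rightarrow> 'e) set" where
  "itinerary_class X n \<tau> = {\<tau>'. \<forall>k<n. X (translate (int k) \<tau>') = X (translate (int k) \<tau>)}"

definition process_entropy :: "((int \<Rightarrow> 'e) \<Rightarrow> 'x) \<Rightarrow> nat \<Rightarrow> real" where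
  "process_entropy X n = (\<integral>\<tau>. - ln (prob (itinerary_class X n \<tau>)) \<partial>M)"

lemma integrable_translate:
  fixes f :: "(int \<Rightarrow> 'e) \<Rightarrow> real"
  assumes "integrable M f"
  shows "integrable M (\<lambda>\<tau>. f (translate i \<tau>))" and "(\<integral>\<tau>. f (translate i \<tau>) \<partial>M) = (\<integral>\<tau>. f \<tau> \<partial>M)"
  using integrable_distr[OF measurable_translate_M, of i f] integral_distr[OF measurable_translate_M, of f i]
    assms by (simp_all add: distr_translate)

end

locale finite_process = gibbs_shift M F C
  for M :: "(int \<Rightarrow> 'e::countable) measure" and F C +
  fixes X :: "(int \<Rightarrow> 'e) \<Rightarrow> 'x" and P :: "'x set"
  assumes finite_P: "finite P" and X_in: "X \<tau> \<in> P" and X_events: "{\<tau>. X \<tau> = x} \<in> events"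
begin

definition words :: "nat \<Rightarrow> (nat \<Rightarrow> 'x) set" where
  "words n = ({..<n} \<rightarrow>\<^sub>E P)"

definition itinerary :: "nat \<Rightarrow> (int \<Rightarrow> 'e) \<Rightarrow> nat \<Rightarrow> 'x" where
  "itinerary n \<tau> = (\<lambda>k\<in>{..<n}. X (translate (int k) \<tau>))"

definition law :: "nat \<Rightarrow> (nat \<Rightarrow> 'x) \<Rightarrow> real" where
  "law n s = prob {\<tau>. itinerary n \<tau> = s}"

lemma finite_words: "finite (words n)"
  unfolding words_def by (intro finite_PiE) (auto simp: finite_P)

lemma itinerary_in: "itinerary n \<tau> \<in> words n"
  by (auto simp: itinerary_def words_def X_in)

lemma itinerary_eq_iff:
  "itinerary n \<tau> = s \<longleftrightarrow> s \<in> words n \<and> (\<forall>k<n. X (translate (int k) \<tau>) = s k)"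
proof
  assume "itinerary n \<tau> = s"
  then show "s \<in> words n \<and> (\<forall>k<n. X (translate (int k) \<tau>) = s k)"
    using itinerary_in[of n \<tau>] by (auto simp: itinerary_def)
next
  assume s: "s \<in> words n \<and> (\<forall>k<n. X (translate (int k) \<tau>) = s k)"
  show "itinerary n \<tau> = s"
    by (rule PiE_ext[where k = "{..<n}" and s = "\<lambda>_. P"])
      (use s itinerary_in[of n \<tau>] in \<open>auto simp: words_def itinerary_def\<close>)
qed

lemma X_translate_events: "{\<tau>. X (translate i \<tau>) = x} \<in> events"
  using measurable_sets[OF measurable_translate_M X_events] by (simp add: vimage_def)

lemma itinerary_events: "{\<tau>. itinerary n \<tau> = s} \<in> events"
proof (cases "s \<in> words n")
  case True
  then have "{\<tau>. itinerary n \<tau> = s} = {\<tau> \<in> space M. \<forall>k\<in>{..<n}. X (translate (int k) \<tau>) = s k}"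
    by (auto simp: itinerary_eq_iff)
  also have "\<dots> \<in> events"
    using X_translate_events by (intro sets.sets_Collect_finite_All) auto
  finally show ?thesis .
qed (simp add: itinerary_eq_iff)

lemma nth_itinerary: "k < n \<Longrightarrow> itinerary n \<tau> k = X (translate (int k) \<tau>)"
  by (simp add: itinerary_def)

lemma itinerary_class_eq: "itinerary_class X n \<tau> = {\<tau>'. itinerary n \<tau>' = itinerary n \<tau>}"
  unfolding itinerary_class_def itinerary_eq_iff[of n _ "itinerary n \<tau>"]
  using itinerary_in[of n \<tau>] by (simp add: nth_itinerary)

lemma law_itinerary: "law n (itinerary n \<tau>) = prob (itinerary_class X n \<tau>)"
  by (simp add: law_def itinerary_class_eq)

lemma law_nonneg: "0 \<le> law n s" and law_le_1: "law n s \<le> 1"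
  by (auto simp: law_def)

lemma
  fixes f :: "(nat \<Rightarrow> 'x) \<Rightarrow> real"
  shows integrable_itinerary: "integrable M (\<lambda>\<tau>. f (itinerary n \<tau>))"
    and integral_itinerary: "(\<integral>\<tau>. f (itinerary n \<tau>) \<partial>M) = (\<Sum>s\<in>words n. law n s * f s)"
proof -
  have eq: "f (itinerary n \<tau>) = (\<Sum>s\<in>words n. indicator {\<tau>. itinerary n \<tau> = s} \<tau> * f s)" for \<tau>
  proof -
    have "(\<Sum>s\<in>words n. indicator {\<tau>. itinerary n \<tau> = s} \<tau> * f s) = (\<Sum>s\<in>words n. if itinerary n \<tau> = s then f s else 0)"
      by (intro sum.cong) (simp_all add: indicator_def)
    then show ?thesis using itinerary_in[of n \<tau>] finite_words[of n] by (simp add: sum.delta)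
  qed
  have int: "integrable M (\<lambda>\<tau>. indicator {\<tau>. itinerary n \<tau> = s} \<tau> * f s)" for s
    using itinerary_events[of n s] by (intro integrable_mult_left) (simp add: emeasure_eq_measure)
  show "integrable M (\<lambda>\<tau>. f (itinerary n \<tau>))" unfolding eq using int by simp
  show "(\<integral>\<tau>. f (itinerary n \<tau>) \<partial>M) = (\<Sum>s\<in>words n. law n s * f s)"
    unfolding eq using int itinerary_events by (simp add: law_def)
qed

lemma sum_law: "(\<Sum>s\<in>words n. law n s) = 1"
  using integral_itinerary[of "\<lambda>_. 1" n] by simp

lemma process_entropy_eq: "process_entropy X n = - (\<Sum>s\<in>words n. law n s * ln (law n s))"
  using integral_itinerary[of "\<lambda>s. - ln (law n s)" n]
  by (simp add: process_entropy_def law_itinerary sum_negf)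

lemma process_entropy_nonneg: "0 \<le> process_entropy X n"
proof -
  have "law n s * ln (law n s) \<le> 0" for s
    using law_nonneg[of n s] law_le_1[of n s] by (cases "law n s = 0") (auto intro: mult_nonneg_nonpos)
  then show ?thesis unfolding process_entropy_eq by (simp add: sum_nonpos)
qed

lemma process_entropy_le:
  assumes "\<And>s. s \<in> words n \<Longrightarrow> 0 \<le> r s" "\<And>s. s \<in> words n \<Longrightarrow> 0 < law n s \<Longrightarrow> 0 < r s"
    and "(\<Sum>s\<in>words n. r s) \<le> 1"
  shows "process_entropy X n \<le> - (\<Sum>s\<in>words n. law n s * ln (r s))"
  unfolding process_entropy_eq
  by (rule gibbs_inequality[OF finite_words]) (use assms law_nonneg sum_law in auto)

definition head :: "nat \<Rightarrow> (nat \<Rightarrow> 'x) \<Rightarrow> nat \<Rightarrow> 'x" where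
  "head m s = restrict s {..<m}"

definition tail :: "nat \<Rightarrow> nat \<Rightarrow> (nat \<Rightarrow> 'x) \<Rightarrow> nat \<Rightarrow> 'x" where
  "tail m n s = (\<lambda>k\<in>{..<n}. s (m + k))"

lemma head_itinerary: "head m (itinerary (m + n) \<tau>) = itinerary m \<tau>"
  by (auto simp: head_def itinerary_def fun_eq_iff restrict_def)

lemma tail_itinerary: "tail m n (itinerary (m + n) \<tau>) = itinerary n (translate (int m) \<tau>)"
  by (auto simp: tail_def itinerary_def fun_eq_iff restrict_def add.commute)

lemma law_translate: "prob {\<tau>. itinerary n (translate i \<tau>) = s} = law n s"
  using prob_translate[OF itinerary_events, of i n s] by (simp add: law_def vimage_def)

lemma sum_law_head: "(\<Sum>s\<in>words (m + n). law (m + n) s * f (head m s)) = (\<Sum>s\<in>words m. law m s * f s)"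
  for f :: "_ \<Rightarrow> real"
  unfolding integral_itinerary[symmetric] head_itinerary ..

lemma sum_law_tail: "(\<Sum>s\<in>words (m + n). law (m + n) s * f (tail m n s)) = (\<Sum>s\<in>words n. law n s * f s)"
  for f :: "_ \<Rightarrow> real"
  unfolding integral_itinerary[symmetric] tail_itinerary
  by (rule integrable_translate(2)[OF integrable_itinerary])

lemma law_pos_parts:
  assumes "0 < law (m + n) s" shows "0 < law m (head m s)" "0 < law n (tail m n s)"
proof -
  have "law (m + n) s \<le> law m (head m s)"
    unfolding law_def by (intro finite_measure_mono itinerary_events) (auto simp: head_itinerary)
  then show "0 < law m (head m s)" using assms by simp
  have "{\<tau>. itinerary n (translate (int m) \<tau>) = tail m n s} \<in> events"
    using measurable_sets[OF measurable_translate_M itinerary_events] by (simp add: vimage_def)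
  then have "law (m + n) s \<le> prob {\<tau>. itinerary n (translate (int m) \<tau>) = tail m n s}"
    unfolding law_def by (intro finite_measure_mono) (auto simp: tail_itinerary)
  then show "0 < law n (tail m n s)" using assms by (simp add: law_translate)
qed

text \<open>The laws of the two parts are marginals of the law of the whole itinerary.\<close>

lemma sum_law_split:
  "(\<Sum>s\<in>words (m + n). law (m + n) s * ln (law m (head m s) * law n (tail m n s))) =
    - process_entropy X m - process_entropy X n"
proof -
  have "law (m + n) s * ln (law m (head m s) * law n (tail m n s)) =
      law (m + n) s * ln (law m (head m s)) + law (m + n) s * ln (law n (tail m n s))" for s
  proof (cases "law (m + n) s = 0")
    case False
    then have "0 < law (m + n) s" using law_nonneg[of "m + n" s] by simp
    then show ?thesis using law_pos_parts[of m n s] by (simp add: ln_mult algebra_simps)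
  qed simp
  then show ?thesis
    using sum_law_head[of m n "\<lambda>s. ln (law m s)"] sum_law_tail[of m n "\<lambda>s. ln (law n s)"]
    by (simp add: sum.distrib process_entropy_eq)
qed

text \<open>Compare the law of a long itinerary with the product of the laws of its two parts.\<close>

lemma process_entropy_subadditive: "process_entropy X (m + n) \<le> process_entropy X m + process_entropy X n"
proof -
  let ?r = "\<lambda>s. law m (head m s) * law n (tail m n s)"
  have inj: "inj_on (\<lambda>s. (head m s, tail m n s)) (words (m + n))"
  proof (rule inj_onI)
    fix s t assume st: "s \<in> words (m + n)" "t \<in> words (m + n)" "(head m s, tail m n s) = (head m t, tail m n t)"
    show "s = t"
    proof (rule PiE_ext)
      show "s \<in> {..<m + n} \<rightarrow>\<^sub>E P" "t \<in> {..<m + n} \<rightarrow>\<^sub>E P" using st by (auto simp: words_def)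
      fix k assume k: "k \<in> {..<m + n}"
      show "s k = t k"
      proof (cases "k < m")
        case True
        then have "head m s k = s k" "head m t k = t k" by (auto simp: head_def)
        then show ?thesis using st(3) by auto
      next
        case False
        then have "tail m n s (k - m) = s k" "tail m n t (k - m) = t k" using k by (auto simp: tail_def)
        then show ?thesis using st(3) by auto
      qed
    qed
  qed
  have sub: "(\<lambda>s. (head m s, tail m n s)) ` words (m + n) \<subseteq> words m \<times> words n"
  proof (intro image_subsetI SigmaI)
    fix s assume "s \<in> words (m + n)"
    then have "s k \<in> P" if "k < m + n" for k using that by (auto simp: words_def)
    then show "head m s \<in> words m" "tail m n s \<in> words n"
      unfolding words_def head_def tail_def restrict_PiE_iff by simp_all
  qed
  have "process_entropy X (m + n) \<le> - (\<Sum>s\<in>words (m + n). law (m + n) s * ln (?r s))"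
  proof (rule process_entropy_le)
    have "(\<Sum>s\<in>words (m + n). ?r s) = (\<Sum>(u, v)\<in>(\<lambda>s. (head m s, tail m n s)) ` words (m + n). law m u * law n v)"
      by (subst sum.reindex[OF inj]) simp
    also have "\<dots> \<le> (\<Sum>(u, v)\<in>words m \<times> words n. law m u * law n v)"
      using sub finite_words law_nonneg by (intro sum_mono2) auto
    also have "\<dots> = (\<Sum>u\<in>words m. law m u) * (\<Sum>v\<in>words n. law n v)"
      by (simp add: sum.cartesian_product[symmetric] sum_product)
    finally show "(\<Sum>s\<in>words (m + n). ?r s) \<le> 1" by (simp add: sum_law)
  qed (use law_nonneg law_pos_parts in auto)
  then show ?thesis unfolding sum_law_split by simp
qed

text \<open>If laws are multiplicative up to the factor \<open>D\<close>, entropy is additive up to \<open>ln D\<close>.\<close>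

lemma process_entropy_superadditive:
  assumes "0 < D" and "\<And>s. law (m + n) s \<le> D * (law m (head m s) * law n (tail m n s))"
  shows "process_entropy X m + process_entropy X n - ln D \<le> process_entropy X (m + n)"
proof -
  let ?r = "\<lambda>s. law m (head m s) * law n (tail m n s)"
  have "law (m + n) s * ln (law (m + n) s) \<le> law (m + n) s * ln D + law (m + n) s * ln (?r s)" for s
  proof (cases "law (m + n) s = 0")
    case False
    then have pos: "0 < law (m + n) s" using law_nonneg[of "m + n" s] by simp
    then have "ln (law (m + n) s) \<le> ln (D * ?r s)"
      using assms law_pos_parts[OF pos] by (subst ln_le_cancel_iff) auto
    also have "\<dots> = ln D + ln (?r s)" using assms(1) law_pos_parts[OF pos] by (intro ln_mult_pos) auto
    finally have "law (m + n) s * ln (law (m + n) s) \<le> law (m + n) s * (ln D + ln (?r s))"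
      using pos by (intro mult_left_mono) auto
    then show ?thesis by (simp add: algebra_simps)
  qed simp
  then have "(\<Sum>s\<in>words (m + n). law (m + n) s * ln (law (m + n) s)) \<le>
      (\<Sum>s\<in>words (m + n). law (m + n) s * ln D + law (m + n) s * ln (?r s))"
    by (rule sum_mono)
  also have "\<dots> = ln D + (- process_entropy X m - process_entropy X n)"
    by (simp only: sum.distrib sum_distrib_right[symmetric] sum_law sum_law_split)
  finally show ?thesis by (simp add: process_entropy_eq[of "m + n"])
qed

lemma convergent_entropy_rate: "convergent (\<lambda>n. process_entropy X n / real n)"
  by (rule fekete) (auto intro: process_entropy_subadditive process_entropy_nonneg)

lemma entropy_rate_lim: "(\<lambda>n. process_entropy X n / real n) \<longlonglongrightarrow> lim (\<lambda>n. process_entropy X n / real n)"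
  using convergent_entropy_rate by (simp add: convergent_LIMSEQ_iff)

text \<open>Each level set of \<open>X\<close> is approximated by an event determined by a window of symbols; outside
  the errors exactly one of these events holds, and \<open>Y\<close> selects it.\<close>

lemma block_code:
  assumes "\<epsilon> > 0"
  shows "\<exists>m Y. (\<forall>w. Y w \<in> P) \<and> {\<tau>. X \<tau> \<noteq> Y (block (- int m) (2 * m + 1) \<tau>)} \<in> events \<and>
    prob {\<tau>. X \<tau> \<noteq> Y (block (- int m) (2 * m + 1) \<tau>)} < \<epsilon>"
proof -
  have "P \<noteq> {}" using X_in by blast
  then have cP: "0 < card P" using finite_P by (simp add: card_gt_0_iff)
  define \<delta> where "\<delta> = \<epsilon> / real (card P)"
  have "\<delta> > 0" using assms cP by (simp add: \<delta>_def)
  have "\<forall>x. \<exists>m0. \<forall>m\<ge>m0. \<exists>U. prob (sym_diff {\<tau>. X \<tau> = x} {\<tau>. block (- int m) (2 * m + 1) \<tau> \<in> U}) < \<delta>"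
    using approx_by_blocks[OF X_events \<open>\<delta> > 0\<close>] by blast
  then obtain m0 where m0: "\<And>x m. m \<ge> m0 x \<Longrightarrow> \<exists>U. prob (sym_diff {\<tau>. X \<tau> = x} {\<tau>. block (- int m) (2 * m + 1) \<tau> \<in> U}) < \<delta>"
    by metis
  define m where "m = (\<Sum>x\<in>P. m0 x)"
  have "\<forall>x. \<exists>U. x \<in> P \<longrightarrow> prob (sym_diff {\<tau>. X \<tau> = x} {\<tau>. block (- int m) (2 * m + 1) \<tau> \<in> U}) < \<delta>"
    using m0 member_le_sum[of _ P m0] finite_P unfolding m_def by blast
  then obtain U where U: "\<And>x. x \<in> P \<Longrightarrow> prob (sym_diff {\<tau>. X \<tau> = x} {\<tau>. block (- int m) (2 * m + 1) \<tau> \<in> U x}) < \<delta>"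
    by metis
  let ?b = "block (- int m) (2 * m + 1) :: (int \<Rightarrow> 'e) \<Rightarrow> 'e list"
  let ?S = "\<lambda>x. sym_diff {\<tau>. X \<tau> = x} {\<tau>. ?b \<tau> \<in> U x}"
  obtain x0 where "x0 \<in> P" using \<open>P \<noteq> {}\<close> by blast
  define Y where "Y w = (if \<exists>x\<in>P. w \<in> U x then SOME x. x \<in> P \<and> w \<in> U x else x0)" for w
  have Y_in: "Y w \<in> P" for w
    using \<open>x0 \<in> P\<close> someI_ex[of "\<lambda>x. x \<in> P \<and> w \<in> U x"] unfolding Y_def by auto
  have sub: "{\<tau>. X \<tau> \<noteq> Y (?b \<tau>)} \<subseteq> (\<Union>x\<in>P. ?S x)"
  proof
    fix \<tau> assume "\<tau> \<in> {\<tau>. X \<tau> \<noteq> Y (?b \<tau>)}"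
    then have ne: "X \<tau> \<noteq> Y (?b \<tau>)" by simp
    show "\<tau> \<in> (\<Union>x\<in>P. ?S x)"
    proof (rule ccontr)
      assume no: "\<tau> \<notin> (\<Union>x\<in>P. ?S x)"
      have iff: "X \<tau> = x \<longleftrightarrow> ?b \<tau> \<in> U x" if "x \<in> P" for x
      proof -
        have "\<tau> \<notin> ?S x" using no that by blast
        then show ?thesis by blast
      qed
      have ex: "\<exists>x. x \<in> P \<and> ?b \<tau> \<in> U x" using iff[OF X_in] X_in by blast
      then have "Y (?b \<tau>) = (SOME x. x \<in> P \<and> ?b \<tau> \<in> U x)" by (auto simp: Y_def)
      then have "Y (?b \<tau>) \<in> P \<and> ?b \<tau> \<in> U (Y (?b \<tau>))" using someI_ex[OF ex] by simp
      then have "X \<tau> = Y (?b \<tau>)" using iff by blast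
      with ne show False by simp
    qed
  qed
  have S_events: "?S x \<in> events" for x using X_events[of x] block_events by auto
  have ev: "{\<tau>. X \<tau> \<noteq> Y (?b \<tau>)} \<in> events"
  proof -
    have "{\<tau>. X \<tau> \<noteq> Y (?b \<tau>)} = (\<Union>x\<in>P. {\<tau>. X \<tau> = x} \<inter> {\<tau>. ?b \<tau> \<in> {w. Y w \<noteq> x}})"
      using X_in by auto
    also have "\<dots> \<in> events" by (intro sets.finite_UN finite_P sets.Int X_events block_events)
    finally show ?thesis .
  qed
  have "prob {\<tau>. X \<tau> \<noteq> Y (?b \<tau>)} \<le> prob (\<Union>x\<in>P. ?S x)"
    using sub S_events finite_P by (intro finite_measure_mono) auto
  also have "\<dots> \<le> (\<Sum>x\<in>P. prob (?S x))"
    using S_events finite_P by (intro finite_measure_subadditive_finite) auto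
  also have "\<dots> < (\<Sum>x\<in>P. \<delta>)" using U finite_P \<open>P \<noteq> {}\<close> by (intro sum_strict_mono) auto
  also have "\<dots> = \<epsilon>" using cP by (simp add: \<delta>_def)
  finally show ?thesis using Y_in ev by blast
qed

text \<open>Let \<open>Y\<close> be a block code that equals \<open>X\<close> up to probability \<open>\<eta>\<^sup>2\<close>. Passing the sequence of
  its values through a channel \<open>K\<close> that keeps a letter with probability close to \<open>1\<close> and otherwise
  makes a uniform choice gives a probability \<open>r\<close> on itineraries of length \<open>n\<close>. By the Gibbs
  inequality for finite sums, the entropy of the law of \<open>X\<close> is at most the mean of \<open>- ln r\<close>. Restricting the
  integral that defines \<open>r\<close> to one cylinder bounds this by the mean information of words of length
  \<open>n + 2 * m\<close> plus \<open>n\<close> times the mean cost of the channel.\<close>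

lemma entropy_bound_via_code:
  assumes F: "integrable M F" and \<eta>: "0 < \<eta>" "\<eta> < 1"
  shows "lim (\<lambda>n. process_entropy X n / real n) \<le>
    integral\<^sup>L M F + (- ln (1 - \<eta>\<^sup>2) + \<eta>\<^sup>2 * ln (real (card P)) + 2 * \<eta>)"
proof -
  obtain m Y where Y_in: "\<And>w. Y w \<in> P"
    and D_events: "{\<tau>. X \<tau> \<noteq> Y (block (- int m) (2 * m + 1) \<tau>)} \<in> events"
    and D: "prob {\<tau>. X \<tau> \<noteq> Y (block (- int m) (2 * m + 1) \<tau>)} < \<eta>\<^sup>2"
    using block_code[of "\<eta>\<^sup>2"] \<eta> by auto
  define D where "D = {\<tau>. X \<tau> \<noteq> Y (block (- int m) (2 * m + 1) \<tau>)}"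
  define N where "N = real (card P)"
  have "P \<noteq> {}" using X_in by blast
  then have "card P \<noteq> 0" using finite_P by simp
  then have N1: "1 \<le> N" by (simp add: N_def)
  have \<eta>2: "0 < \<eta>\<^sup>2" "\<eta>\<^sup>2 < 1" using \<eta> by (auto simp: power_less_one_iff abs_square_less_1)
  \<comment> \<open>The uniform part keeps \<open>K\<close> positive; its weight makes the logarithmic cost of an error at most \<open>ln N + 2 / \<eta>\<close>, hence of order \<open>\<eta>\<close> on average.\<close>
  define K where "K x y = (1 - \<eta>\<^sup>2) * (if x = y then 1 else 0) + \<eta>\<^sup>2 / N" for x y :: 'x
  have K_pos: "0 < K x y" for x y using \<eta>2 N1 by (auto simp: K_def add_nonneg_pos)
  have K_ne: "K x y \<noteq> 0" for x y using K_pos[of x y] by simp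
  have K_sum: "(\<Sum>x\<in>P. K x y) = 1" if "y \<in> P" for y
    using that finite_P N1 \<open>P \<noteq> {}\<close> by (simp add: K_def sum.distrib sum_distrib_left[symmetric] N_def)
  have K_le: "K x y \<le> 1" for x y
  proof -
    have "\<eta>\<^sup>2 / N \<le> \<eta>\<^sup>2 / 1" using N1 \<eta>2 by (intro divide_left_mono) auto
    then show ?thesis using \<eta>2 by (auto simp: K_def)
  qed
  define y where "y k \<tau> = Y (block (int k - int m) (2 * m + 1) \<tau>)" for k :: nat and \<tau>
  define c where "c \<tau> = - ln (1 - \<eta>\<^sup>2) + indicator D \<tau> * (ln N + 2 / \<eta>)" for \<tau>
  have c_ge: "- ln (K (X (translate (int k) \<tau>)) (y k \<tau>)) \<le> c (translate (int k) \<tau>)" for k \<tau>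
  proof (cases "translate (int k) \<tau> \<in> D")
    case False
    then have "K (X (translate (int k) \<tau>)) (y k \<tau>) \<ge> 1 - \<eta>\<^sup>2"
      using \<eta>2 N1 by (simp add: D_def y_def K_def block_translate add.commute)
    then have "ln (1 - \<eta>\<^sup>2) \<le> ln (K (X (translate (int k) \<tau>)) (y k \<tau>))" using \<eta>2 K_pos by (subst ln_le_cancel_iff) auto
    then show ?thesis using False by (simp add: c_def)
  next
    case True
    then have "K (X (translate (int k) \<tau>)) (y k \<tau>) = \<eta>\<^sup>2 / N"
      by (simp add: D_def y_def K_def block_translate add.commute)
    then have "- ln (K (X (translate (int k) \<tau>)) (y k \<tau>)) = ln N - 2 * ln \<eta>"
      using N1 \<eta> by (simp add: ln_div ln_realpow)
    moreover have "- ln \<eta> \<le> 1 / \<eta>"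
      using ln_le_minus_one[of "1 / \<eta>"] \<eta> by (simp add: ln_div)
    moreover have "ln (1 - \<eta>\<^sup>2) \<le> 0" using \<eta>2 by simp
    ultimately show ?thesis using True by (simp add: c_def)
  qed
  have c_int: "integrable M c" and c_le: "integral\<^sup>L M c \<le> - ln (1 - \<eta>\<^sup>2) + \<eta>\<^sup>2 * ln N + 2 * \<eta>"
  proof -
    have [measurable]: "D \<in> events" using D_events by (simp add: D_def)
    have int_ind: "integrable M (\<lambda>\<tau>. indicator D \<tau> * (ln N + 2 / \<eta>))"
      by (intro integrable_mult_left) (simp add: emeasure_eq_measure)
    then show "integrable M c" unfolding c_def by simp
    have "integral\<^sup>L M c = - ln (1 - \<eta>\<^sup>2) + prob D * (ln N + 2 / \<eta>)"
      unfolding c_def using int_ind by simp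
    also have "prob D * (ln N + 2 / \<eta>) \<le> \<eta>\<^sup>2 * (ln N + 2 / \<eta>)"
      using D N1 \<eta> by (intro mult_right_mono) (auto simp: D_def)
    also have "\<eta>\<^sup>2 * (ln N + 2 / \<eta>) = \<eta>\<^sup>2 * ln N + 2 * \<eta>"
      using \<eta> by (simp add: power2_eq_square field_simps)
    finally show "integral\<^sup>L M c \<le> - ln (1 - \<eta>\<^sup>2) + \<eta>\<^sup>2 * ln N + 2 * \<eta>" by simp
  qed
  have y_meas: "(\<lambda>\<tau>. f (y k \<tau>)) \<in> borel_measurable M" for f :: "'x \<Rightarrow> real" and k
  proof -
    have "(\<lambda>w. f (Y w)) \<circ> block (int k - int m) (2 * m + 1) \<in> borel_measurable M"
      by (rule measurable_comp[where N = "count_space UNIV"]) auto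
    then show ?thesis by (simp add: comp_def y_def)
  qed
  have bound: "process_entropy X n \<le> ln C + real (n + 2 * m) * integral\<^sup>L M F + real n * integral\<^sup>L M c" for n
  proof -
    define r where "r s = (\<integral>\<tau>. (\<Prod>k<n. K (s k) (y k \<tau>)) \<partial>M)" for s
    have r_int: "integrable M (\<lambda>\<tau>. \<Prod>k<n. K (s k) (y k \<tau>))" for s
      by (rule integrable_const_bound[where B = 1])
        (use y_meas K_pos K_le in \<open>auto intro!: borel_measurable_prod prod_le_1 simp: abs_prod less_imp_le abs_of_pos\<close>)
    define p where "p \<tau> = prob (cylinder (block 0 (n + 2 * m) (translate (- int m) \<tau>)))" for \<tau>
    have p_pos: "0 < p \<tau>" for \<tau> unfolding p_def by (rule prob_cylinder_pos)
    have p_eq: "p \<tau> = prob {\<tau>'. block (- int m) (n + 2 * m) \<tau>' = block (- int m) (n + 2 * m) \<tau>}" for \<tau>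
      unfolding p_def using prob_block_eq[of "- int m" "block (- int m) (n + 2 * m) \<tau>"] by (simp add: block_translate)
    have r_lower: "p \<tau> * (\<Prod>k<n. K (X (translate (int k) \<tau>)) (y k \<tau>)) \<le> r (itinerary n \<tau>)" for \<tau>
    proof -
      let ?B = "{\<tau>'. block (- int m) (n + 2 * m) \<tau>' = block (- int m) (n + 2 * m) \<tau>}"
      let ?c = "\<Prod>k<n. K (X (translate (int k) \<tau>)) (y k \<tau>)"
      have [measurable]: "?B \<in> events" using block_events[of "- int m" "n + 2 * m" "{_}"] by simp
      have same: "y k \<tau>' = y k \<tau>" if "\<tau>' \<in> ?B" "k < n" for k \<tau>'
      proof -
        have eq: "\<forall>j<n + 2 * m. \<tau>' (- int m + int j) = \<tau> (- int m + int j)"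
          using that(1) by (simp add: block_eq_iff)
        have "block (int k - int m) (2 * m + 1) \<tau>' = block (int k - int m) (2 * m + 1) \<tau>"
          unfolding block_eq_iff
        proof (intro conjI allI impI)
          fix j assume j: "j < 2 * m + 1"
          then have "\<tau>' (- int m + int (k + j)) = \<tau> (- int m + int (k + j))" using eq \<open>k < n\<close> by (simp del: of_nat_add)
          moreover have pos: "- int m + int (k + j) = int k - int m + int j" by simp
          ultimately have "\<tau>' (int k - int m + int j) = \<tau> (int k - int m + int j)" by (simp only: pos)
          then show "\<tau>' (int k - int m + int j) = block (int k - int m) (2 * m + 1) \<tau> ! j"
            using j by simp
        qed simp
        then show ?thesis by (simp add: y_def)
      qed
      have "p \<tau> * ?c = (\<integral>\<tau>'. indicator ?B \<tau>' * ?c \<partial>M)"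
        by (simp add: p_eq)
      also have "\<dots> \<le> r (itinerary n \<tau>)"
        unfolding r_def
      proof (rule integral_mono[OF _ r_int])
        show "integrable M (\<lambda>\<tau>'. indicator ?B \<tau>' * ?c)"
          by (intro integrable_mult_left) (simp add: emeasure_eq_measure)
        fix \<tau>'
        show "indicator ?B \<tau>' * ?c \<le> (\<Prod>k<n. K (itinerary n \<tau> k) (y k \<tau>'))"
        proof (cases "\<tau>' \<in> ?B")
          case True
          then have "(\<Prod>k<n. K (itinerary n \<tau> k) (y k \<tau>')) = ?c"
            using same[OF True] by (intro prod.cong refl) (simp add: nth_itinerary)
          then show ?thesis using True by simp
        next
          case False
          then show ?thesis using K_pos by (simp add: prod_nonneg less_imp_le)
        qed
      qed
      finally show ?thesis .
    qed
    have prod_pos: "0 < (\<Prod>k<n. K (X (translate (int k) \<tau>)) (y k \<tau>))" for \<tau>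
      using K_pos by (intro prod_pos) auto
    have r_pos: "0 < r (itinerary n \<tau>)" for \<tau>
      using r_lower[of \<tau>] p_pos[of \<tau>] prod_pos[of \<tau>] by (meson less_le_trans mult_pos_pos)
    have "process_entropy X n \<le> - (\<Sum>s\<in>words n. law n s * ln (r s))"
    proof (rule process_entropy_le)
      show "0 \<le> r s" for s unfolding r_def using K_pos by (intro Bochner_Integration.integral_nonneg prod_nonneg) (simp add: less_imp_le)
      show "0 < r s" if "0 < law n s" for s
      proof -
        have "{\<tau>. itinerary n \<tau> = s} \<noteq> {}" using that unfolding law_def by (metis measure_empty less_irrefl)
        then show ?thesis using r_pos by blast
      qed
      have "(\<Sum>s\<in>words n. r s) = (\<integral>\<tau>. (\<Sum>s\<in>words n. \<Prod>k<n. K (s k) (y k \<tau>)) \<partial>M)"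
        unfolding r_def using r_int by (simp add: Bochner_Integration.integral_sum)
      also have "\<dots> = (\<integral>\<tau>. (\<Prod>k<n. \<Sum>x\<in>P. K x (y k \<tau>)) \<partial>M)"
        unfolding words_def using finite_P by (intro Bochner_Integration.integral_cong refl prod_sum_PiE[symmetric]) auto
      also have "\<dots> = 1" using K_sum Y_in by (simp add: y_def)
      finally show "(\<Sum>s\<in>words n. r s) \<le> 1" by simp
    qed
    also have "\<dots> = (\<integral>\<tau>. - ln (r (itinerary n \<tau>)) \<partial>M)"
      using integral_itinerary[of "\<lambda>s. - ln (r s)" n] by (simp add: sum_negf)
    also have "\<dots> \<le> (\<integral>\<tau>. ln C + (\<Sum>j<n + 2 * m. F (translate (int j - int m) \<tau>)) + (\<Sum>k<n. c (translate (int k) \<tau>)) \<partial>M)"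
    proof (rule integral_mono)
      show "integrable M (\<lambda>\<tau>. - ln (r (itinerary n \<tau>)))" by (rule integrable_itinerary)
      show "integrable M (\<lambda>\<tau>. ln C + (\<Sum>j<n + 2 * m. F (translate (int j - int m) \<tau>)) + (\<Sum>k<n. c (translate (int k) \<tau>)))"
        using integrable_translate(1)[OF F] integrable_translate(1)[OF c_int] by simp
      fix \<tau>
      have "ln (p \<tau> * (\<Prod>k<n. K (X (translate (int k) \<tau>)) (y k \<tau>))) \<le> ln (r (itinerary n \<tau>))"
        using r_lower r_pos p_pos prod_pos by (subst ln_le_cancel_iff) auto
      then have "- ln (r (itinerary n \<tau>)) \<le> - ln (p \<tau>) - ln (\<Prod>k<n. K (X (translate (int k) \<tau>)) (y k \<tau>))"
        using p_pos[of \<tau>] prod_pos[of \<tau>] by (simp add: ln_mult_pos)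
      moreover have "ln (\<Prod>k<n. K (X (translate (int k) \<tau>)) (y k \<tau>)) = (\<Sum>k<n. ln (K (X (translate (int k) \<tau>)) (y k \<tau>)))"
        by (rule ln_prod) (simp_all add: K_ne)
      moreover have "- (\<Sum>k<n. ln (K (X (translate (int k) \<tau>)) (y k \<tau>))) \<le> (\<Sum>k<n. c (translate (int k) \<tau>))"
        unfolding sum_negf[symmetric] using c_ge by (intro sum_mono) auto
      moreover have "- ln (p \<tau>) \<le> ln C + (\<Sum>j<n + 2 * m. F (translate (int j - int m) \<tau>))"
      proof -
        have "exp (- (\<Sum>j<n + 2 * m. F (translate (int j - int m) \<tau>))) \<le> C * p \<tau>"
          using gibbs_lower[where n = "n + 2 * m" and \<tau> = "translate (- int m) \<tau>"] unfolding p_def by simp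
        then have "ln (exp (- (\<Sum>j<n + 2 * m. F (translate (int j - int m) \<tau>)))) \<le> ln (C * p \<tau>)"
          by (meson exp_gt_zero less_le_trans ln_le_cancel_iff)
        also have "ln (C * p \<tau>) = ln C + ln (p \<tau>)" using C_ge_1 p_pos[of \<tau>] by (intro ln_mult_pos) auto
        finally show ?thesis by simp
      qed
      ultimately show "- ln (r (itinerary n \<tau>)) \<le> ln C + (\<Sum>j<n + 2 * m. F (translate (int j - int m) \<tau>)) + (\<Sum>k<n. c (translate (int k) \<tau>))"
        by linarith
    qed
    also have "\<dots> = ln C + real (n + 2 * m) * integral\<^sup>L M F + real n * integral\<^sup>L M c"
      using integrable_translate[OF F] integrable_translate[OF c_int] by (simp add: Bochner_Integration.integral_sum)
    finally show ?thesis .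
  qed
  have "lim (\<lambda>n. process_entropy X n / real n) \<le> integral\<^sup>L M F + integral\<^sup>L M c"
  proof (rule LIMSEQ_le[OF entropy_rate_lim])
    have "(\<lambda>n. (ln C + 2 * real m * integral\<^sup>L M F) / real n + (integral\<^sup>L M F + integral\<^sup>L M c)) \<longlonglongrightarrow> 0 + (integral\<^sup>L M F + integral\<^sup>L M c)"
      by (intro tendsto_intros lim_const_over_n)
    then show "(\<lambda>n. (ln C + 2 * real m * integral\<^sup>L M F) / real n + (integral\<^sup>L M F + integral\<^sup>L M c)) \<longlonglongrightarrow> integral\<^sup>L M F + integral\<^sup>L M c"
      by simp
    show "\<exists>N. \<forall>n\<ge>N. process_entropy X n / real n \<le> (ln C + 2 * real m * integral\<^sup>L M F) / real n + (integral\<^sup>L M F + integral\<^sup>L M c)"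
    proof (intro exI allI impI)
      fix n :: nat assume "1 \<le> n"
      then show "process_entropy X n / real n \<le> (ln C + 2 * real m * integral\<^sup>L M F) / real n + (integral\<^sup>L M F + integral\<^sup>L M c)"
        using divide_right_mono[OF bound[of n], of "real n"] by (simp add: field_simps)
    qed
  qed
  then show ?thesis using c_le by (simp add: N_def)
qed

lemma entropy_rate_le:
  assumes "integrable M F"
  shows "lim (\<lambda>n. process_entropy X n / real n) \<le> integral\<^sup>L M F"
proof (rule tendsto_lowerbound)
  have "((\<lambda>\<eta>. integral\<^sup>L M F + (- ln (1 - \<eta>\<^sup>2) + \<eta>\<^sup>2 * ln (real (card P)) + 2 * \<eta>)) \<longlongrightarrow>
      integral\<^sup>L M F + (- ln (1 - 0\<^sup>2) + 0\<^sup>2 * ln (real (card P)) + 2 * 0)) (at_right 0)"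
    by (intro tendsto_intros) auto
  then show "((\<lambda>\<eta>. integral\<^sup>L M F + (- ln (1 - \<eta>\<^sup>2) + \<eta>\<^sup>2 * ln (real (card P)) + 2 * \<eta>)) \<longlongrightarrow> integral\<^sup>L M F) (at_right 0)"
    by simp
  show "\<forall>\<^sub>F \<eta> in at_right 0. lim (\<lambda>n. process_entropy X n / real n) \<le>
      integral\<^sup>L M F + (- ln (1 - \<eta>\<^sup>2) + \<eta>\<^sup>2 * ln (real (card P)) + 2 * \<eta>)"
    unfolding eventually_at_right_field using entropy_bound_via_code[OF assms] by (intro exI[of _ 1]) auto
qed auto

end

context gibbs_shift
begin

text \<open>Truncating the enumeration of the alphabet at \<open>N\<close> merges all but finitely many symbols, which
  produces finite partitions for an infinite alphabet.\<close>

lemma truncated_symbol_process: "finite_process M F C (\<lambda>\<tau>. min (to_nat (\<tau> 0)) N) {..N}"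
proof
  fix x
  have "{\<tau> :: int \<Rightarrow> 'e. min (to_nat (\<tau> 0)) N = x} = {\<tau>. block 0 1 \<tau> \<in> {w. min (to_nat (w ! 0)) N = x}}"
    by auto
  then show "{\<tau>. min (to_nat (\<tau> 0)) N = x} \<in> events" by (simp only: block_events)
qed auto

lemma truncated_superadditive:
  fixes N :: nat
  defines "X \<equiv> \<lambda>\<tau>. min (to_nat (\<tau> 0)) N"
  shows "process_entropy X m + process_entropy X n - ln (C ^ 3) \<le> process_entropy X (m + n)"
proof -
  interpret finite_process M F C X "{..N}" unfolding X_def by (rule truncated_symbol_process)
  show ?thesis
  proof (rule process_entropy_superadditive)
    show "0 < C ^ 3" using C_ge_1 by simp
    fix s
    have Xt: "X (translate i \<tau>) = min (to_nat (\<tau> i)) N" for i \<tau> by (simp add: X_def translate_apply)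
    have code: "{\<tau>. itinerary k (translate i \<tau>) = t} = {\<tau>. block i k \<tau> \<in> {w. t \<in> words k \<and> (\<forall>j<k. min (to_nat (w ! j)) N = t j)}}" for k i t
      by (auto simp: itinerary_eq_iff Xt add.commute)
    have "law (m + n) s \<le> prob ({\<tau>. itinerary m (translate 0 \<tau>) = head m s} \<inter> {\<tau>. itinerary n (translate (0 + int m) \<tau>) = tail m n s})"
      unfolding law_def
    proof (intro finite_measure_mono)
      show "{\<tau>. itinerary m (translate 0 \<tau>) = head m s} \<inter> {\<tau>. itinerary n (translate (0 + int m) \<tau>) = tail m n s} \<in> events"
        unfolding code by (intro sets.Int block_events)
    qed (auto simp: head_itinerary tail_itinerary)
    also have "\<dots> \<le> C ^ 3 * (prob {\<tau>. itinerary m (translate 0 \<tau>) = head m s} * prob {\<tau>. itinerary n (translate (0 + int m) \<tau>) = tail m n s})"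
      unfolding code by (rule adjacent_blocks)
    finally show "law (m + n) s \<le> C ^ 3 * (law m (head m s) * law n (tail m n s))"
      unfolding law_translate .
  qed
qed

text \<open>An almost superadditive sequence grows at least at the rate that is seen at a fixed length \<open>m\<close>.\<close>

lemma truncated_rate_lower:
  fixes N :: nat
  defines "X \<equiv> \<lambda>\<tau>. min (to_nat (\<tau> 0)) N"
  assumes "0 < m"
  shows "(process_entropy X m - ln (C ^ 3)) / real m \<le> lim (\<lambda>n. process_entropy X n / real n)"
proof -
  interpret finite_process M F C X "{..N}" unfolding X_def by (rule truncated_symbol_process)
  have mult: "real k * (process_entropy X m - ln (C ^ 3)) \<le> process_entropy X (k * m)" for k
  proof (induction k)
    case 0
    then show ?case by (simp add: process_entropy_nonneg)
  next
    case (Suc k)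
    then show ?case using truncated_superadditive[of N m "k * m"] by (simp add: X_def algebra_simps)
  qed
  have "strict_mono (\<lambda>k. k * m)" using \<open>0 < m\<close> by (auto simp: strict_mono_def)
  from LIMSEQ_subseq_LIMSEQ[OF entropy_rate_lim this]
  have "(\<lambda>k. process_entropy X (k * m) / real (k * m)) \<longlonglongrightarrow> lim (\<lambda>n. process_entropy X n / real n)"
    by (simp add: comp_def)
  then show ?thesis
  proof (rule LIMSEQ_le_const)
    show "\<exists>K. \<forall>k\<ge>K. (process_entropy X m - ln (C ^ 3)) / real m \<le> process_entropy X (k * m) / real (k * m)"
    proof (intro exI allI impI)
      fix k :: nat assume "1 \<le> k"
      then have "(process_entropy X m - ln (C ^ 3)) / real m = (real k * (process_entropy X m - ln (C ^ 3))) / real (k * m)"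
        using \<open>0 < m\<close> by simp
      also have "\<dots> \<le> process_entropy X (k * m) / real (k * m)"
        by (intro divide_right_mono mult) simp
      finally show "(process_entropy X m - ln (C ^ 3)) / real m \<le> process_entropy X (k * m) / real (k * m)" .
    qed
  qed
qed

text \<open>As \<open>N\<close> grows, the classes of truncated words decrease to cylinders, so the information increases.\<close>

lemma truncated_entropy_limit:
  "(\<lambda>N. ennreal (process_entropy (\<lambda>\<tau>. min (to_nat (\<tau> 0)) N) m)) \<longlonglongrightarrow>
    (\<integral>\<^sup>+\<tau>. ennreal (- ln (prob (cylinder (block 0 m \<tau>)))) \<partial>M)"
proof -
  define X where "X N = (\<lambda>\<tau> :: int \<Rightarrow> 'e. min (to_nat (\<tau> 0)) N)" for N
  have fp: "finite_process M F C (X N) {..N}" for N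
    unfolding X_def by (rule truncated_symbol_process)
  define I where "I N \<tau> = ennreal (- ln (prob (itinerary_class (X N) m \<tau>)))" for N \<tau>
  have class_events: "itinerary_class (X N) m \<tau> \<in> events" for N \<tau>
  proof -
    interpret finite_process M F C "X N" "{..N}" by (rule fp)
    show ?thesis unfolding itinerary_class_eq by (rule itinerary_events)
  qed
  have class_mono: "itinerary_class (X N') m \<tau> \<subseteq> itinerary_class (X N) m \<tau>" if "N \<le> N'" for N N' \<tau>
  proof -
    have "min i N = min j N" if "min i N' = min j N'" for i j :: nat
      using that \<open>N \<le> N'\<close> by (auto simp: min_def split: if_splits)
    then show ?thesis unfolding itinerary_class_def X_def by blast
  qed
  have class_Int: "(\<Inter>N. itinerary_class (X N) m \<tau>) = {\<tau>'. block 0 m \<tau>' = block 0 m \<tau>}" for \<tau>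
  proof (intro set_eqI iffI)
    fix \<tau>' assume *: "\<tau>' \<in> (\<Inter>N. itinerary_class (X N) m \<tau>)"
    have "\<tau>' (int k) = \<tau> (int k)" if "k < m" for k
    proof -
      have "min (to_nat (\<tau>' (int k))) N = min (to_nat (\<tau> (int k))) N" for N
        using * that by (auto simp: itinerary_class_def X_def translate_apply)
      from this[of "to_nat (\<tau>' (int k)) + to_nat (\<tau> (int k))"] show ?thesis by simp
    qed
    then show "\<tau>' \<in> {\<tau>'. block 0 m \<tau>' = block 0 m \<tau>}" by (simp add: block_eq_iff)
  qed (auto simp: block_eq_iff itinerary_class_def X_def translate_apply)
  have prob_block: "prob {\<tau>'. block 0 m \<tau>' = block 0 m \<tau>} = prob (cylinder (block 0 m \<tau>))" for \<tau>
    using prob_block_eq[of 0 "block 0 m \<tau>"] by simp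
  have class_pos: "0 < prob (itinerary_class (X N) m \<tau>)" for N \<tau>
  proof -
    have "prob (cylinder (block 0 m \<tau>)) \<le> prob (itinerary_class (X N) m \<tau>)"
      unfolding prob_block[symmetric] using class_Int[of \<tau>] class_events by (intro finite_measure_mono) auto
    then show ?thesis using prob_cylinder_pos by (meson less_le_trans)
  qed
  have "(\<lambda>N. \<integral>\<^sup>+\<tau>. I N \<tau> \<partial>M) \<longlonglongrightarrow> (\<integral>\<^sup>+\<tau>. ennreal (- ln (prob (cylinder (block 0 m \<tau>)))) \<partial>M)"
  proof (rule nn_integral_LIMSEQ)
    show "incseq I"
      unfolding incseq_def le_fun_def I_def
      using class_mono class_pos class_events by (auto intro!: ennreal_leI finite_measure_mono)
    show "I N \<in> borel_measurable M" for N
    proof -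
      interpret finite_process M F C "X N" "{..N}" by (rule fp)
      have "integrable M (\<lambda>\<tau>. - ln (law m (itinerary m \<tau>)))" by (rule integrable_itinerary)
      then show ?thesis unfolding I_def law_itinerary by measurable
    qed
    fix \<tau>
    have "(\<lambda>N. prob (itinerary_class (X N) m \<tau>)) \<longlonglongrightarrow> prob (\<Inter>N. itinerary_class (X N) m \<tau>)"
      using class_events class_mono by (intro finite_Lim_measure_decseq) (auto simp: decseq_def)
    then have "(\<lambda>N. prob (itinerary_class (X N) m \<tau>)) \<longlonglongrightarrow> prob (cylinder (block 0 m \<tau>))"
      unfolding class_Int prob_block .
    then show "(\<lambda>N. I N \<tau>) \<longlonglongrightarrow> ennreal (- ln (prob (cylinder (block 0 m \<tau>))))"
      unfolding I_def using prob_cylinder_pos[of "block 0 m \<tau>"] by (intro tendsto_intros) auto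
  qed
  moreover have "(\<integral>\<^sup>+\<tau>. I N \<tau> \<partial>M) = ennreal (process_entropy (X N) m)" for N
  proof -
    interpret finite_process M F C "X N" "{..N}" by (rule fp)
    have "integrable M (\<lambda>\<tau>. - ln (prob (itinerary_class (X N) m \<tau>)))"
      using integrable_itinerary[of "\<lambda>s. - ln (law m s)" m] by (simp add: law_itinerary)
    then show ?thesis unfolding I_def process_entropy_def
      using class_pos by (intro nn_integral_eq_integral) auto
  qed
  ultimately show ?thesis by (simp add: X_def)
qed

text \<open>The number \<open>m\<close> is chosen so large that the additive errors are small compared with \<open>m\<close>;
  only then \<open>N\<close> is chosen, depending on \<open>m\<close>. The order matters, since the limit in \<open>N\<close>
  is not uniform in \<open>m\<close>.\<close>

lemma truncated_rate_approximates:
  assumes "0 \<le> y" and y: "ennreal (y + ln C) < (\<integral>\<^sup>+\<tau>. ennreal (F \<tau> + ln C) \<partial>M)"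
    and F_lower: "\<And>\<tau>. 0 \<le> F \<tau> + ln C"
  shows "\<exists>N. y \<le> lim (\<lambda>n. process_entropy (\<lambda>\<tau>. min (to_nat (\<tau> 0)) N) n / real n)"
proof -
  define G where "G = (\<integral>\<^sup>+\<tau>. ennreal (F \<tau> + ln C) \<partial>M)"
  have lnC: "0 \<le> ln C" using C_ge_1 by simp
  obtain z where z: "ennreal (y + ln C) < ennreal z" "ennreal z < G" "0 \<le> z"
    using y dense[of "ennreal (y + ln C)" G] unfolding G_def[symmetric]
    by (metis ennreal_cases order_less_imp_not_less top.not_eq_extremum infinity_ennreal_def)
  have yz: "y + ln C < z" using z(1) \<open>0 \<le> y\<close> lnC by (simp add: ennreal_less_iff del: ennreal_plus)
  \<comment> \<open>The error is \<open>ln (C ^ 3)\<close> from superadditivity and \<open>ln C\<close> from the Gibbs inequality.\<close>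
  obtain m :: nat where "real m > (4 * ln C) / (z - (y + ln C))" using reals_Archimedean2 by blast
  then have m: "4 * ln C \<le> real m * (z - (y + ln C))" using yz by (simp add: field_simps)
  have "0 < m"
  proof (rule ccontr)
    assume "\<not> 0 < m"
    then show False using \<open>real m > _\<close> lnC yz by (simp add: divide_less_0_iff not_less)
  qed
  let ?I = "\<integral>\<^sup>+\<tau>. ennreal (- ln (prob (cylinder (block 0 m \<tau>)))) \<partial>M"
  have "ennreal (real m) * G \<le> ?I + ennreal ((real m + 1) * ln C)"
  proof -
    have "ennreal (real m) * G = (\<Sum>k<m. \<integral>\<^sup>+\<tau>. ennreal (F (translate (int k) \<tau>) + ln C) \<partial>M)"
      unfolding G_def using nn_integral_translate[of "\<lambda>\<tau>. ennreal (F \<tau> + ln C)"]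
      by (simp add: ennreal_of_nat_eq_real_of_nat)
    also have "\<dots> = (\<integral>\<^sup>+\<tau>. (\<Sum>k<m. ennreal (F (translate (int k) \<tau>) + ln C)) \<partial>M)"
      by (intro nn_integral_sum[symmetric]) measurable
    also have "\<dots> \<le> (\<integral>\<^sup>+\<tau>. ennreal (- ln (prob (cylinder (block 0 m \<tau>)))) + ennreal ((real m + 1) * ln C) \<partial>M)"
    proof (rule nn_integral_mono)
      fix \<tau>
      let ?p = "prob (cylinder (block 0 m \<tau>))"
      have p: "0 < ?p" by (rule prob_cylinder_pos)
      have "ln ?p \<le> ln (C * exp (- (\<Sum>k<m. F (translate (int k) \<tau>))))"
        using gibbs_upper[where n = m and \<tau> = \<tau>] p by (meson less_le_trans ln_le_cancel_iff)
      also have "\<dots> = ln C - (\<Sum>k<m. F (translate (int k) \<tau>))" using C_ge_1 by (simp add: ln_mult)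
      finally have le: "(\<Sum>k<m. F (translate (int k) \<tau>) + ln C) \<le> - ln ?p + (real m + 1) * ln C"
        by (simp add: sum.distrib algebra_simps)
      have "(\<Sum>k<m. ennreal (F (translate (int k) \<tau>) + ln C)) = ennreal (\<Sum>k<m. F (translate (int k) \<tau>) + ln C)"
        using F_lower by (intro sum_ennreal) auto
      also have "\<dots> \<le> ennreal (- ln ?p + (real m + 1) * ln C)" by (rule ennreal_leI[OF le])
      also have "\<dots> = ennreal (- ln ?p) + ennreal ((real m + 1) * ln C)"
        using p lnC by (intro ennreal_plus) auto
      finally show "(\<Sum>k<m. ennreal (F (translate (int k) \<tau>) + ln C)) \<le> ennreal (- ln ?p) + ennreal ((real m + 1) * ln C)" .
    qed
    also have "\<dots> = ?I + ennreal ((real m + 1) * ln C)"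
    proof -
      have "(\<lambda>\<tau>. ennreal (- ln (prob (cylinder (block 0 m \<tau>))))) \<in> borel_measurable M"
        by (rule measurable_compose[where N = "count_space UNIV" and f = "block 0 m"]) auto
      then show ?thesis using emeasure_space_1 by (subst nn_integral_add) auto
    qed
    finally show ?thesis .
  qed
  have big: "ennreal (real m * y + ln (C ^ 3)) < ?I"
  proof (rule ccontr)
    assume "\<not> ?thesis"
    then have "?I \<le> ennreal (real m * y + ln (C ^ 3))" by simp
    then have "ennreal (real m) * G \<le> ennreal (real m * y + ln (C ^ 3)) + ennreal ((real m + 1) * ln C)"
      using \<open>ennreal (real m) * G \<le> _\<close> by (meson add_right_mono order_trans)
    also have "\<dots> = ennreal (real m * y + ln (C ^ 3) + (real m + 1) * ln C)"
      using \<open>0 \<le> y\<close> lnC C_ge_1 by (intro ennreal_plus[symmetric]) auto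
    also have "\<dots> \<le> ennreal (real m * z)"
      using m C_ge_1 by (intro ennreal_leI) (simp add: ln_realpow algebra_simps)
    also have "\<dots> = ennreal (real m) * ennreal z" using z(3) by (simp add: ennreal_mult)
    also have "\<dots> < ennreal (real m) * G"
      using z(2) \<open>0 < m\<close> by (intro ennreal_mult_strict_left_mono) auto
    finally show False by simp
  qed
  then have "\<forall>\<^sub>F N in sequentially. ennreal (real m * y + ln (C ^ 3)) < ennreal (process_entropy (\<lambda>\<tau>. min (to_nat (\<tau> 0)) N) m)"
    using truncated_entropy_limit[of m] by (intro order_tendstoD(1))
  then obtain N where N: "ennreal (real m * y + ln (C ^ 3)) < ennreal (process_entropy (\<lambda>\<tau>. min (to_nat (\<tau> 0)) N) m)"
    by (auto simp: eventually_sequentially)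
  have "0 \<le> real m * y + ln (C ^ 3)" using \<open>0 \<le> y\<close> C_ge_1 by simp
  with N have "real m * y \<le> process_entropy (\<lambda>\<tau>. min (to_nat (\<tau> 0)) N) m - ln (C ^ 3)"
    by (simp add: ennreal_less_iff)
  then have "y \<le> (process_entropy (\<lambda>\<tau>. min (to_nat (\<tau> 0)) N) m - ln (C ^ 3)) / real m"
    using \<open>0 < m\<close> by (simp add: pos_le_divide_eq mult.commute)
  also have "\<dots> \<le> lim (\<lambda>n. process_entropy (\<lambda>\<tau>. min (to_nat (\<tau> 0)) N) n / real n)"
    by (rule truncated_rate_lower[OF \<open>0 < m\<close>])
  finally show ?thesis by blast
qed

end

section \<open>Entropy and exponent of the natural extension\<close>

context gibbs_shift
begin

lemma AE_translate:
  assumes "AE \<tau> in M. Q \<tau>" shows "AE \<tau> in M. Q (translate i \<tau>)"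
proof -
  have "AE \<tau> in distr M M (translate i). Q \<tau>"
    by (subst distr_translate) (rule assms)
  then show ?thesis by (rule AE_distrD[OF measurable_translate_M])
qed

text \<open>Were the event \<open>A\<close> not null, then by quasi-independence it would also occur with positive
  probability together with the symbol \<open>e'\<close> at \<open>-1\<close>. But the part of \<open>A\<close> where the symbol at \<open>-1\<close>
  is not \<open>e\<close> is null, because \<open>A\<close> and its translate, which is contained in it, have the same probability.\<close>

lemma constant_future_null:
  assumes "e' \<noteq> e" shows "AE \<tau> in M. \<not> (\<forall>n. \<tau> (int n) = e)"
proof -
  let ?P = "PiM UNIV (\<lambda>_::nat. count_space (UNIV :: 'e set))"
  define S where "S = {\<omega>\<in>space ?P. \<forall>n. \<omega> n = e}"
  define S' where "S' = {\<omega>\<in>space ?P. \<omega> 0 = e'}"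
  have S: "S \<in> sets ?P" "S' \<in> sets ?P" unfolding S_def S'_def by measurable
  note pf = past_future[OF S(2) S(1)]
  define A where "A = future -` S"
  have A_eq: "A = {\<tau>. \<forall>n. \<tau> (int n) = e}" by (auto simp: A_def S_def future_def space_PiM)
  have A [measurable]: "A \<in> events" using pf(2) by (simp add: A_def)
  have "past -` S' = {\<tau>. block (-1) 1 \<tau> = [e']}" by (auto simp: S'_def past_def space_PiM block_def)
  then have pos: "0 < prob (past -` S')"
    using prob_block_eq[of "-1" "[e']"] prob_cylinder_pos[of "[e']"] by simp
  have "translate (-1) -` A \<subseteq> A"
  proof
    fix \<tau> assume "\<tau> \<in> translate (-1) -` A"
    then have "translate (-1) \<tau> (int (Suc n)) = e" for n unfolding A_eq by blast
    then have "\<tau> (int n) = e" for n by (simp add: translate_apply)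
    then show "\<tau> \<in> A" by (simp add: A_eq)
  qed
  moreover have "translate (-1) -` A \<in> events" using measurable_sets[OF measurable_translate_M A] by simp
  ultimately have "prob (A - translate (-1) -` A) = prob A - prob (translate (-1) -` A)"
    using A by (intro finite_measure_Diff) auto
  then have 0: "prob (A - translate (-1) -` A) = 0" by (simp add: prob_translate)
  have "past -` S' \<inter> A \<subseteq> A - translate (-1) -` A"
  proof
    fix \<tau> assume \<tau>: "\<tau> \<in> past -` S' \<inter> A"
    then have "\<tau> (-1) = e'" by (auto simp: S'_def past_def)
    then have "translate (-1) \<tau> (int 0) \<noteq> e" using assms by (simp add: translate_apply)
    then show "\<tau> \<in> A - translate (-1) -` A" using \<tau> unfolding A_eq by blast
  qed
  then have "prob (past -` S' \<inter> A) \<le> prob (A - translate (-1) -` A)"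
    using A \<open>translate (-1) -` A \<in> events\<close> by (intro finite_measure_mono) auto
  then have "prob (past -` S' \<inter> A) = 0" using 0 measure_nonneg[of M "past -` S' \<inter> A"] by simp
  then have "prob (past -` S') * prob A \<le> 0" using pf(4) unfolding A_def by simp
  then have "prob A \<le> 0" using pos by (metis mult_pos_pos not_less)
  then have "prob A = 0" by (simp add: measure_le_0_iff)
  then have "AE \<tau> in M. \<tau> \<notin> A" using A by (simp add: prob_eq_0)
  then show ?thesis by (simp add: A_eq)
qed

lemma process_entropy_cong_AE:
  assumes X: "finite_process M F C X P" and Y: "finite_process M F C Y Q" and g: "AE \<tau> in M. g \<tau>"
    and iff: "\<And>\<tau> \<tau>' k. g \<tau> \<Longrightarrow> g \<tau>' \<Longrightarrow>
      X (translate (int k) \<tau>) = X (translate (int k) \<tau>') \<longleftrightarrow> Y (translate (int k) \<tau>) = Y (translate (int k) \<tau>')"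
  shows "process_entropy X n = process_entropy Y n"
proof -
  interpret X: finite_process M F C X P by fact
  interpret Y: finite_process M F C Y Q by fact
  have "(\<integral>\<tau>. - ln (X.law n (X.itinerary n \<tau>)) \<partial>M) = (\<integral>\<tau>. - ln (Y.law n (Y.itinerary n \<tau>)) \<partial>M)"
  proof (rule integral_cong_AE)
    show "AE \<tau> in M. - ln (X.law n (X.itinerary n \<tau>)) = - ln (Y.law n (Y.itinerary n \<tau>))"
      using g
    proof eventually_elim
      case (elim \<tau>)
      have "prob (itinerary_class X n \<tau>) = prob (itinerary_class Y n \<tau>)"
      proof (rule finite_measure_eq_AE)
        show "AE \<tau>' in M. \<tau>' \<in> itinerary_class X n \<tau> \<longleftrightarrow> \<tau>' \<in> itinerary_class Y n \<tau>"
          using g by eventually_elim (use iff elim in \<open>auto simp: itinerary_class_def\<close>)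
      qed (auto simp: X.itinerary_class_eq Y.itinerary_class_eq X.itinerary_events Y.itinerary_events)
      then show ?case by (simp add: X.law_itinerary Y.law_itinerary)
    qed
  qed (use X.integrable_itinerary[of "\<lambda>s. - ln (X.law n s)" n] Y.integrable_itinerary[of "\<lambda>s. - ln (Y.law n s)" n]
       in \<open>auto dest: borel_measurable_integrable\<close>)
  then show ?thesis by (simp add: process_entropy_def X.law_itinerary Y.law_itinerary)
qed

end

context luroth
begin

abbreviation "T \<equiv> natural_extension a b"

abbreviation "coded_space \<equiv> base_space a b \<Otimes>\<^sub>M fibre_space a b"

lemma space_base: "space (base_space a b) = limit_set a b"
  by (simp add: base_space_def space_restrict_space)

lemma space_fibre: "space (fibre_space a b) = closure (limit_set a b)"
  by (simp add: fibre_space_def space_restrict_space)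

lemma space_coded: "space coded_space = limit_set a b \<times> closure (limit_set a b)"
  by (simp add: space_pair_measure space_base space_fibre)

lemma coding_in_limit_set: "coding a b \<omega> \<in> limit_set a b"
  by (simp add: limit_set_def)

lemma limit_set_subset_closure: "x \<in> limit_set a b \<Longrightarrow> x \<in> closure (limit_set a b)"
  using closure_subset by blast

lemma coding2_in_space: "coding2 a b \<tau> \<in> space coded_space"
  by (auto simp: coding2_eq space_coded coding_in_limit_set intro: limit_set_subset_closure)

lemma measurable_coding_base: "coding a b \<in> PiM UNIV (\<lambda>_. count_space UNIV) \<rightarrow>\<^sub>M base_space a b"
  unfolding base_space_def by (intro measurable_restrict_space2 measurable_coding) (auto simp: coding_in_limit_set)

lemma measurable_coding_fibre: "coding a b \<in> PiM UNIV (\<lambda>_. count_space UNIV) \<rightarrow>\<^sub>M fibre_space a b"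
  unfolding fibre_space_def
  by (intro measurable_restrict_space2 measurable_coding) (auto simp: coding_in_limit_set limit_set_subset_closure)

lemma measurable_coding2: "coding2 a b \<in> PiM UNIV (\<lambda>_. count_space UNIV) \<rightarrow>\<^sub>M coded_space"
proof -
  have "(\<lambda>\<tau>. (coding a b (future \<tau>), coding a b (past \<tau>))) \<in> PiM UNIV (\<lambda>_. count_space UNIV) \<rightarrow>\<^sub>M coded_space"
    by (intro measurable_Pair measurable_compose[OF measurable_future measurable_coding_base]
        measurable_compose[OF measurable_past measurable_coding_fibre])
  then show ?thesis by (simp add: coding2_eq[abs_def])
qed

text \<open>A point of the limit set in the interior of a branch can only be coded by sequences that start with
  the symbol of this branch.\<close>

lemma regular_point_digit:
  assumes "coding a b \<omega> \<in> regular_set a b" shows "digit a b (coding a b \<omega>) = \<omega> 0"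
    and "luroth_map a b (coding a b \<omega>) = coding a b (\<lambda>n. \<omega> (Suc n))"
proof -
  obtain e where e: "coding a b \<omega> \<in> {b e<..<a e + b e}" using assms by (auto simp: regular_set_eq)
  have "coding a b \<omega> \<in> branch a b (\<omega> 0) ` {0..1}" using coding_shift[of \<omega>] coding_unit by blast
  then have "coding a b \<omega> \<in> closure {b (\<omega> 0)<..<a (\<omega> 0) + b (\<omega> 0)}"
    using a_pos[of "\<omega> 0"] by (simp add: branch_image)
  then have "{b e<..<a e + b e} \<inter> closure {b (\<omega> 0)<..<a (\<omega> 0) + b (\<omega> 0)} \<noteq> {}" using e by blast
  then have "{b e<..<a e + b e} \<inter> {b (\<omega> 0)<..<a (\<omega> 0) + b (\<omega> 0)} \<noteq> {}"
    by (subst (asm) open_Int_closure_eq_empty) auto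
  then have "e = \<omega> 0" using disjoint_interiors by blast
  then show d: "digit a b (coding a b \<omega>) = \<omega> 0" using digit_eq[OF e] by simp
  show "luroth_map a b (coding a b \<omega>) = coding a b (\<lambda>n. \<omega> (Suc n))"
    unfolding luroth_map_def d using assms coding_shift[of \<omega>] a_pos[of "\<omega> 0"]
    by (simp add: branch_def field_simps)
qed

lemma luroth_map_limit_set: "x \<in> limit_set a b \<Longrightarrow> x \<in> regular_set a b \<Longrightarrow> luroth_map a b x \<in> limit_set a b"
  unfolding limit_set_def using regular_point_digit by auto

lemma branch_closure_limit_set:
  assumes "y \<in> closure (limit_set a b)" shows "a e * y + b e \<in> closure (limit_set a b)"
proof -
  have "(\<lambda>y. a e * y + b e) ` closure (limit_set a b) \<subseteq> closure (limit_set a b)"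
  proof (rule image_closure_subset)
    show "(\<lambda>y. a e * y + b e) ` limit_set a b \<subseteq> closure (limit_set a b)"
    proof
      fix z assume "z \<in> (\<lambda>y. a e * y + b e) ` limit_set a b"
      then obtain \<omega> where z: "z = a e * coding a b \<omega> + b e" by (auto simp: limit_set_def)
      have "coding a b (case_nat e \<omega>) = z"
        unfolding z by (subst coding_shift) (simp add: branch_def)
      then show "z \<in> closure (limit_set a b)" using coding_in_limit_set limit_set_subset_closure by metis
    qed
  qed (auto intro!: continuous_intros)
  then show ?thesis using assms by blast
qed

lemma measurable_count_real: "h \<in> count_space UNIV \<rightarrow>\<^sub>M borel" for h :: "'e \<Rightarrow> real"
  by simp

lemma regular_set_borel [measurable]: "regular_set a b \<in> sets borel"
  unfolding regular_set_eq by (intro borel_open) auto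

lemma measurable_base_borel: "(\<lambda>x. x) \<in> base_space a b \<rightarrow>\<^sub>M borel"
  unfolding base_space_def by (rule measurable_restrict_space1) simp

lemma measurable_fibre_borel: "(\<lambda>x. x) \<in> fibre_space a b \<rightarrow>\<^sub>M borel"
  unfolding fibre_space_def by (rule measurable_restrict_space1) simp

lemma measurable_fst_coded [measurable]: "fst \<in> coded_space \<rightarrow>\<^sub>M borel"
  by (rule measurable_compose[OF measurable_fst measurable_base_borel])

lemma measurable_snd_coded [measurable]: "snd \<in> coded_space \<rightarrow>\<^sub>M borel"
  by (rule measurable_compose[OF measurable_snd measurable_fibre_borel])

lemma measurable_luroth_map [measurable]: "luroth_map a b \<in> borel_measurable borel"
proof -
  note [measurable] = measurable_compose[OF measurable_digit measurable_count_real]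
  show ?thesis unfolding luroth_map_def by measurable
qed

text \<open>On the regular part the map stays in the coded space and is measurable there; on the rest it
  is constant, with a value that need not belong to the space.\<close>

lemma T_vimage:
  assumes A: "A \<in> sets coded_space" shows "{z\<in>space coded_space. T z \<in> A} \<in> sets coded_space"
proof -
  note [measurable] = measurable_compose[OF measurable_digit measurable_count_real] A
  fix \<omega>0 :: "nat \<Rightarrow> 'e"
  define c where "c = coding a b \<omega>0"
  \<comment> \<open>The regular part of the map, with a point of the coded space as a default value.\<close>
  define T' where "T' z = (if fst z \<in> regular_set a b then luroth_map a b (fst z) else c,
      if fst z \<in> regular_set a b then a (digit a b (fst z)) * snd z + b (digit a b (fst z)) else c)" for z
  have reg [measurable]: "Measurable.pred coded_space (\<lambda>z. fst z \<in> regular_set a b)" by measurable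
  have "T' \<in> coded_space \<rightarrow>\<^sub>M coded_space"
    unfolding T'_def
  proof (rule measurable_Pair)
    show "(\<lambda>z. if fst z \<in> regular_set a b then luroth_map a b (fst z) else c) \<in> coded_space \<rightarrow>\<^sub>M base_space a b"
      unfolding base_space_def
    proof (rule measurable_restrict_space2)
      show "(\<lambda>z. if fst z \<in> regular_set a b then luroth_map a b (fst z) else c)
          \<in> space (restrict_space borel (limit_set a b) \<Otimes>\<^sub>M fibre_space a b) \<rightarrow> limit_set a b"
        using luroth_map_limit_set by (auto simp: space_coded[unfolded base_space_def] c_def coding_in_limit_set)
    qed (simp add: base_space_def[symmetric], measurable)
    show "(\<lambda>z. if fst z \<in> regular_set a b then a (digit a b (fst z)) * snd z + b (digit a b (fst z)) else c)
        \<in> coded_space \<rightarrow>\<^sub>M fibre_space a b"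
      unfolding fibre_space_def
    proof (rule measurable_restrict_space2)
      show "(\<lambda>z. if fst z \<in> regular_set a b then a (digit a b (fst z)) * snd z + b (digit a b (fst z)) else c)
          \<in> space (base_space a b \<Otimes>\<^sub>M restrict_space borel (closure (limit_set a b))) \<rightarrow> closure (limit_set a b)"
        using branch_closure_limit_set
        by (auto simp: space_coded[unfolded fibre_space_def] c_def coding_in_limit_set limit_set_subset_closure)
    qed (simp add: fibre_space_def[symmetric], measurable)
  qed
  note [measurable] = this
  have "{z\<in>space coded_space. T z \<in> A} =
      {z\<in>space coded_space. fst z \<in> regular_set a b \<and> T' z \<in> A} \<union>
      {z\<in>space coded_space. fst z \<notin> regular_set a b \<and> (0, 0) \<in> A}"
    by (auto simp: natural_extension_def T'_def)
  also have "\<dots> \<in> sets coded_space" by measurable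
  finally show ?thesis .
qed

text \<open>The sets \<open>A k\<close> keep the orbit in the coded space as long as it is observed, so one can
  go back one step at a time.\<close>

lemma orbit_cell_measurable:
  assumes "\<And>k. k < n \<Longrightarrow> A k \<in> sets coded_space"
  shows "{z\<in>space coded_space. \<forall>k<n. (T ^^ k) z \<in> A k} \<in> sets coded_space"
  using assms
proof (induction n arbitrary: A)
  case (Suc n)
  show ?case
  proof (cases n)
    case 0
    then have "{z\<in>space coded_space. \<forall>k<Suc n. (T ^^ k) z \<in> A k} = space coded_space \<inter> A 0" by auto
    then show ?thesis using Suc.prems[of 0] by auto
  next
    case (Suc n')
    let ?E = "{z\<in>space coded_space. \<forall>k<n. (T ^^ k) z \<in> A (Suc k)}"
    have "A 1 \<subseteq> space coded_space" using Suc.prems[of 1] Suc sets.sets_into_space by auto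
    then have in_space: "T z \<in> space coded_space" if "\<forall>k<n. (T ^^ k) (T z) \<in> A (Suc k)" for z
      using that[rule_format, of 0] Suc by auto
    have "{z\<in>space coded_space. \<forall>k<Suc n. (T ^^ k) z \<in> A k} = A 0 \<inter> {z\<in>space coded_space. T z \<in> ?E}"
    proof (intro set_eqI iffI)
      fix z assume z: "z \<in> {z\<in>space coded_space. \<forall>k<Suc n. (T ^^ k) z \<in> A k}"
      then have "(T ^^ k) (T z) \<in> A (Suc k)" if "k < n" for k
        using that by (auto simp: funpow_swap1 dest!: spec[of _ "Suc k"])
      then show "z \<in> A 0 \<inter> {z\<in>space coded_space. T z \<in> ?E}" using z in_space by (auto dest: spec[of _ 0])
    next
      fix z assume z: "z \<in> A 0 \<inter> {z\<in>space coded_space. T z \<in> ?E}"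
      have "(T ^^ k) z \<in> A k" if "k < Suc n" for k
      proof (cases k)
        case (Suc k')
        then show ?thesis using z that by (auto simp: funpow_swap1)
      qed (use z in auto)
      then show "z \<in> {z\<in>space coded_space. \<forall>k<Suc n. (T ^^ k) z \<in> A k}" using z by auto
    qed
    moreover have "{z\<in>space coded_space. T z \<in> ?E} \<in> sets coded_space"
      by (rule T_vimage, rule Suc.IH, rule Suc.prems) simp
    ultimately show ?thesis using Suc.prems[of 0] by auto
  qed
qed simp

end

context luroth_gibbs
begin

definition \<mu> :: "(real \<times> real) measure" where
  "\<mu> = distr M coded_space (coding2 a b)"

lemma space_\<mu> [simp]: "space \<mu> = space coded_space" and sets_\<mu> [simp]: "sets \<mu> = sets coded_space"
  by (simp_all add: \<mu>_def)

lemma measurable_coding2_M [measurable]: "coding2 a b \<in> M \<rightarrow>\<^sub>M coded_space"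
  using measurable_coding2 measurable_cong_sets[OF sets_M refl] by blast

text \<open>Sequences whose forward orbit never meets an endpoint of a branch.\<close>

definition regular_orbit :: "(int \<Rightarrow> 'e) \<Rightarrow> bool" where
  "regular_orbit \<tau> \<longleftrightarrow> (\<forall>k::nat. coding a b (future (translate (int k) \<tau>)) \<notin> {0, 1})"

lemma AE_regular_orbit: "AE \<tau> in M. regular_orbit \<tau>"
proof -
  have "AE \<tau> in M. \<forall>e. \<not> (\<forall>n. \<tau> (int n) = e)"
    unfolding AE_all_countable
  proof
    fix e :: 'e
    obtain e0 e1 :: 'e where "e0 \<noteq> e1" using two_symbols by blast
    then obtain e' where "e' \<noteq> e" by (metis (full_types))
    then show "AE \<tau> in M. \<not> (\<forall>n. \<tau> (int n) = e)" by (rule constant_future_null)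
  qed
  then have "AE \<tau> in M. coding a b (future \<tau>) \<notin> {0, 1}"
  proof eventually_elim
    case (elim \<tau>)
    show ?case
    proof
      assume "coding a b (future \<tau>) \<in> {0, 1}"
      then have "\<tau> (int n) = \<tau> 0" for n using coding_endpoint[of "future \<tau>" n] by (simp add: future_def)
      then show False using elim by blast
    qed
  qed
  then show ?thesis unfolding regular_orbit_def AE_all_countable by (intro allI AE_translate)
qed

lemma regular_orbit_conjugacy:
  assumes "regular_orbit \<tau>"
  shows "(T ^^ k) (coding2 a b \<tau>) = coding2 a b (translate (int k) \<tau>)"
    and "digit a b (fst (coding2 a b (translate (int k) \<tau>))) = \<tau> (int k)"
proof -
  have reg: "coding a b (future (translate 1 (translate (int k) \<tau>))) \<notin> {0, 1}" for k
    using assms[unfolded regular_orbit_def, rule_format, of "Suc k"] by simp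
  show "(T ^^ k) (coding2 a b \<tau>) = coding2 a b (translate (int k) \<tau>)"
  proof (induction k)
    case (Suc k)
    then show ?case using natural_extension_coding2(1)[OF reg[of k]] by simp
  qed simp
  show "digit a b (fst (coding2 a b (translate (int k) \<tau>))) = \<tau> (int k)"
    using natural_extension_coding2(2)[OF reg[of k]] by (simp add: translate_apply)
qed

lemma measure_orbit_cell:
  assumes A: "\<And>k. k < n \<Longrightarrow> A k \<in> sets coded_space"
  shows "measure \<mu> {z\<in>space \<mu>. \<forall>k<n. (T ^^ k) z \<in> A k} = prob {\<tau>. \<forall>k<n. coding2 a b (translate (int k) \<tau>) \<in> A k}"
proof -
  let ?E = "{z\<in>space coded_space. \<forall>k<n. (T ^^ k) z \<in> A k}"
  have E: "?E \<in> sets coded_space" by (rule orbit_cell_measurable[OF A])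
  have "measure \<mu> ?E = prob (coding2 a b -` ?E \<inter> space M)"
    unfolding \<mu>_def by (rule measure_distr[OF measurable_coding2_M E])
  also have "\<dots> = prob {\<tau>. \<forall>k<n. coding2 a b (translate (int k) \<tau>) \<in> A k}"
  proof (rule finite_measure_eq_AE)
    show "AE \<tau> in M. \<tau> \<in> coding2 a b -` ?E \<inter> space M \<longleftrightarrow> \<tau> \<in> {\<tau>. \<forall>k<n. coding2 a b (translate (int k) \<tau>) \<in> A k}"
      using AE_regular_orbit by eventually_elim (auto simp: regular_orbit_conjugacy coding2_in_space)
    show "coding2 a b -` ?E \<inter> space M \<in> events" using E by (rule measurable_sets[OF measurable_coding2_M])
    have "{\<tau>\<in>space M. \<forall>k\<in>{..<n}. coding2 a b (translate (int k) \<tau>) \<in> A k} \<in> events"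
    proof (intro sets.sets_Collect_finite_All)
      fix k assume "k \<in> {..<n}"
      then have [measurable]: "A k \<in> sets coded_space" using A by simp
      show "{\<tau>\<in>space M. coding2 a b (translate (int k) \<tau>) \<in> A k} \<in> events" by measurable
    qed auto
    then show "{\<tau>. \<forall>k<n. coding2 a b (translate (int k) \<tau>) \<in> A k} \<in> events" by (simp add: Ball_def)
  qed
  finally show ?thesis by simp
qed

definition cell :: "(real \<times> real) set set \<Rightarrow> (int \<Rightarrow> 'e) \<Rightarrow> (real \<times> real) set" where
  "cell P \<tau> = (THE A. A \<in> P \<and> coding2 a b \<tau> \<in> A)"

lemma cell_eq_iff:
  assumes "P \<in> finite_partitions \<mu>"
  shows "cell P \<tau> = A \<longleftrightarrow> A \<in> P \<and> coding2 a b \<tau> \<in> A"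
proof -
  have part: "partition_on (space coded_space) P" using assms by (simp add: finite_partitions_def)
  then have "\<exists>A\<in>P. coding2 a b \<tau> \<in> A"
    using coding2_in_space[of \<tau>] by (auto simp: partition_on_def)
  moreover have "A = B" if "A \<in> P" "B \<in> P" "coding2 a b \<tau> \<in> A" "coding2 a b \<tau> \<in> B" for A B
    using partition_onD2[OF part] that by (auto simp: disjoint_def)
  ultimately have ex: "\<exists>!A. A \<in> P \<and> coding2 a b \<tau> \<in> A" by blast
  show ?thesis unfolding cell_def using theI'[OF ex] the1_equality[OF ex] by blast
qed

lemma cell_process:
  assumes P: "P \<in> finite_partitions \<mu>" shows "finite_process M F C (cell P) P"
proof
  show "finite P" using P by (simp add: finite_partitions_def)
  show "cell P \<tau> \<in> P" for \<tau> using cell_eq_iff[OF P, of \<tau> "cell P \<tau>"] by simp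
  fix A
  show "{\<tau>. cell P \<tau> = A} \<in> events"
  proof (cases "A \<in> P")
    case True
    then have [measurable]: "A \<in> sets coded_space" using P by (auto simp: finite_partitions_def)
    have "{\<tau>\<in>space M. coding2 a b \<tau> \<in> A} \<in> events" by measurable
    then show ?thesis using True by (simp add: cell_eq_iff[OF P])
  qed (simp add: cell_eq_iff[OF P])
qed

text \<open>Distinct itineraries can name the same atom only if this atom is empty, and empty atoms do not
  contribute.\<close>

lemma partition_entropy_eq:
  assumes P: "P \<in> finite_partitions \<mu>"
  shows "partition_entropy \<mu> (refined_partition \<mu> T P n) = process_entropy (cell P) n"
proof -
  interpret finite_process M F C "cell P" P by (rule cell_process[OF P])
  have P_sets: "A \<in> sets coded_space" if "A \<in> P" for A using P that by (auto simp: finite_partitions_def)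
  have disj: "A \<inter> B = {}" if "A \<in> P" "B \<in> P" "A \<noteq> B" for A B
    using P that by (auto simp: finite_partitions_def partition_on_def disjoint_def)
  define E where "E s = {z\<in>space \<mu>. \<forall>k<n. (T ^^ k) z \<in> s k}" for s
  have law_E: "measure \<mu> (E s) = law n s" if s: "s \<in> words n" for s
  proof -
    have sP: "s k \<in> P" if "k < n" for k using s that by (auto simp: words_def)
    have "measure \<mu> (E s) = prob {\<tau>. \<forall>k<n. coding2 a b (translate (int k) \<tau>) \<in> s k}"
      unfolding E_def using sP P_sets by (intro measure_orbit_cell) auto
    also have "{\<tau>. \<forall>k<n. coding2 a b (translate (int k) \<tau>) \<in> s k} = {\<tau>. itinerary n \<tau> = s}"
      using sP s by (auto simp: itinerary_eq_iff cell_eq_iff[OF P])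
    finally show ?thesis by (simp add: law_def)
  qed
  have "refined_partition \<mu> T P n = E ` words n"
    by (simp add: refined_partition_def E_def words_def)
  then have "partition_entropy \<mu> (refined_partition \<mu> T P n) = - (\<Sum>A\<in>E ` words n. measure \<mu> A * ln (measure \<mu> A))"
    by (simp add: partition_entropy_def)
  also have "(\<Sum>A\<in>E ` words n. measure \<mu> A * ln (measure \<mu> A)) = (\<Sum>s\<in>words n. measure \<mu> (E s) * ln (measure \<mu> (E s)))"
  proof (subst sum.reindex_nontrivial[OF finite_words])
    fix s t assume st: "s \<in> words n" "t \<in> words n" "s \<noteq> t" "E s = E t"
    obtain k where k: "k < n" "s k \<noteq> t k"
      using st PiE_ext[of s "{..<n}" "\<lambda>_. P" t] unfolding words_def by auto
    have "s k \<inter> t k = {}" using st k by (intro disj) (auto simp: words_def)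
    then have "E s \<inter> E t = {}" using k unfolding E_def by blast
    then have "E s = {}" using st by simp
    then show "measure \<mu> (E s) * ln (measure \<mu> (E s)) = 0" by simp
  qed (simp add: comp_def)
  also have "\<dots> = (\<Sum>s\<in>words n. law n s * ln (law n s))" by (intro sum.cong) (simp_all add: law_E)
  finally show ?thesis by (simp add: process_entropy_eq)
qed

lemma ks_entropy_eq_SUP:
  "ks_entropy \<mu> T = (SUP P\<in>finite_partitions \<mu>. ereal (lim (\<lambda>n. process_entropy (cell P) n / real n)))"
  unfolding ks_entropy_def by (intro SUP_cong refl) (simp add: partition_entropy_eq)

lemma gibbs_entropy_integral:
  assumes "gibbs_entropy \<noteq> \<infinity>"
  shows "integrable M F" "gibbs_entropy = ereal (integral\<^sup>L M F)"
proof -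
  have "(\<integral>\<^sup>+\<tau>. ennreal (F \<tau> + ln C) \<partial>M) < \<infinity>"
    using assms unfolding gibbs_entropy_def by (cases "\<integral>\<^sup>+\<tau>. ennreal (F \<tau> + ln C) \<partial>M") auto
  then have int: "integrable M (\<lambda>\<tau>. F \<tau> + ln C)" using F_lower_bound by (intro integrableI_nonneg) auto
  then have "integrable M (\<lambda>\<tau>. (F \<tau> + ln C) - ln C)" by (intro Bochner_Integration.integrable_diff) auto
  then show F: "integrable M F" by simp
  have "(\<integral>\<^sup>+\<tau>. ennreal (F \<tau> + ln C) \<partial>M) = ennreal (integral\<^sup>L M (\<lambda>\<tau>. F \<tau> + ln C))"
    using int F_lower_bound by (intro nn_integral_eq_integral) auto
  moreover have "0 \<le> integral\<^sup>L M (\<lambda>\<tau>. F \<tau> + ln C)" using F_lower_bound by (intro Bochner_Integration.integral_nonneg) auto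
  moreover have "integral\<^sup>L M (\<lambda>\<tau>. F \<tau> + ln C) = integral\<^sup>L M F + ln C" using F by simp
  ultimately show "gibbs_entropy = ereal (integral\<^sup>L M F)"
    unfolding gibbs_entropy_def by (simp add: enn2ereal_ennreal)
qed

lemma ks_entropy_le: "ks_entropy \<mu> T \<le> gibbs_entropy"
proof (cases "gibbs_entropy = \<infinity>")
  case False
  show ?thesis
    unfolding ks_entropy_eq_SUP gibbs_entropy_integral(2)[OF False]
  proof (rule SUP_least)
    fix P assume "P \<in> finite_partitions \<mu>"
    then interpret finite_process M F C "cell P" P by (rule cell_process)
    show "ereal (lim (\<lambda>n. process_entropy (cell P) n / real n)) \<le> ereal (integral\<^sup>L M F)"
      using entropy_rate_le[OF gibbs_entropy_integral(1)[OF False]] by simp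
  qed
qed simp

text \<open>The partition by the truncated digit of the first coordinate is a partition of the plane that
  almost surely reads the truncated symbol at \<open>0\<close>.\<close>

lemma truncated_rate_le_ks:
  "ereal (lim (\<lambda>n. process_entropy (\<lambda>\<tau>. min (to_nat (\<tau> 0)) N) n / real n)) \<le> ks_entropy \<mu> T"
proof -
  define d where "d z = min (to_nat (digit a b (fst z))) N" for z :: "real \<times> real"
  have "(\<lambda>x. min (to_nat (digit a b x)) N) \<in> borel \<rightarrow>\<^sub>M count_space UNIV"
    by (rule measurable_compose[OF measurable_digit]) simp
  then have d_meas: "d \<in> coded_space \<rightarrow>\<^sub>M count_space UNIV"
    unfolding d_def by (rule measurable_compose[OF measurable_fst_coded])
  define P where "P = (\<lambda>i. d -` {i} \<inter> space coded_space) ` {..N} - {{}}"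
  have P: "P \<in> finite_partitions \<mu>"
    unfolding finite_partitions_def
  proof (intro CollectI conjI)
    show "P \<subseteq> sets \<mu>" using measurable_sets[OF d_meas] by (auto simp: P_def)
    have "d z \<le> N" for z by (simp add: d_def)
    then show "partition_on (space \<mu>) P"
      by (auto simp: partition_on_def P_def disjoint_def)
  qed (simp add: P_def)
  have cell: "cell P \<tau> = cell P \<tau>' \<longleftrightarrow> d (coding2 a b \<tau>) = d (coding2 a b \<tau>')" for \<tau> \<tau>'
  proof -
    have in_P: "d -` {d (coding2 a b \<tau>)} \<inter> space coded_space \<in> P" for \<tau>
      using coding2_in_space[of \<tau>] by (auto simp: P_def d_def)
    have eq: "cell P \<tau> = d -` {d (coding2 a b \<tau>)} \<inter> space coded_space" for \<tau>
      using in_P coding2_in_space by (subst cell_eq_iff[OF P]) auto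
    show ?thesis unfolding eq using coding2_in_space[of \<tau>] by auto
  qed
  have "process_entropy (cell P) n = process_entropy (\<lambda>\<tau>. min (to_nat (\<tau> 0)) N) n" for n
  proof (rule process_entropy_cong_AE[OF cell_process[OF P] truncated_symbol_process AE_regular_orbit])
    fix \<tau> \<tau>' k assume "regular_orbit \<tau>" "regular_orbit \<tau>'"
    then show "cell P (translate (int k) \<tau>) = cell P (translate (int k) \<tau>') \<longleftrightarrow>
       min (to_nat (translate (int k) \<tau> 0)) N = min (to_nat (translate (int k) \<tau>' 0)) N"
      unfolding cell d_def by (simp add: regular_orbit_conjugacy translate_apply)
  qed
  then show ?thesis unfolding ks_entropy_eq_SUP using P by (intro SUP_upper2[of P]) simp_all
qed

lemma ks_entropy_eq: "ks_entropy \<mu> T = gibbs_entropy"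
proof (rule antisym[OF ks_entropy_le], rule dense_le)
  fix x assume x: "x < gibbs_entropy"
  show "x \<le> ks_entropy \<mu> T"
  proof (cases "x < 0")
    case True
    interpret finite_process M F C "\<lambda>\<tau>. min (to_nat (\<tau> 0)) (0::nat)" "{..0}" by (rule truncated_symbol_process)
    have "0 \<le> lim (\<lambda>n. process_entropy (\<lambda>\<tau>. min (to_nat (\<tau> 0)) (0::nat)) n / real n)"
      using process_entropy_nonneg by (intro LIMSEQ_le_const[OF entropy_rate_lim]) auto
    then have "0 \<le> ereal (lim (\<lambda>n. process_entropy (\<lambda>\<tau>. min (to_nat (\<tau> 0)) (0::nat)) n / real n))" by simp
    also have "\<dots> \<le> ks_entropy \<mu> T" by (rule truncated_rate_le_ks)
    finally show ?thesis using True by simp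
  next
    case False
    then obtain y where y: "x = ereal y" "0 \<le> y" using x by (cases x) auto
    have lnC: "0 \<le> ln C" using C_ge_1 by simp
    have "ereal (y + ln C) < enn2ereal (\<integral>\<^sup>+\<tau>. ennreal (F \<tau> + ln C) \<partial>M)"
      using x unfolding y gibbs_entropy_def by (cases "\<integral>\<^sup>+\<tau>. ennreal (F \<tau> + ln C) \<partial>M") (auto simp: enn2ereal_ennreal)
    then have "ennreal (y + ln C) < (\<integral>\<^sup>+\<tau>. ennreal (F \<tau> + ln C) \<partial>M)"
      using y lnC by (simp add: less_ennreal.rep_eq enn2ereal_ennreal del: ennreal_plus)
    then obtain N where "y \<le> lim (\<lambda>n. process_entropy (\<lambda>\<tau>. min (to_nat (\<tau> 0)) N) n / real n)"
      using truncated_rate_approximates[OF \<open>0 \<le> y\<close>] F_lower_bound by blast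
    then have "x \<le> ereal (lim (\<lambda>n. process_entropy (\<lambda>\<tau>. min (to_nat (\<tau> 0)) N) n / real n))" by (simp add: y)
    then show ?thesis using truncated_rate_le_ks by (meson order_trans)
  qed
qed

lemma lyapunov_exponent_eq: "lyapunov_exponent a b \<mu> = mean_contraction"
proof -
  note [measurable] = measurable_compose[OF measurable_digit measurable_count_real]
  have meas: "(\<lambda>z. ennreal (- ln (a (digit a b (fst z))))) \<in> borel_measurable coded_space"
  proof -
    have "(\<lambda>x. ennreal (- ln (a (digit a b x)))) \<in> borel_measurable borel" by measurable
    then show ?thesis by (rule measurable_compose[OF measurable_fst_coded])
  qed
  have "(\<integral>\<^sup>+(x, y). ennreal (- ln (a (digit a b x))) \<partial>\<mu>) = (\<integral>\<^sup>+z. ennreal (- ln (a (digit a b (fst z)))) \<partial>\<mu>)"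
    by (intro nn_integral_cong) (simp split: prod.split)
  also have "\<dots> = (\<integral>\<^sup>+\<tau>. ennreal (- ln (a (digit a b (fst (coding2 a b \<tau>))))) \<partial>M)"
    unfolding \<mu>_def using meas by (intro nn_integral_distr) auto
  also have "\<dots> = (\<integral>\<^sup>+\<tau>. ennreal (- ln (a (\<tau> 0))) \<partial>M)"
  proof (rule nn_integral_cong_AE)
    show "AE \<tau> in M. ennreal (- ln (a (digit a b (fst (coding2 a b \<tau>))))) = ennreal (- ln (a (\<tau> 0)))"
      using AE_regular_orbit
    proof eventually_elim
      case (elim \<tau>)
      then show ?case using regular_orbit_conjugacy(2)[OF elim, of 0] by simp
    qed
  qed
  finally show ?thesis by (simp add: lyapunov_exponent_def mean_contraction_def)
qed

end

section \<open>Conditional measures\<close>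

text \<open>This makes the set of points with a given local dimension measurable, as only countably many
  radii occur in the hypothesis on the limit.\<close>

lemma log_ratio_along_powers:
  fixes q :: "real \<Rightarrow> real"
  assumes pos: "\<And>r. 0 < r \<Longrightarrow> 0 < q r" and le1: "\<And>r. q r \<le> 1" and mono: "\<And>r r'. r \<le> r' \<Longrightarrow> q r \<le> q r'"
    and lim: "(\<lambda>n. - ln (q (exp (- real n))) / real n) \<longlonglongrightarrow> d"
  shows "((\<lambda>r. ln (q r) / ln r) \<longlongrightarrow> d) (at_right 0)"
proof -
  have "0 \<le> d"
  proof (rule LIMSEQ_le_const[OF lim], intro exI allI impI)
    fix n :: nat
    have "ln (q (exp (- real n))) \<le> 0" using pos[of "exp (- real n)"] le1 by simp
    then show "0 \<le> - ln (q (exp (- real n))) / real n" by (intro divide_nonneg_nonneg) auto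
  qed
  have upper: "\<forall>\<^sub>F r in at_right 0. ln (q r) / ln r \<le> (d + \<delta>) / 1 + \<delta>" if "0 < \<delta>" for \<delta>
  proof (rule log_ratio_upper)
    have "\<forall>\<^sub>F n in sequentially. - ln (q (exp (- real n))) / real n < d + \<delta>"
      using lim \<open>0 < \<delta>\<close> by (intro order_tendstoD) auto
    then show "\<forall>\<^sub>F n in sequentially. \<forall>r. exp (- (real n * 1)) < r \<longrightarrow> exp (- (real n * (d + \<delta>))) \<le> q r"
      using eventually_gt_at_top[of "0::nat"]
    proof eventually_elim
      case (elim n)
      have "- (real n * (d + \<delta>)) \<le> ln (q (exp (- real n)))" using elim by (simp add: field_simps)
      then have "exp (- (real n * (d + \<delta>))) \<le> q (exp (- real n))" using pos by (simp add: ln_ge_iff)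
      then show ?case using mono by (auto intro: order_trans less_imp_le)
    qed
  qed (use pos \<open>0 \<le> d\<close> \<open>0 < \<delta>\<close> in auto)
  have lower: "\<forall>\<^sub>F r in at_right 0. max 0 (d - \<delta>) / 1 - \<delta> \<le> ln (q r) / ln r" if "0 < \<delta>" for \<delta>
  proof (rule log_ratio_lower)
    have "\<forall>\<^sub>F n in sequentially. d - \<delta> < - ln (q (exp (- real n))) / real n"
      using lim \<open>0 < \<delta>\<close> by (intro order_tendstoD) auto
    then show "\<forall>\<^sub>F n in sequentially. q (exp (- (real n * 1))) \<le> exp (- (real n * max 0 (d - \<delta>)))"
      using eventually_gt_at_top[of "0::nat"]
    proof eventually_elim
      case (elim n)
      have "ln (q (exp (- real n))) \<le> - (real n * (d - \<delta>))" using elim by (simp add: field_simps)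
      then have "q (exp (- real n)) \<le> exp (- (real n * (d - \<delta>)))" using pos by (simp add: le_exp_iff)
      then show ?case using le1 by (auto simp: max_def)
    qed
  qed (use pos mono \<open>0 < \<delta>\<close> in auto)
  show ?thesis
  proof (rule order_tendstoI)
    fix x assume "x < d"
    then have \<delta>: "0 < (d - x) / 3" by simp
    show "\<forall>\<^sub>F r in at_right 0. x < ln (q r) / ln r"
      using lower[OF \<delta>]
    proof eventually_elim
      case (elim r)
      have "d - (d - x) / 3 \<le> max 0 (d - (d - x) / 3) / 1" by simp
      with elim \<open>x < d\<close> show ?case by argo
    qed
  next
    fix x assume "d < x"
    then have \<delta>: "0 < (x - d) / 3" by simp
    show "\<forall>\<^sub>F r in at_right 0. ln (q r) / ln r < x"
      using upper[OF \<delta>]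
    proof eventually_elim
      case (elim r)
      with \<open>d < x\<close> show ?case by argo
    qed
  qed
qed

lemma log_ratio_comparable:
  fixes p q :: "real \<Rightarrow> real"
  assumes "1 \<le> D" and pos: "\<And>r. 0 < r \<Longrightarrow> 0 < q r"
    and comp: "\<And>r. 0 < r \<Longrightarrow> p r \<le> D * q r" "\<And>r. 0 < r \<Longrightarrow> q r \<le> D * p r"
    and lim: "((\<lambda>r. ln (q r) / ln r) \<longlongrightarrow> d) (at_right 0)"
  shows "((\<lambda>r. ln (p r) / ln r) \<longlongrightarrow> d) (at_right 0)"
proof -
  have diff: "\<bar>ln (p r) - ln (q r)\<bar> \<le> ln D" if "0 < r" for r
  proof -
    have "0 < D * p r" using pos[OF that] comp(2)[OF that] by (rule less_le_trans)
    then have p: "0 < p r" using \<open>1 \<le> D\<close> by (simp add: zero_less_mult_iff)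
    have "ln (p r) \<le> ln (D * q r)" using p comp(1)[OF that] by (meson less_le_trans ln_le_cancel_iff)
    moreover have "ln (q r) \<le> ln (D * p r)" using pos[OF that] comp(2)[OF that] by (meson less_le_trans ln_le_cancel_iff)
    ultimately show ?thesis using p pos[OF that] \<open>1 \<le> D\<close> by (simp add: ln_mult)
  qed
  have "((\<lambda>r. ln (p r) / ln r - ln (q r) / ln r) \<longlongrightarrow> 0) (at_right 0)"
  proof (rule tendstoI)
    fix e :: real assume "0 < e"
    show "\<forall>\<^sub>F r in at_right 0. dist (ln (p r) / ln r - ln (q r) / ln r) 0 < e"
      using eventually_at_right_0_ln[of "ln D / e"]
    proof eventually_elim
      case (elim r)
      then have "0 < - ln r" by simp
      have "\<bar>ln (p r) / ln r - ln (q r) / ln r\<bar> = \<bar>ln (p r) - ln (q r)\<bar> / (- ln r)"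
        using \<open>0 < - ln r\<close> by (simp add: diff_divide_distrib[symmetric] abs_divide)
      also have "\<dots> \<le> ln D / (- ln r)" using diff[of r] elim \<open>0 < - ln r\<close> by (intro divide_right_mono) auto
      also have "\<dots> < e"
      proof -
        have "ln D < e * (- ln r)" using elim \<open>0 < e\<close> by (simp add: field_simps)
        then show ?thesis using \<open>0 < - ln r\<close> by (simp only: pos_divide_less_eq)
      qed
      finally show ?case by (simp add: dist_real_def)
    qed
  qed
  from tendsto_add[OF this lim] show ?thesis by simp
qed

text \<open>Open balls are increasing unions of smaller balls.\<close>

lemma measure_ball_le:
  fixes N :: "real measure"
  assumes "finite_measure N" and sets: "\<And>s. ball y s \<inter> S \<in> sets N"
    and le: "\<And>s. s < r \<Longrightarrow> measure N (ball y s \<inter> S) \<le> c"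
  shows "measure N (ball y r \<inter> S) \<le> c"
proof -
  interpret finite_measure N by fact
  have "(\<lambda>n. measure N (ball y (r - 1 / real (Suc n)) \<inter> S)) \<longlonglongrightarrow> measure N (\<Union>n. ball y (r - 1 / real (Suc n)) \<inter> S)"
  proof (rule finite_Lim_measure_incseq)
    show "incseq (\<lambda>n. ball y (r - 1 / real (Suc n)) \<inter> S)"
    proof (rule incseq_SucI)
      fix n
      have "1 / real (Suc (Suc n)) \<le> 1 / real (Suc n)" by (simp add: frac_le)
      then show "ball y (r - 1 / real (Suc n)) \<inter> S \<subseteq> ball y (r - 1 / real (Suc (Suc n))) \<inter> S" by auto
    qed
  qed (use sets in auto)
  moreover have "(\<Union>n. ball y (r - 1 / real (Suc n)) \<inter> S) = ball y r \<inter> S"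
  proof
    show "ball y r \<inter> S \<subseteq> (\<Union>n. ball y (r - 1 / real (Suc n)) \<inter> S)"
    proof
      fix x assume x: "x \<in> ball y r \<inter> S"
      then obtain n where "1 / real (Suc n) < r - dist y x" using nat_approx_posE[of "r - dist y x"] by auto
      then show "x \<in> (\<Union>n. ball y (r - 1 / real (Suc n)) \<inter> S)" using x by (auto intro!: exI[of _ n])
    qed
    have "r - 1 / real (Suc n) \<le> r" for n by simp
    then show "(\<Union>n. ball y (r - 1 / real (Suc n)) \<inter> S) \<subseteq> ball y r \<inter> S" using subset_ball by blast
  qed
  ultimately have "(\<lambda>n. measure N (ball y (r - 1 / real (Suc n)) \<inter> S)) \<longlonglongrightarrow> measure N (ball y r \<inter> S)" by simp
  then show ?thesis by (rule LIMSEQ_le_const2) (use le in auto)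
qed

text \<open>Test the assumption on the set where the conclusion fails.\<close>

lemma AE_le_of_set_integrals:
  fixes f g :: "'x \<Rightarrow> real"
  assumes f: "integrable N f" and g: "integrable N g"
    and le: "\<And>A. A \<in> sets N \<Longrightarrow> (\<integral>x. indicator A x * f x \<partial>N) \<le> (\<integral>x. indicator A x * g x \<partial>N)"
  shows "AE x in N. f x \<le> g x"
proof -
  have [measurable]: "f \<in> borel_measurable N" "g \<in> borel_measurable N" using f g by auto
  define A where "A = {x\<in>space N. g x < f x}"
  have A [measurable]: "A \<in> sets N" unfolding A_def by measurable
  have ints: "integrable N (\<lambda>x. indicator A x * f x)" "integrable N (\<lambda>x. indicator A x * g x)"
    using f g A by (auto intro: integrable_real_mult_indicator simp: mult.commute[of "indicator A _"])
  let ?h = "\<lambda>x. indicator A x * f x - indicator A x * g x"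
  have h_nonneg: "AE x in N. 0 \<le> ?h x" by (intro AE_I2) (auto simp: A_def indicator_def)
  have "integral\<^sup>L N ?h \<le> 0" using le[OF A] ints by simp
  moreover have "0 \<le> integral\<^sup>L N ?h" using h_nonneg by (rule integral_nonneg_AE)
  ultimately have "AE x in N. ?h x = 0"
    using integral_nonneg_eq_0_iff_AE[of N ?h] ints h_nonneg by simp
  then show ?thesis
    by (rule AE_mp) (auto simp: A_def indicator_def intro!: AE_I2)
qed

text \<open>Such a function is a limit of functions of finitely many coordinates, which are measurable because
  the alphabet is countable. The value \<open>undefined\<close> is an arbitrary symbol outside the window.\<close>

lemma locally_holder_measurable:
  fixes g :: "(int \<Rightarrow> 'e::countable) \<Rightarrow> real"
  assumes "locally_holder_two_sided g"
  shows "g \<in> borel_measurable (PiM UNIV (\<lambda>_. count_space UNIV))"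
proof (rule borel_measurable_LIMSEQ_real)
  obtain D \<beta> where "0 < D" "0 < \<beta>" and
    H: "\<And>n \<omega> \<tau>. (\<forall>k. \<bar>k\<bar> \<le> int n \<longrightarrow> \<omega> k = \<tau> k) \<Longrightarrow> \<bar>g \<omega> - g \<tau>\<bar> \<le> D * exp (- \<beta> * real n)"
    using assms unfolding locally_holder_two_sided_def by blast
  define u where "u n w = (\<lambda>k. if \<bar>k\<bar> \<le> int n then w ! nat (k + int n) else undefined)" for n :: nat and w :: "'e list"
  define h where "h n \<tau> = g (u n (block (- int n) (2 * n + 1) \<tau>))" for n \<tau>
  show "h n \<in> borel_measurable (PiM UNIV (\<lambda>_. count_space UNIV))" for n
    unfolding h_def by (rule measurable_compose[OF measurable_block]) simp
  fix \<tau>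
  have "\<bar>h n \<tau> - g \<tau>\<bar> \<le> D * exp (- \<beta>) ^ n" for n
  proof -
    have "\<bar>h n \<tau> - g \<tau>\<bar> \<le> D * exp (- \<beta> * real n)"
      unfolding h_def by (rule H) (auto simp: u_def)
    then show ?thesis by (simp add: exp_of_nat_mult[symmetric] mult.commute)
  qed
  then have le: "\<forall>\<^sub>F n in sequentially. norm (h n \<tau> - g \<tau>) \<le> D * exp (- \<beta>) ^ n" by simp
  have "(\<lambda>n. exp (- \<beta>) ^ n) \<longlonglongrightarrow> 0"
    using \<open>0 < \<beta>\<close> by (intro LIMSEQ_realpow_zero) auto
  then have "(\<lambda>n. D * exp (- \<beta>) ^ n) \<longlonglongrightarrow> 0" by (rule tendsto_mult_right_zero)
  with le have "(\<lambda>n. h n \<tau> - g \<tau>) \<longlonglongrightarrow> 0" by (rule Lim_null_comparison)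
  then show "(\<lambda>n. h n \<tau>) \<longlonglongrightarrow> g \<tau>" by (rule LIM_zero_cancel)
qed

lemma gibbs_shift_of_gibbs_state:
  fixes g :: "(int \<Rightarrow> 'e::countable) \<Rightarrow> real"
  assumes "invariant_gibbs_state g M" and g: "locally_holder_two_sided g"
  shows "\<exists>C. gibbs_shift M (\<lambda>\<tau>. pressure g - g \<tau>) C"
proof -
  obtain C where M: "prob_space M" "sets M = sets (PiM UNIV (\<lambda>_. count_space UNIV))" "distr M M shift = M"
    and C: "1 \<le> C"
    and bounds: "\<And>\<omega> n. inverse C \<le> measure M (cylinder (map (\<lambda>k. \<omega> (int k)) [0..<n]))
            / exp (birkhoff_sum g n \<omega> - real n * pressure g) \<and>
        measure M (cylinder (map (\<lambda>k. \<omega> (int k)) [0..<n]))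
            / exp (birkhoff_sum g n \<omega> - real n * pressure g) \<le> C"
    using assms(1) unfolding invariant_gibbs_state_def by auto
  have sum: "birkhoff_sum g n \<omega> - real n * pressure g = - (\<Sum>k<n. pressure g - g (translate (int k) \<omega>))" for n \<omega>
    by (simp add: birkhoff_sum_def shift_eq_translate translate_funpow sum_subtractf)
  have block: "map (\<lambda>k. \<omega> (int k)) [0..<n] = block 0 n \<omega>" for \<omega> :: "int \<Rightarrow> 'e" and n
    by (simp add: block_def)
  have g_meas: "g \<in> borel_measurable M"
    using locally_holder_measurable[OF g] measurable_cong_sets[OF M(2) refl] by blast
  interpret prob_space M by (rule M(1))
  have "gibbs_shift M (\<lambda>\<tau>. pressure g - g \<tau>) C"
  proof
    fix n \<tau>
    let ?E = "exp (- (\<Sum>k<n. pressure g - g (translate (int k) \<tau>)))"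
    have "inverse C \<le> prob (cylinder (block 0 n \<tau>)) / ?E" "prob (cylinder (block 0 n \<tau>)) / ?E \<le> C"
      using bounds[of \<tau> n] unfolding block sum by auto
    then show "?E \<le> C * prob (cylinder (block 0 n \<tau>))" "prob (cylinder (block 0 n \<tau>)) \<le> C * ?E"
      using C by (simp_all only: pos_le_divide_eq pos_divide_le_eq exp_gt_zero) (simp add: field_simps)
  qed (use M C g_meas in auto)
  then show ?thesis ..
qed

context luroth_gibbs
begin

definition base_law :: "real measure" where
  "base_law = distr \<mu> (base_space a b) fst"

lemma prob_space_\<mu>: "prob_space \<mu>"
  unfolding \<mu>_def by (rule prob_space_distr) measurable

lemma fst_\<mu>: "fst \<in> \<mu> \<rightarrow>\<^sub>M base_space a b"
  unfolding \<mu>_def by simp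

lemma prob_space_base_law: "prob_space base_law"
  unfolding base_law_def by (rule prob_space.prob_space_distr[OF prob_space_\<mu> fst_\<mu>])

lemma sets_base_law [simp]: "sets base_law = sets (base_space a b)"
  and space_base_law [simp]: "space base_law = limit_set a b"
  by (simp_all add: base_law_def space_base)

text \<open>A rectangle is the intersection of an event of the past with one of the future.\<close>

lemma measure_rectangle:
  assumes A: "A \<in> sets (base_space a b)" and B: "B \<in> sets (fibre_space a b)"
  shows "measure \<mu> (A \<times> B) \<le> C ^ 3 * (measure base_law A * prob {\<tau>. pt \<tau> \<in> B})"
    and "measure base_law A * prob {\<tau>. pt \<tau> \<in> B} \<le> C ^ 3 * measure \<mu> (A \<times> B)"
proof -
  let ?P = "PiM UNIV (\<lambda>_::nat. count_space (UNIV :: 'e set))"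
  have "coding a b -` B \<inter> space ?P \<in> sets ?P" by (rule measurable_sets[OF measurable_coding_fibre B])
  then have S: "coding a b -` B \<in> sets ?P" by (simp add: space_PiM)
  have "coding a b -` A \<inter> space ?P \<in> sets ?P" by (rule measurable_sets[OF measurable_coding_base A])
  then have S': "coding a b -` A \<in> sets ?P" by (simp add: space_PiM)
  have AB: "A \<times> B \<in> sets coded_space" using A B by (rule pair_measureI)
  have "measure \<mu> (A \<times> B) = prob (coding2 a b -` (A \<times> B) \<inter> space M)"
    unfolding \<mu>_def by (rule measure_distr[OF measurable_coding2_M AB])
  also have "coding2 a b -` (A \<times> B) \<inter> space M = past -` (coding a b -` B) \<inter> future -` (coding a b -` A)"
    by (auto simp: coding2_eq)
  finally have 1: "measure \<mu> (A \<times> B) = prob (past -` (coding a b -` B) \<inter> future -` (coding a b -` A))" .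
  have "measure base_law A = measure \<mu> (fst -` A \<inter> space \<mu>)"
    unfolding base_law_def by (rule measure_distr[OF fst_\<mu> A])
  also have "\<dots> = prob (coding2 a b -` (fst -` A \<inter> space \<mu>) \<inter> space M)"
    unfolding \<mu>_def by (rule measure_distr[OF measurable_coding2_M])
      (use measurable_sets[OF fst_\<mu> A] in \<open>simp add: \<mu>_def\<close>)
  also have "coding2 a b -` (fst -` A \<inter> space \<mu>) \<inter> space M = future -` (coding a b -` A)"
    using coding2_in_space by (auto simp: coding2_eq)
  finally have 2: "measure base_law A = prob (future -` (coding a b -` A))" .
  have 3: "{\<tau>. pt \<tau> \<in> B} = past -` (coding a b -` B)" by (auto simp: pt_def)
  show "measure \<mu> (A \<times> B) \<le> C ^ 3 * (measure base_law A * prob {\<tau>. pt \<tau> \<in> B})"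
    using past_future(3)[OF S S'] unfolding 1 2 3 by (simp add: mult.commute)
  show "measure base_law A * prob {\<tau>. pt \<tau> \<in> B} \<le> C ^ 3 * measure \<mu> (A \<times> B)"
    using past_future(4)[OF S S'] unfolding 1 2 3 by (simp add: mult.commute)
qed

end

locale luroth_conditional = luroth_gibbs a b M F C
  for a b :: "'e::countable \<Rightarrow> real" and M :: "(int \<Rightarrow> 'e) measure" and F C +
  fixes \<kappa> :: "real \<Rightarrow> real measure"
  assumes conditional: "conditional_measures (base_space a b) (fibre_space a b) \<mu> \<kappa>"
begin

lemma \<kappa>_meas: "\<kappa> \<in> base_space a b \<rightarrow>\<^sub>M prob_algebra (fibre_space a b)"
  using conditional by (simp add: conditional_measures_def)

lemma disintegration:
  assumes "A \<in> sets coded_space"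
  shows "emeasure \<mu> A = (\<integral>\<^sup>+x. emeasure (\<kappa> x) (Pair x -` A) \<partial>base_law)"
  using conditional assms by (simp add: conditional_measures_def base_law_def)

lemma
  assumes "x \<in> limit_set a b"
  shows prob_space_\<kappa>: "prob_space (\<kappa> x)" and sets_\<kappa>: "sets (\<kappa> x) = sets (fibre_space a b)"
  using measurable_space[OF \<kappa>_meas, of x] assms by (auto simp: space_prob_algebra space_base)

lemma space_\<kappa>: "x \<in> limit_set a b \<Longrightarrow> space (\<kappa> x) = closure (limit_set a b)"
  using sets_eq_imp_space_eq[OF sets_\<kappa>] by (simp add: space_fibre)

lemma measurable_emeasure_\<kappa>:
  assumes "B \<in> sets (fibre_space a b)"
  shows "(\<lambda>x. emeasure (\<kappa> x) B) \<in> borel_measurable base_law"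
proof -
  have "(\<lambda>x. emeasure (\<kappa> x) B) \<in> borel_measurable (base_space a b)"
    using measurable_compose[OF measurable_prob_algebraD[OF \<kappa>_meas] measurable_emeasure_subprob_algebra[OF assms]] .
  then show ?thesis using measurable_cong_sets[OF sets_base_law refl] by blast
qed

lemma
  assumes B: "B \<in> sets (fibre_space a b)"
  shows integrable_\<kappa>: "integrable base_law (\<lambda>x. measure (\<kappa> x) B)"
    and integral_\<kappa>: "A \<in> sets (base_space a b) \<Longrightarrow> (\<integral>x. indicator A x * measure (\<kappa> x) B \<partial>base_law) = measure \<mu> (A \<times> B)"
proof -
  interpret base: prob_space base_law by (rule prob_space_base_law)
  interpret m: prob_space \<mu> by (rule prob_space_\<mu>)
  have meas [measurable]: "(\<lambda>x. measure (\<kappa> x) B) \<in> borel_measurable base_law"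
    unfolding measure_def using measurable_emeasure_\<kappa>[OF B] by (rule measurable_compose) simp
  have le1: "measure (\<kappa> x) B \<le> 1" if "x \<in> limit_set a b" for x
    using prob_space.prob_le_1[OF prob_space_\<kappa>[OF that]] .
  show int: "integrable base_law (\<lambda>x. measure (\<kappa> x) B)"
    by (rule base.integrable_const_bound[where B = 1]) (auto intro!: AE_I2 le1)
  assume A: "A \<in> sets (base_space a b)"
  have "ennreal (measure \<mu> (A \<times> B)) = emeasure \<mu> (A \<times> B)" by (simp add: m.emeasure_eq_measure)
  also have "\<dots> = (\<integral>\<^sup>+x. emeasure (\<kappa> x) (Pair x -` (A \<times> B)) \<partial>base_law)"
    using A B by (intro disintegration pair_measureI)
  also have "\<dots> = (\<integral>\<^sup>+x. ennreal (indicator A x * measure (\<kappa> x) B) \<partial>base_law)"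
  proof (rule nn_integral_cong)
    fix x assume "x \<in> space base_law"
    then interpret k: prob_space "\<kappa> x" by (intro prob_space_\<kappa>) simp
    show "emeasure (\<kappa> x) (Pair x -` (A \<times> B)) = ennreal (indicator A x * measure (\<kappa> x) B)"
      by (auto simp: indicator_def k.emeasure_eq_measure)
  qed
  also have "\<dots> = ennreal (\<integral>x. indicator A x * measure (\<kappa> x) B \<partial>base_law)"
  proof (rule nn_integral_eq_integral)
    show "integrable base_law (\<lambda>x. indicator A x * measure (\<kappa> x) B)"
      using integrable_real_mult_indicator[OF _ int, of A] A by (simp add: mult.commute)
  qed auto
  finally show "(\<integral>x. indicator A x * measure (\<kappa> x) B \<partial>base_law) = measure \<mu> (A \<times> B)"
    by (subst (asm) ennreal_inj) (auto intro!: Bochner_Integration.integral_nonneg)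
qed

text \<open>Integrate over an arbitrary set \<open>A\<close> of base points: the two sides then become the masses of a
  rectangle and of a product.\<close>

lemma AE_\<kappa>_comparable:
  assumes B: "B \<in> sets (fibre_space a b)"
  shows "AE x in base_law. measure (\<kappa> x) B \<le> C ^ 3 * prob {\<tau>. pt \<tau> \<in> B} \<and> prob {\<tau>. pt \<tau> \<in> B} \<le> C ^ 3 * measure (\<kappa> x) B"
proof -
  interpret base: prob_space base_law by (rule prob_space_base_law)
  let ?\<nu> = "prob {\<tau>. pt \<tau> \<in> B}"
  have const: "(\<integral>x. indicator A x * c \<partial>base_law) = measure base_law A * c" if "A \<in> sets base_law" for A and c :: real
    using sets.sets_into_space[OF that] that by (simp add: Int_absorb2)
  have scale: "(\<integral>x. indicator A x * (c * f x) \<partial>base_law) = c * (\<integral>x. indicator A x * f x \<partial>base_law)" for A c and f :: "real \<Rightarrow> real"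
  proof -
    have "(\<integral>x. indicator A x * (c * f x) \<partial>base_law) = (\<integral>x. c * (indicator A x * f x) \<partial>base_law)"
      by (rule Bochner_Integration.integral_cong[OF refl]) (rule mult.left_commute)
    then show ?thesis by simp
  qed
  have "AE x in base_law. measure (\<kappa> x) B \<le> C ^ 3 * ?\<nu>"
  proof (rule AE_le_of_set_integrals[OF integrable_\<kappa>[OF B]])
    fix A assume "A \<in> sets base_law"
    then show "(\<integral>x. indicator A x * measure (\<kappa> x) B \<partial>base_law) \<le> (\<integral>x. indicator A x * (C ^ 3 * ?\<nu>) \<partial>base_law)"
      using measure_rectangle(1)[of A B] B by (simp only: const integral_\<kappa>[OF B] sets_base_law) (simp add: ac_simps)
  qed simp
  moreover have "AE x in base_law. ?\<nu> \<le> C ^ 3 * measure (\<kappa> x) B"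
  proof (rule AE_le_of_set_integrals)
    fix A assume "A \<in> sets base_law"
    then show "(\<integral>x. indicator A x * ?\<nu> \<partial>base_law) \<le> (\<integral>x. indicator A x * (C ^ 3 * measure (\<kappa> x) B) \<partial>base_law)"
      using measure_rectangle(2)[of A B] B by (simp only: const scale integral_\<kappa>[OF B] sets_base_law)
  qed (use integrable_\<kappa>[OF B] in auto)
  ultimately show ?thesis by eventually_elim simp
qed

definition comparable :: "real \<Rightarrow> bool" where
  "comparable x \<longleftrightarrow> x \<in> limit_set a b \<and> (\<forall>y r. measure (\<kappa> x) (ball y r \<inter> space (\<kappa> x)) \<le> C ^ 3 * ball_mass y r \<and>
     ball_mass y r \<le> C ^ 3 * measure (\<kappa> x) (ball y r \<inter> space (\<kappa> x)))"

text \<open>One null set serves all balls, since countably many intervals with rational endpoints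
  separate a ball from every smaller concentric one.\<close>

lemma AE_comparable: "AE x in base_law. comparable x"
proof -
  define J where "J = closure (limit_set a b)"
  have open_sets: "U \<inter> J \<in> sets (fibre_space a b)" if "open U" for U
    unfolding fibre_space_def sets_restrict_space J_def using that by (auto intro!: imageI)
  have pt_J: "pt \<tau> \<in> J" for \<tau> unfolding pt_def J_def by (rule limit_set_subset_closure[OF coding_in_limit_set])
  have "AE x in base_law. \<forall>p::rat. \<forall>q::rat.
      measure (\<kappa> x) ({of_rat p<..<of_rat q} \<inter> J) \<le> C ^ 3 * prob {\<tau>. pt \<tau> \<in> {of_rat p<..<of_rat q} \<inter> J} \<and>
      prob {\<tau>. pt \<tau> \<in> {of_rat p<..<of_rat q} \<inter> J} \<le> C ^ 3 * measure (\<kappa> x) ({of_rat p<..<of_rat q} \<inter> J)"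
    unfolding AE_all_countable by (intro allI AE_\<kappa>_comparable open_sets) auto
  moreover have "AE x in base_law. x \<in> limit_set a b" by (rule AE_I2) simp
  ultimately show ?thesis
  proof eventually_elim
    case (elim x)
    interpret k: prob_space "\<kappa> x" by (rule prob_space_\<kappa>[OF elim(2)])
    interpret n: prob_space "distr M borel pt" by (rule prob_space_distr) measurable
    have space: "space (\<kappa> x) = J" by (simp add: space_\<kappa> elim J_def)
    have ksets: "U \<inter> J \<in> sets (\<kappa> x)" if "open U" for U using open_sets[OF that] by (simp add: sets_\<kappa> elim)
    have C3: "0 \<le> C ^ 3" using C_ge_1 by simp
    have nu: "measure (distr M borel pt) U = prob {\<tau>. pt \<tau> \<in> U}" if "open U" for U
      using that by (subst measure_distr) (auto simp: vimage_def)
    have mass: "ball_mass y r = measure (distr M borel pt) (ball y r)" for y r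
      unfolding nu[OF open_ball] by (simp add: ball_mass_def)
    have step: "measure (\<kappa> x) (ball y s \<inter> J) \<le> C ^ 3 * measure (distr M borel pt) (ball y r) \<and>
        measure (distr M borel pt) (ball y s) \<le> C ^ 3 * measure (\<kappa> x) (ball y r \<inter> J)" if "s < r" for y r s
    proof -
      obtain p where p: "y - r < of_rat p" "of_rat p < y - s" using of_rat_dense[of "y - r" "y - s"] \<open>s < r\<close> by auto
      obtain q where q: "y + s < of_rat q" "of_rat q < y + r" using of_rat_dense[of "y + s" "y + r"] \<open>s < r\<close> by auto
      let ?I = "{of_rat p<..<of_rat q} :: real set"
      have sub: "ball y s \<subseteq> ?I" "?I \<subseteq> ball y r" using p q by (auto simp: ball_eq_greaterThanLessThan)
      have I: "measure (\<kappa> x) (?I \<inter> J) \<le> C ^ 3 * measure (distr M borel pt) ?I"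
        "measure (distr M borel pt) ?I \<le> C ^ 3 * measure (\<kappa> x) (?I \<inter> J)"
        using elim(1)[rule_format, of p q] pt_J by (simp_all add: nu)
      have "measure (\<kappa> x) (ball y s \<inter> J) \<le> measure (\<kappa> x) (?I \<inter> J)"
        using sub(1) by (intro k.finite_measure_mono ksets) auto
      moreover have "measure (distr M borel pt) ?I \<le> measure (distr M borel pt) (ball y r)"
        using sub(2) by (intro n.finite_measure_mono) auto
      moreover have "measure (distr M borel pt) (ball y s) \<le> measure (distr M borel pt) ?I"
        using sub(1) by (intro n.finite_measure_mono) auto
      moreover have "measure (\<kappa> x) (?I \<inter> J) \<le> measure (\<kappa> x) (ball y r \<inter> J)"
        using sub(2) by (intro k.finite_measure_mono ksets) auto
      ultimately show ?thesis using I C3 by (meson mult_left_mono order_trans)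
    qed
    have "measure (\<kappa> x) (ball y r \<inter> J) \<le> C ^ 3 * ball_mass y r" for y r
      unfolding mass by (rule measure_ball_le) (use step ksets in \<open>auto intro: k.finite_measure_axioms\<close>)
    moreover have "ball_mass y r \<le> C ^ 3 * measure (\<kappa> x) (ball y r \<inter> J)" for y r
      using measure_ball_le[of "distr M borel pt" y UNIV r "C ^ 3 * measure (\<kappa> x) (ball y r \<inter> J)"] step
      unfolding mass by (auto intro: n.finite_measure_axioms)
    ultimately show ?case unfolding comparable_def space using elim by blast
  qed
qed

text \<open>The radii \<open>exp (- n)\<close> are enough to determine the local dimension and keep this property measurable.\<close>

definition typical :: "real \<Rightarrow> real \<Rightarrow> bool" where
  "typical d y \<longleftrightarrow> (\<forall>n::nat. 0 < ball_mass y (exp (- real n))) \<and>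
     (\<lambda>n. - ln (ball_mass y (exp (- real n))) / real n) \<longlonglongrightarrow> d"

lemma ball_mass_measurable [measurable]: "(\<lambda>y. ball_mass y r) \<in> borel_measurable borel"
proof -
  interpret n: prob_space "distr M borel pt" by (rule prob_space_distr) measurable
  let ?Q = "{z\<in>space (borel \<Otimes>\<^sub>M distr M borel pt). dist (fst z) (snd z) < r}"
  have "?Q \<in> sets (borel \<Otimes>\<^sub>M distr M borel pt)" by measurable
  then have meas: "(\<lambda>y. emeasure (distr M borel pt) (Pair y -` ?Q)) \<in> borel_measurable borel"
    by (rule n.measurable_emeasure_Pair)
  have eq: "emeasure (distr M borel pt) (Pair y -` ?Q) = ennreal (ball_mass y r)" for y
  proof -
    have "Pair y -` ?Q = {x. dist y x < r}" by (auto simp: space_pair_measure)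
    moreover have "{x. dist y x < r} \<in> sets borel" by measurable
    ultimately show ?thesis by (simp add: emeasure_distr ball_mass_def emeasure_eq_measure vimage_def)
  qed
  have "(\<lambda>y. ennreal (ball_mass y r)) \<in> borel_measurable borel" using meas unfolding eq .
  then have "(\<lambda>y. enn2real (ennreal (ball_mass y r))) \<in> borel_measurable borel" by measurable
  then show ?thesis by (simp add: ball_mass_def)
qed

lemma typical_set: "{y. typical d y} \<in> sets borel"
proof -
  have "{y\<in>space borel. typical d y} \<in> sets borel" unfolding typical_def by measurable
  then show ?thesis by simp
qed

lemma AE_typical:
  assumes "AE \<tau> in M. ((\<lambda>r. ln (ball_mass (pt \<tau>) r) / ln r) \<longlongrightarrow> d) (at_right 0)"
  shows "AE \<tau> in M. typical d (pt \<tau>)"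
  using assms
proof eventually_elim
  case (elim \<tau>)
  have "filterlim (\<lambda>n. exp (- real n)) (at_right 0) sequentially"
    unfolding filterlim_at
  proof
    show "(\<lambda>n. exp (- real n)) \<longlonglongrightarrow> 0"
      by (rule filterlim_compose[OF exp_at_bot])
        (rule filterlim_compose[OF filterlim_uminus_at_bot_at_top filterlim_real_sequentially])
  qed simp
  from filterlim_compose[OF elim this] show ?case
    by (auto simp: typical_def ball_mass_pos)
qed

lemma AE_\<mu>_typical:
  assumes "AE \<tau> in M. ((\<lambda>r. ln (ball_mass (pt \<tau>) r) / ln r) \<longlongrightarrow> d) (at_right 0)"
  shows "AE z in \<mu>. typical d (snd z)"
proof -
  have "{z\<in>space coded_space. snd z \<in> {y. typical d y}} \<in> sets coded_space"
    using typical_set[of d] by measurable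
  then have "(AE z in distr M coded_space (coding2 a b). typical d (snd z)) \<longleftrightarrow> (AE \<tau> in M. typical d (snd (coding2 a b \<tau>)))"
    by (intro AE_distr_iff measurable_coding2_M) simp
  then have "AE z in distr M coded_space (coding2 a b). typical d (snd z)"
    using AE_typical[OF assms] by (simp add: coding2_eq pt_def)
  then show ?thesis unfolding \<mu>_def .
qed

text \<open>The exceptional points form a null set of the second marginal of \<open>\<mu>\<close>, which by disintegration is
  null for almost every conditional measure.\<close>

lemma AE_\<kappa>_typical:
  assumes "AE \<tau> in M. ((\<lambda>r. ln (ball_mass (pt \<tau>) r) / ln r) \<longlongrightarrow> d) (at_right 0)"
  shows "AE x in base_law. AE y in \<kappa> x. typical d y"
proof -
  interpret m: prob_space \<mu> by (rule prob_space_\<mu>)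
  define B where "B = {y\<in>closure (limit_set a b). \<not> typical d y}"
  have "- {y. typical d y} \<in> sets borel" using typical_set[of d] by (rule borel_comp)
  moreover have "B = closure (limit_set a b) \<inter> - {y. typical d y}" unfolding B_def by blast
  ultimately have B: "B \<in> sets (fibre_space a b)"
    unfolding fibre_space_def sets_restrict_space by (rule image_eqI[rotated])
  have J: "limit_set a b \<in> sets (base_space a b)" using sets.top[of "base_space a b"] by (simp add: space_base)
  have JB: "limit_set a b \<times> B \<in> sets coded_space" using J B by (rule pair_measureI)
  have "AE z in \<mu>. z \<notin> limit_set a b \<times> B"
    using AE_\<mu>_typical[OF assms] by eventually_elim (auto simp: B_def)
  moreover have "{z\<in>space \<mu>. \<not> z \<notin> limit_set a b \<times> B} = limit_set a b \<times> B"
    using sets.sets_into_space[OF JB] by auto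
  ultimately have "emeasure \<mu> (limit_set a b \<times> B) = 0"
    using AE_iff_measurable[of "limit_set a b \<times> B" \<mu> "\<lambda>z. z \<notin> limit_set a b \<times> B"] JB by simp
  then have "(\<integral>\<^sup>+x. emeasure (\<kappa> x) (Pair x -` (limit_set a b \<times> B)) \<partial>base_law) = 0"
    using disintegration[OF JB] by simp
  also have "(\<integral>\<^sup>+x. emeasure (\<kappa> x) (Pair x -` (limit_set a b \<times> B)) \<partial>base_law) = (\<integral>\<^sup>+x. emeasure (\<kappa> x) B \<partial>base_law)"
  proof (rule nn_integral_cong)
    fix x assume "x \<in> space base_law"
    then have "Pair x -` (limit_set a b \<times> B) = B" by auto
    then show "emeasure (\<kappa> x) (Pair x -` (limit_set a b \<times> B)) = emeasure (\<kappa> x) B" by simp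
  qed
  finally have "AE x in base_law. emeasure (\<kappa> x) B = 0"
    using nn_integral_0_iff_AE[OF measurable_emeasure_\<kappa>[OF B]] by simp
  moreover have "AE x in base_law. x \<in> limit_set a b" by (rule AE_I2) simp
  ultimately show ?thesis
  proof eventually_elim
    case (elim x)
    show ?case
      by (rule AE_I[of _ _ B]) (use elim B in \<open>auto simp: B_def sets_\<kappa> space_\<kappa>\<close>)
  qed
qed

lemma local_dimension_at_typical:
  assumes "comparable x" "typical d y"
  shows "has_local_dimension (\<kappa> x) y (ereal d)"
proof -
  have pos: "0 < ball_mass y r" if "0 < r" for r
  proof -
    obtain n :: nat where "- ln r < real n" using reals_Archimedean2 by blast
    then have "exp (- real n) \<le> r" using that by (metis exp_le_cancel_iff exp_ln less_imp_le minus_less_iff)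
    then show ?thesis using assms(2) ball_mass_mono unfolding typical_def by (meson less_le_trans)
  qed
  have "((\<lambda>r. ln (ball_mass y r) / ln r) \<longlongrightarrow> d) (at_right 0)"
    using assms(2) unfolding typical_def
    by (intro log_ratio_along_powers pos ball_mass_le_1 ball_mass_mono) auto
  then have "((\<lambda>r. ln (measure (\<kappa> x) (ball y r \<inter> space (\<kappa> x))) / ln r) \<longlongrightarrow> d) (at_right 0)"
    by (rule log_ratio_comparable[rotated 4, where D = "C ^ 3"])
      (use assms(1) pos C_ge_1 in \<open>auto simp: comparable_def\<close>)
  then show ?thesis unfolding has_local_dimension_def by (rule tendsto_ereal)
qed

lemma AE_local_dimension:
  assumes "\<not> (gibbs_entropy = \<infinity> \<and> mean_contraction = \<infinity>)"
  shows "\<exists>d::real. gibbs_entropy / mean_contraction = ereal d \<and>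
    (AE \<tau> in M. ((\<lambda>r. ln (ball_mass (pt \<tau>) r) / ln r) \<longlongrightarrow> d) (at_right 0))"
proof (cases "mean_contraction = \<infinity>")
  case True
  then have "gibbs_entropy \<noteq> \<infinity>" using assms by simp
  moreover have "gibbs_entropy / mean_contraction = ereal 0" by (simp add: True zero_ereal_def[symmetric])
  ultimately show ?thesis using AE_local_dimension_infinite_exponent True by blast
next
  case False
  then obtain l where l: "mean_contraction = ereal l" using mean_contraction_pos by (cases mean_contraction) auto
  obtain h where h: "gibbs_entropy = ereal h" using gibbs_entropy_finite[OF False] gibbs_entropy_nonneg by (cases gibbs_entropy) auto
  have "l \<noteq> 0" using mean_contraction_pos l by simp
  then have "gibbs_entropy / mean_contraction = ereal (h / l)" by (simp add: h l)
  then show ?thesis using AE_local_dimension_finite[OF h l] by blast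
qed

end

theorem corollary5p2:
  fixes a b :: "'e::countable \<Rightarrow> real"
    and \<phi> :: "real \<times> real \<Rightarrow> real"
    and \<mu> :: "(real \<times> real) measure"
    and \<kappa> :: "real \<Rightarrow> real measure"
  assumes luroth: "luroth_system a b"
    and potential:
      "(locally_holder_two_sided (\<phi> \<circ> coding2 a b) \<and> summable_potential (\<phi> \<circ> coding2 a b)) \<or>
       (locally_holder_potential a b \<phi> \<and> summable_potential (\<phi> \<circ> coding2 a b)) \<or>
       (\<exists>\<theta> :: real \<Rightarrow> real.
          (\<forall>x\<in>limit_set a b. \<forall>y\<in>closure (limit_set a b). \<phi> (x, y) = \<theta> x) \<and>
          locally_holder_one_sided (\<theta> \<circ> coding a b) \<and>
          summable_potential (\<theta> \<circ> coding a b))"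
    and equilibrium: "equilibrium_measure a b \<phi> \<mu>"
    and conditional: "conditional_measures (base_space a b) (fibre_space a b) \<mu> \<kappa>"
    and quotient_defined:
      "\<not> (ks_entropy \<mu> (natural_extension a b) = \<infinity> \<and> lyapunov_exponent a b \<mu> = \<infinity>)"
  shows
    "(AE x in distr \<mu> (base_space a b) fst. exact_dimensional (\<kappa> x)) \<and>
     (AE x in distr \<mu> (base_space a b) fst. AE y in \<kappa> x.
        has_local_dimension (\<kappa> x) y
          (ks_entropy \<mu> (natural_extension a b) / lyapunov_exponent a b \<mu>)) \<and>
     (AE (x, y) in \<mu>.
        has_local_dimension (\<kappa> x) y
          (ks_entropy \<mu> (natural_extension a b) / lyapunov_exponent a b \<mu>))"
proof -
  interpret luroth a b by (rule luroth.intro) (rule luroth)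
  have holder: "locally_holder_two_sided (\<phi> \<circ> coding2 a b)"
    using potential
  proof (elim disjE exE conjE)
    fix \<theta> :: "real \<Rightarrow> real"
    assume \<theta>: "\<forall>x\<in>limit_set a b. \<forall>y\<in>closure (limit_set a b). \<phi> (x, y) = \<theta> x"
      and "locally_holder_one_sided (\<theta> \<circ> coding a b)"
    then obtain D \<beta> where "0 < D" "0 < \<beta>" and
      H: "\<And>n \<omega> \<tau>. (\<forall>k\<le>n. \<omega> k = \<tau> k) \<Longrightarrow> \<bar>(\<theta> \<circ> coding a b) \<omega> - (\<theta> \<circ> coding a b) \<tau>\<bar> \<le> D * exp (- \<beta> * real n)"
      unfolding locally_holder_one_sided_def by blast
    have eq: "(\<phi> \<circ> coding2 a b) \<tau> = (\<theta> \<circ> coding a b) (future \<tau>)" for \<tau>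
      using \<theta> by (simp add: coding2_eq coding_in_limit_set limit_set_subset_closure)
    have "\<bar>(\<phi> \<circ> coding2 a b) \<omega> - (\<phi> \<circ> coding2 a b) \<tau>\<bar> \<le> D * exp (- \<beta> * real n)"
      if "\<forall>k. \<bar>k\<bar> \<le> int n \<longrightarrow> \<omega> k = \<tau> k" for n \<omega> \<tau>
      unfolding eq using that by (intro H) (simp add: future_def)
    then show ?thesis unfolding locally_holder_two_sided_def using \<open>0 < D\<close> \<open>0 < \<beta>\<close> by blast
  qed (simp_all add: locally_holder_potential_def)
  obtain M where gibbs: "invariant_gibbs_state (\<phi> \<circ> coding2 a b) M"
    and \<mu>: "\<mu> = distr M (base_space a b \<Otimes>\<^sub>M fibre_space a b) (coding2 a b)"
    using equilibrium unfolding equilibrium_measure_def by blast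
  define F where "F = (\<lambda>\<tau>. pressure (\<phi> \<circ> coding2 a b) - (\<phi> \<circ> coding2 a b) \<tau>)"
  obtain C where "gibbs_shift M F C"
    using gibbs_shift_of_gibbs_state[OF gibbs holder] unfolding F_def by blast
  then interpret G: luroth_gibbs a b M F C by (intro luroth_gibbs.intro luroth_axioms)
  have \<mu>_eq: "\<mu> = G.\<mu>" unfolding \<mu> G.\<mu>_def ..
  interpret K: luroth_conditional a b M F C \<kappa>
    by unfold_locales (use conditional in \<open>simp add: \<mu>_eq\<close>)
  let ?q = "ks_entropy \<mu> (natural_extension a b) / lyapunov_exponent a b \<mu>"
  have q: "?q = G.gibbs_entropy / G.mean_contraction"
    by (simp add: \<mu>_eq G.ks_entropy_eq G.lyapunov_exponent_eq)
  have "\<not> (G.gibbs_entropy = \<infinity> \<and> G.mean_contraction = \<infinity>)"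
    using quotient_defined by (simp add: \<mu>_eq G.ks_entropy_eq G.lyapunov_exponent_eq)
  then obtain d where d: "?q = ereal d"
    and lim: "AE \<tau> in M. ((\<lambda>r. ln (G.ball_mass (G.pt \<tau>) r) / ln r) \<longlongrightarrow> d) (at_right 0)"
    using K.AE_local_dimension unfolding q by blast
  have base: "distr \<mu> (base_space a b) fst = G.base_law" unfolding \<mu>_eq G.base_law_def ..
  have fibre: "AE x in G.base_law. AE y in \<kappa> x. has_local_dimension (\<kappa> x) y (ereal d)"
    using K.AE_comparable K.AE_\<kappa>_typical[OF lim]
  proof eventually_elim
    case (elim x)
    show ?case using elim(2) by eventually_elim (rule K.local_dimension_at_typical[OF elim(1)])
  qed
  have "AE z in \<mu>. K.comparable (fst z)"
    using K.AE_comparable unfolding G.base_law_def \<mu>_eq by (rule AE_distrD[OF G.fst_\<mu>])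
  then have "AE z in \<mu>. has_local_dimension (\<kappa> (fst z)) (snd z) (ereal d)"
    using K.AE_\<mu>_typical[OF lim] unfolding \<mu>_eq
    by eventually_elim (rule K.local_dimension_at_typical)
  then have joint: "AE (x, y) in \<mu>. has_local_dimension (\<kappa> x) y (ereal d)" by (simp add: case_prod_beta')
  have "AE x in G.base_law. exact_dimensional (\<kappa> x)"
    using fibre by eventually_elim (auto simp: exact_dimensional_def)
  then show ?thesis unfolding base d using fibre joint by blast
qed

end
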